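(* Let $\mathbb{H}$ be a complex Hilbert space, let $A$ be a sectorial operator of type $\omega\in(0,\pi)$ on $\mathbb{H}$, and suppose that $A$ is one-one. Let $\theta\in(\omega,\pi)$ and $0<\alpha<\frac{\theta-\omega}{2}$, and let $F$ and $G$ be two nonzero functions in $H^\infty_0(\Sigma_\theta)$. Then the area integral function of $F$ and the square function of $G$ are equivalent: there is a constant $C>0$ such that $$C^{-1}\|x\|_{G}\le\|x\|_{F,\alpha}\le C\|x\|_{G},\qquad\forall x\in\mathbb{H},$$ where the quantities are allowed to take the value $+\infty$.
   Context: Sectors: for $\omega\in(0,\pi)$, $\Sigma_\omega=\{z\in\mathbb{C}\setminus\{0\}: |\mathrm{Arg}(z)|<\omega\}$. Sectorial operators: a closed densely defined operator $A$ on $\mathbb{H}$ is sectorial of type $\omega\in(0,\pi)$ if its spectrum satisfies $\sigma(A)\subset\overline{\Sigma}_\omega$ and for every $\theta'\in(\omega,\pi)$ there is a constant $K_{\theta'}>0$ with $\|zR(z,A)\|\le K_{\theta'}$ for all $z\in\mathbb{C}\setminus\overline{\Sigma}_{\theta'}$, where $R(z,A)=(z-A)^{-1}$. Function spaces: for $\theta\in(0,\pi)$, $H^\infty_0(\Sigma_\theta)$ is the algebra of bounded analytic functions $f:\Sigma_\theta\to\mathbb{C}$ for which there exist $s,c>0$ with $|f(z)|\le c\,|z|^s/(1+|z|)^{2s}$ for all $z\in\Sigma_\theta$. Functional calculus: if $A$ is sectorial of type $\omega$, $\theta\in(\omega,\pi)$ and $f\in H^\infty_0(\Sigma_\theta)$,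 then $f(A)=\frac{1}{2\pi i}\int_{\Gamma_\gamma}f(z)R(z,A)\,dz$, a bounded operator on $\mathbb{H}$, where $\gamma\in(\omega,\theta)$ and $\Gamma_\gamma$ is the boundary of $\Sigma_\gamma$ oriented counterclockwise ($\Gamma_\gamma(t)=-te^{i\gamma}$ for $t\le 0$ and $te^{-i\gamma}$ for $t\ge0$); this is independent of $\gamma$. Square and area integral functions: for $F\in H^\infty_0(\Sigma_\theta)$, $0<\alpha<\frac{\theta-\omega}{2}$ and $z\in\Sigma_\alpha$, let $F_z(w)=F(zw)$ for $w\in\Sigma_{\theta-\alpha}$; then $F_z\in H^\infty_0(\Sigma_{\theta-\alpha})$ with $\theta-\alpha>\omega$, and $F(zA)$ means $F_z(A)$ (in particular for $z=t>0$). With $dm$ the Lebesgue measure on $\mathbb{R}^2\cong\mathbb{C}$, for $x\in\mathbb{H}$, $$\|x\|_{F}=\left(\int_0^\infty\|F(tA)x\|^2\,\frac{dt}{t}\right)^{1/2},\qquad \|x\|_{F,\alpha}=\left(\int_{\Sigma_\alpha}\|F(zA)x\|^2\,\frac{dm(z)}{|z|^2}\right)^{1/2},$$ both with values in $[0,\infty]$. $\|x\|_G$ is defined in the same way as $\|x\|_F$. *)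

theory Defs
  imports "HOL-Analysis.Analysis"
begin

section \<open>Complex Hilbert spaces\<close>

text \<open>
  The library only has real inner product spaces.  A complex Hilbert space is a complete real
  inner product space with a compatible complex scalar multiplication and a Hermitian form whose
  real part is the real inner product; norm and topology are those of the underlying real space.
\<close>

class complex_hilbert = real_inner + banach +
  fixes scaleC :: "complex \<Rightarrow> 'a \<Rightarrow> 'a" (infixr "*\<^sub>C" 75)
    and cinner :: "'a \<Rightarrow> 'a \<Rightarrow> complex"
  assumes scaleC_add_right: "c *\<^sub>C (x + y) = c *\<^sub>C x + c *\<^sub>C y"
    and scaleC_add_left: "(c + d) *\<^sub>C x = c *\<^sub>C x + d *\<^sub>C x"
    and scaleC_scaleC: "c *\<^sub>C (d *\<^sub>C x) = (c * d) *\<^sub>C x"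
    and scaleC_of_real: "complex_of_real r *\<^sub>C x = r *\<^sub>R x"
    and cinner_commute: "cinner x y = cnj (cinner y x)"
    and cinner_add_left: "cinner (x + y) z = cinner x z + cinner y z"
    and cinner_scaleC_left: "cinner (c *\<^sub>C x) y = c * cinner x y"
    and Re_cinner: "Re (cinner x y) = inner x y"

instantiation complex :: complex_hilbert
begin

definition scaleC_complex :: "complex \<Rightarrow> complex \<Rightarrow> complex"
  where "scaleC_complex c x = c * x"

definition cinner_complex :: "complex \<Rightarrow> complex \<Rightarrow> complex"
  where "cinner_complex x y = x * cnj y"

instance
  by standard
    (auto simp: scaleC_complex_def cinner_complex_def algebra_simps scaleR_conv_of_real
      inner_complex_def)

end

text \<open>
  Bounded operators are elements of the real-linear type \<open>'a \<Rightarrow>\<^sub>L 'a\<close>, whose norm is the operator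
  norm; all operators built below are in fact complex linear.
\<close>

definition scaleC_op :: "complex \<Rightarrow> ('a::complex_hilbert \<Rightarrow>\<^sub>L 'a) \<Rightarrow> ('a \<Rightarrow>\<^sub>L 'a)"
  where "scaleC_op c T = Blinfun (\<lambda>x. c *\<^sub>C blinfun_apply T x)"


section \<open>Sectorial operators\<close>

text \<open>
  An unbounded operator is given by its domain \<open>D\<close> and a function \<open>A\<close> whose values outside \<open>D\<close>
  are irrelevant.
\<close>

definition closed_densely_defined :: "'a::complex_hilbert set \<Rightarrow> ('a \<Rightarrow> 'a) \<Rightarrow> bool"
  where "closed_densely_defined D A \<longleftrightarrow>
    0 \<in> D \<and> (\<forall>x\<in>D. \<forall>y\<in>D. x + y \<in> D \<and> A (x + y) = A x + A y) \<and>
    (\<forall>c. \<forall>x\<in>D. c *\<^sub>C x \<in> D \<and> A (c *\<^sub>C x) = c *\<^sub>C A x) \<and>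
    closed {(x, A x) | x. x \<in> D} \<and> closure D = UNIV"

definition resolvent_set :: "'a::complex_hilbert set \<Rightarrow> ('a \<Rightarrow> 'a) \<Rightarrow> complex set"
  where "resolvent_set D A =
    {z. bij_betw (\<lambda>x. z *\<^sub>C x - A x) D UNIV \<and>
        bounded_linear (inv_into D (\<lambda>x. z *\<^sub>C x - A x))}"

definition op_spectrum :: "'a::complex_hilbert set \<Rightarrow> ('a \<Rightarrow> 'a) \<Rightarrow> complex set"
  where "op_spectrum D A = - resolvent_set D A"

text \<open>Meaningful only for \<open>z\<close> in the resolvent set.\<close>

definition resolvent :: "'a::complex_hilbert set \<Rightarrow> ('a \<Rightarrow> 'a) \<Rightarrow> complex \<Rightarrow> ('a \<Rightarrow>\<^sub>L 'a)"
  where "resolvent D A z = Blinfun (inv_into D (\<lambda>x. z *\<^sub>C x - A x))"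

definition sector :: "real \<Rightarrow> complex set"
  where "sector \<omega> = {z. z \<noteq> 0 \<and> \<bar>Arg z\<bar> < \<omega>}"

definition sectorial :: "real \<Rightarrow> 'a::complex_hilbert set \<Rightarrow> ('a \<Rightarrow> 'a) \<Rightarrow> bool"
  where "sectorial \<omega> D A \<longleftrightarrow>
    closed_densely_defined D A \<and> op_spectrum D A \<subseteq> closure (sector \<omega>) \<and>
    (\<forall>\<theta>'\<in>{\<omega><..<pi}. \<exists>K>0. \<forall>z\<in>- closure (sector \<theta>'). norm (scaleC_op z (resolvent D A z)) \<le> K)"


section \<open>Functional calculus\<close>

text \<open>Only the values of the functions on the sector matter.\<close>

definition Hinf0 :: "real \<Rightarrow> (complex \<Rightarrow> complex) set"
  where "Hinf0 \<theta> = {f. f holomorphic_on sector \<theta> \<and> bounded (f ` sector \<theta>) \<and>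
    (\<exists>s>0. \<exists>c>0. \<forall>z\<in>sector \<theta>. cmod (f z) \<le> c * (cmod z powr s / (1 + cmod z) powr (2 * s)))}"

definition sector_path :: "real \<Rightarrow> real \<Rightarrow> complex"
  where "sector_path \<gamma> t =
    (if t \<le> 0 then - complex_of_real t * cis \<gamma> else complex_of_real t * cis (- \<gamma>))"

text \<open>
  The integral is the gauge integral in the Banach space of bounded operators, which needs no
  separability; for the norm-absolutely convergent integrals at hand it is the usual one.  The
  integrand at the single parameter \<open>t = 0\<close> (the vertex of the contour) is irrelevant.
\<close>

definition sector_integral ::
    "'a::complex_hilbert set \<Rightarrow> ('a \<Rightarrow> 'a) \<Rightarrow> real \<Rightarrow> (complex \<Rightarrow> complex) \<Rightarrow> ('a \<Rightarrow>\<^sub>L 'a)"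
  where "sector_integral D A \<gamma> f =
    integral UNIV (\<lambda>t. scaleC_op
      (f (sector_path \<gamma> t) * vector_derivative (sector_path \<gamma>) (at t))
      (resolvent D A (sector_path \<gamma> t)))"

text \<open>
  \<open>f(A)\<close> for \<open>A\<close> sectorial of type \<open>\<omega>\<close> and \<open>f \<in> Hinf0 \<theta>\<close>.  The value does not depend on which
  \<open>\<gamma>\<close> strictly between \<open>\<omega>\<close> and \<open>\<theta>\<close> is chosen.
\<close>

definition fun_calc ::
    "'a::complex_hilbert set \<Rightarrow> ('a \<Rightarrow> 'a) \<Rightarrow> real \<Rightarrow> real \<Rightarrow> (complex \<Rightarrow> complex) \<Rightarrow> ('a \<Rightarrow>\<^sub>L 'a)"
  where "fun_calc D A \<omega> \<theta> f =
    (let \<gamma> = (SOME \<gamma>. \<omega> < \<gamma> \<and> \<gamma> < \<theta>)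
     in scaleC_op (1 / (2 * complex_of_real pi * \<i>)) (sector_integral D A \<gamma> f))"


section \<open>Square and area integral functions\<close>

definition ennsqrt :: "ennreal \<Rightarrow> ennreal"
  where "ennsqrt a = (if a = \<infinity> then \<infinity> else ennreal (sqrt (enn2real a)))"

text \<open>
  For \<open>t > 0\<close> the dilation \<open>w \<mapsto> F (t w)\<close> is again defined on the whole sector of angle \<open>\<theta>\<close>,
  whereas for \<open>z\<close> in the sector of angle \<open>\<alpha>\<close> it is defined on the sector of angle \<open>\<theta> - \<alpha>\<close>.
\<close>

definition square_fn ::
    "'a::complex_hilbert set \<Rightarrow> ('a \<Rightarrow> 'a) \<Rightarrow> real \<Rightarrow> real \<Rightarrow> (complex \<Rightarrow> complex) \<Rightarrow> 'a \<Rightarrow> ennreal"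
  where "square_fn D A \<omega> \<theta> F x = ennsqrt
    (\<integral>\<^sup>+t\<in>{0<..}. ennreal
        ((norm (blinfun_apply (fun_calc D A \<omega> \<theta> (\<lambda>w. F (complex_of_real t * w))) x))\<^sup>2 / t) \<partial>lborel)"

definition area_fn ::
    "'a::complex_hilbert set \<Rightarrow> ('a \<Rightarrow> 'a) \<Rightarrow> real \<Rightarrow> real \<Rightarrow> real \<Rightarrow> (complex \<Rightarrow> complex) \<Rightarrow> 'a \<Rightarrow> ennreal"
  where "area_fn D A \<omega> \<theta> \<alpha> F x = ennsqrt
    (\<integral>\<^sup>+z\<in>sector \<alpha>. ennreal
        ((norm (blinfun_apply (fun_calc D A \<omega> (\<theta> - \<alpha>) (\<lambda>w. F (z * w))) x))\<^sup>2 / (cmod z)\<^sup>2) \<partial>lborel)"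

end

theory Submission
  imports Defs "HOL-Complex_Analysis.Complex_Analysis" "HOL-Real_Asymp.Real_Asymp"
begin

text \<open>
  The substitution \<open>z = exp w\<close> turns the sector of angle \<open>\<theta>\<close> into the strip \<open>\<bar>Im w\<bar> < \<theta>\<close>, dilations
  into translations, \<open>dt / t\<close> into Lebesgue measure on the line, and the functions of \<open>Hinf0 \<theta>\<close> into
  holomorphic functions on the strip that decay exponentially at both ends.  The scaled resolvent
  \<open>S(w) = exp w R(exp w, A)\<close> is bounded on every smaller set \<open>\<gamma> \<le> \<bar>Im w\<bar> < \<pi>\<close> with \<open>\<omega> < \<gamma>\<close>, and \<open>2 \<pi> i f(A)\<close>
  is the integral of \<open>f(exp w) S(w)\<close> along the line \<open>Im w = -\<gamma>\<close> minus that along \<open>Im w = \<gamma>\<close>.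

  Since \<open>\<alpha> < \<pi> / 2\<close>, the sector of angle \<open>\<alpha>\<close> is swept out by the rays through \<open>1 + i \<tau>\<close> with
  \<open>\<bar>\<tau>\<bar> < tan \<alpha>\<close>, and Fubini's theorem shows that the square of the area integral function of \<open>F\<close> is
  the integral of the squared square functions of the rotated functions \<open>w \<mapsto> F((1 + i \<tau>) w)\<close> against
  the finite measure \<open>d\<tau> / (1 + \<tau>\<^sup>2)\<close> (\<open>area_fn_eq\<close>).  Hence it suffices to compare each of these
  square functions with the square function of \<open>G\<close>, with constants that do not depend on the ray
  (\<open>square_functions_comparable\<close>).

  To bound the square function of \<open>P\<close> by that of a nonzero \<open>Q\<close>, write \<open>p\<close>, \<open>q\<close> for the functions on the
  strip and let \<open>q\<^sup>*(w)\<close> be the conjugate of \<open>q\<close> at the conjugate of \<open>w\<close>.  By Cauchy's theorem the integral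
  of \<open>q\<^sup>*(s + w) q(s + w)\<close> over real \<open>s\<close> does not depend on \<open>w\<close>, so it is the positive number
  \<open>c = \<integral>\<bar>q\<bar>\<^sup>2\<close> (\<open>reproducing_constant\<close>).  Therefore \<open>c P(A)\<close> is the integral over \<open>s\<close> of the operators
  given by \<open>p q\<^sup>*(s + \<sqdot>) q(s + \<sqdot>)\<close>, and multiplicativity of the calculus (\<open>product_formula\<close>) lets the
  factor \<open>q(s + \<sqdot>)\<close> act first, as \<open>Q(exp s A)\<close>.  The norm of the remaining operator is at most a constant times
  \<open>\<integral>\<bar>p\<bar> \<bar>q\<^sup>*(s + \<sqdot>)\<bar>\<close> (\<open>reproducing_estimate\<close>).  For the dilates of \<open>P\<close> this is a kernel with
  uniformly bounded row and column integrals, and Schur's test finishes the comparison.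

  Multiplicativity is derived from the resolvent identity with two different contours, which turns
  the double integral into scalar Cauchy integrals; the one with a pole is \<open>cauchy_strip\<close>.  It is
  combined with the independence of the contour (\<open>contour_independent\<close>), since the square and the
  area integral function use different contours.  The space may be non-separable, so the
  operator-valued integral is only used to extract from it the scalar integrals of
  \<open>f(exp w) \<langle>S(w) x, y\<rangle>\<close> (\<open>contour_calc_weak\<close>), to which Lebesgue integration applies.
\<close>

section \<open>Complex Hilbert spaces\<close>

lemma scaleC_one [simp]: "1 *\<^sub>C (x::'a::complex_hilbert) = x"
  using scaleC_of_real[of 1 x] by simp

lemma scaleC_zero_left [simp]: "0 *\<^sub>C (x::'a::complex_hilbert) = 0"
  using scaleC_of_real[of 0 x] by simp

lemma scaleC_scaleR: "c *\<^sub>C (r *\<^sub>R x) = r *\<^sub>R (c *\<^sub>C (x::'a::complex_hilbert))"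
  by (metis mult.commute scaleC_of_real scaleC_scaleC)

lemma cinner_scaleC_right: "cinner x (c *\<^sub>C y) = cnj c * cinner x (y::'a::complex_hilbert)"
  by (metis cinner_commute cinner_scaleC_left complex_cnj_mult complex_cnj_cnj)

lemma scaleC_diff_right: "c *\<^sub>C (x - y) = c *\<^sub>C x - c *\<^sub>C (y::'a::complex_hilbert)"
  using scaleC_add_right[of c "x - y" y] by (simp add: algebra_simps)

lemma cinner_diff_left: "cinner (x - y) z = cinner x z - cinner y (z::'a::complex_hilbert)"
  using cinner_add_left[of "x - y" y z] by simp

lemma norm_scaleC: "norm (c *\<^sub>C (x::'a::complex_hilbert)) = cmod c * norm x"
proof -
  have "cinner (c *\<^sub>C x) (c *\<^sub>C x) = of_real ((cmod c)\<^sup>2) * cinner x x"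
    unfolding complex_norm_square by (simp add: cinner_scaleC_left cinner_scaleC_right)
  then have "inner (c *\<^sub>C x) (c *\<^sub>C x) = (cmod c)\<^sup>2 * inner x x"
    by (metis Re_cinner Re_complex_of_real mult.commute scaleR_complex.simps(1) scaleR_conv_of_real)
  then have "(norm (c *\<^sub>C x))\<^sup>2 = (cmod c * norm x)\<^sup>2"
    by (simp add: power2_norm_eq_inner power_mult_distrib)
  then show ?thesis
    by simp
qed

text \<open>
  Rotating \<open>x\<close> by a unimodular scalar makes the form real and nonnegative, which reduces the inequality
  to the one for the real inner product.
\<close>

lemma cmod_cinner_le: "cmod (cinner x y) \<le> norm x * norm (y::'a::complex_hilbert)"
proof -
  define c where "c = cnj (sgn (cinner x y))"
  have "complex_of_real (cmod (cinner x y)) = c * cinner x y"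
    unfolding c_def by (simp add: sgn_eq mult.commute complex_norm_square[symmetric] power2_eq_square)
  then have "cmod (cinner x y) = Re (cinner (c *\<^sub>C x) y)"
    by (metis Re_complex_of_real cinner_scaleC_left)
  also have "\<dots> \<le> norm (c *\<^sub>C x) * norm y"
    unfolding Re_cinner using norm_cauchy_schwarz by blast
  also have "\<dots> \<le> norm x * norm y"
    unfolding norm_scaleC c_def by (auto simp: norm_sgn mult_right_mono)
  finally show ?thesis .
qed

lemma bounded_linear_scaleC_right: "bounded_linear (\<lambda>x. c *\<^sub>C (x::'a::complex_hilbert))"
  by (rule bounded_linear_intro[where K = "cmod c"])
    (auto simp: scaleC_add_right scaleC_scaleR norm_scaleC mult.commute)

lemma bounded_linear_cinner_left: "bounded_linear (\<lambda>x. cinner x (y::'a::complex_hilbert))"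
proof (rule bounded_linear_intro[where K = "norm y"])
  show "cinner (r *\<^sub>R x) y = r *\<^sub>R cinner x y" for r x
    by (metis cinner_scaleC_left scaleC_of_real scaleR_conv_of_real)
qed (auto simp: cinner_add_left cmod_cinner_le)

lemma norm_le_if_cinner_le:
  assumes "\<And>y. cmod (cinner v y) \<le> M * norm (y::'a::complex_hilbert)" "0 \<le> M"
  shows "norm v \<le> M"
proof (cases "v = 0")
  case False
  have "norm v * norm v = Re (cinner v v)"
    by (metis Re_cinner power2_eq_square power2_norm_eq_inner)
  also have "\<dots> \<le> M * norm v"
    using assms(1)[of v] complex_Re_le_cmod order_trans by blast
  finally show ?thesis using False by simp
qed (use assms in simp)

lemma scaleC_op_apply [simp]: "blinfun_apply (scaleC_op c T) x = c *\<^sub>C blinfun_apply T x"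
  unfolding scaleC_op_def
  by (rule fun_cong[OF bounded_linear_Blinfun_apply])
    (rule bounded_linear_compose[OF bounded_linear_scaleC_right blinfun.bounded_linear_right])

lemma norm_scaleC_op_le: "norm (scaleC_op c T) \<le> cmod c * norm T"
proof (rule norm_blinfun_bound)
  show "norm (blinfun_apply (scaleC_op c T) x) \<le> cmod c * norm T * norm x" for x
    using norm_blinfun[of T x] mult_left_mono[of _ _ "cmod c"]
    by (simp add: norm_scaleC mult.assoc)
qed simp

lemma bounded_bilinear_scaleC_op: "bounded_bilinear scaleC_op"
proof
  show "\<exists>K. \<forall>a b. norm (scaleC_op a b) \<le> norm a * norm (b::'a::complex_hilbert \<Rightarrow>\<^sub>L 'a) * K"
    using norm_scaleC_op_le by (intro exI[of _ 1]) (auto simp: mult.commute)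
qed (auto intro!: blinfun_eqI simp: scaleC_add_left scaleC_add_right scaleC_scaleR blinfun.bilinear_simps 
   scaleR_conv_of_real scaleC_scaleC[symmetric] scaleC_of_real)

lemma scaleC_op_scaleC_op: "scaleC_op c (scaleC_op d T) = scaleC_op (c * d) T"
  by (rule blinfun_eqI) (simp add: scaleC_scaleC)

section \<open>Integration along horizontal lines\<close>

definition hstrip :: "real \<Rightarrow> real \<Rightarrow> complex set"
  where "hstrip a b = {w. a < Im w \<and> Im w < b}"

lemma mem_hstrip [simp]: "w \<in> hstrip a b \<longleftrightarrow> a < Im w \<and> Im w < b"
  by (simp add: hstrip_def)

lemma open_hstrip: "open (hstrip a b)"
  unfolding hstrip_def by (intro open_Collect_conj open_Collect_less continuous_intros)

lemma convex_hstrip: "convex (hstrip a b)"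
proof -
  have "hstrip a b = {w. a < Im w} \<inter> {w. Im w < b}" by auto
  then show ?thesis
    by (simp add: convex_Int convex_halfspace_Im_gt convex_halfspace_Im_lt)
qed

definition line_int :: "real \<Rightarrow> (complex \<Rightarrow> complex) \<Rightarrow> complex"
  where "line_int c h = (LINT u|lborel. h (Complex u c))"

text \<open>
  Only the two ends of the strip matter here, so that functions with a pole inside are covered.
\<close>

definition decaying :: "real \<Rightarrow> real \<Rightarrow> (complex \<Rightarrow> complex) \<Rightarrow> bool"
  where "decaying a b h \<longleftrightarrow>
    (\<exists>C \<sigma> X. 0 < \<sigma> \<and> (\<forall>w\<in>hstrip a b. X \<le> \<bar>Re w\<bar> \<longrightarrow> cmod (h w) \<le> C * exp (- \<sigma> * \<bar>Re w\<bar>)))"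

lemma decaying_diff:
  assumes "decaying a b f" "decaying a b g"
  shows "decaying a b (\<lambda>w. f w - g w)"
proof -
  obtain C s X where f: "0 < s" "\<And>w. w \<in> hstrip a b \<Longrightarrow> X \<le> \<bar>Re w\<bar> \<Longrightarrow> cmod (f w) \<le> C * exp (- s * \<bar>Re w\<bar>)"
    using assms(1) unfolding decaying_def by blast
  obtain D t Y where g: "0 < t" "\<And>w. w \<in> hstrip a b \<Longrightarrow> Y \<le> \<bar>Re w\<bar> \<Longrightarrow> cmod (g w) \<le> D * exp (- t * \<bar>Re w\<bar>)"
    using assms(2) unfolding decaying_def by blast
  have "cmod (f w - g w) \<le> (\<bar>C\<bar> + \<bar>D\<bar>) * exp (- min s t * \<bar>Re w\<bar>)"
    if w: "w \<in> hstrip a b" "max X Y \<le> \<bar>Re w\<bar>" for w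
  proof -
    have "cmod (f w) \<le> C * exp (- s * \<bar>Re w\<bar>)" using f w by simp
    also have "\<dots> \<le> \<bar>C\<bar> * exp (- min s t * \<bar>Re w\<bar>)"
      by (intro mult_mono) (auto simp: mult_right_mono)
    finally have 1: "cmod (f w) \<le> \<bar>C\<bar> * exp (- min s t * \<bar>Re w\<bar>)" .
    have "cmod (g w) \<le> D * exp (- t * \<bar>Re w\<bar>)" using g w by simp
    also have "\<dots> \<le> \<bar>D\<bar> * exp (- min s t * \<bar>Re w\<bar>)"
      by (intro mult_mono) (auto simp: mult_right_mono)
    finally have "cmod (g w) \<le> \<bar>D\<bar> * exp (- min s t * \<bar>Re w\<bar>)" .
    with 1 show ?thesis
      using norm_triangle_ineq4[of "f w" "g w"] by (simp add: algebra_simps)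
  qed
  moreover have "0 < min s t" using f g by simp
  ultimately show ?thesis unfolding decaying_def by blast
qed

lemma decaying_mult_bounded:
  assumes "decaying a b f" "\<And>w. w \<in> hstrip a b \<Longrightarrow> Y \<le> \<bar>Re w\<bar> \<Longrightarrow> cmod (g w) \<le> B"
  shows "decaying a b (\<lambda>w. f w * g w)"
proof -
  obtain C s X where f: "0 < s" "\<And>w. w \<in> hstrip a b \<Longrightarrow> X \<le> \<bar>Re w\<bar> \<Longrightarrow> cmod (f w) \<le> C * exp (- s * \<bar>Re w\<bar>)"
    using assms(1) unfolding decaying_def by blast
  have "cmod (f w * g w) \<le> (C * \<bar>B\<bar>) * exp (- s * \<bar>Re w\<bar>)"
    if w: "w \<in> hstrip a b" "max X Y \<le> \<bar>Re w\<bar>" for w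
  proof -
    have "cmod (f w * g w) \<le> (C * exp (- s * \<bar>Re w\<bar>)) * \<bar>B\<bar>"
      unfolding norm_mult using f(2)[of w] assms(2)[of w] w
      by (intro mult_mono) (auto intro: order_trans[OF norm_ge_zero])
    then show ?thesis by (simp add: algebra_simps)
  qed
  then show ?thesis unfolding decaying_def using f(1) by blast
qed

lemma decaying_mono: "decaying a b h \<Longrightarrow> a \<le> a' \<Longrightarrow> b' \<le> b \<Longrightarrow> decaying a' b' h"
  unfolding decaying_def by (meson mem_hstrip le_less_trans less_le_trans)

lemma integrable_exp_abs:
  assumes "0 < \<sigma>"
  shows "integrable lborel (\<lambda>u::real. exp (- \<sigma> * \<bar>u\<bar>))"
proof -
  have half: "integrable lborel (\<lambda>u. indicator {0..} u *\<^sub>R exp (- \<sigma> * u))"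
  proof -
    have "(\<lambda>u. exp (- \<sigma> * u)) absolutely_integrable_on {0..}"
      using has_integral_exp_minus_to_infinity[OF assms, of 0]
      by (intro nonnegative_absolutely_integrable_1) (auto simp: integrable_on_def)
    then show ?thesis
      unfolding set_integrable_def by (subst (asm) integrable_completion) auto
  qed
  have "integrable lborel (\<lambda>u. indicator {0..} (-u) *\<^sub>R exp (- \<sigma> * -u))"
    using lborel_integrable_real_affine[OF half, of "-1" 0] by simp
  with half have "integrable lborel (\<lambda>u. indicator {0..} u *\<^sub>R exp (- \<sigma> * u) + indicator {0..} (-u) *\<^sub>R exp (- \<sigma> * -u))"
    by (rule Bochner_Integration.integrable_add)
  then show ?thesis
    by (rule Bochner_Integration.integrable_bound) (auto simp: indicator_def abs_if)
qed

lemma continuous_on_line: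
  assumes "continuous_on (hstrip a b) h" "a < c" "c < b"
  shows "continuous_on UNIV (\<lambda>u. h (Complex u c))"
proof (rule continuous_on_compose2[OF assms(1)])
  show "continuous_on UNIV (\<lambda>u. Complex u c)"
    unfolding Complex_eq by (intro continuous_intros)
qed (use assms in auto)

lemma line_integrable:
  assumes cont: "continuous_on (hstrip a b) h" and "decaying a b h" and c: "a < c" "c < b"
  shows "integrable lborel (\<lambda>u. h (Complex u c))"
proof -
  obtain C s X where s: "0 < s"
    and h: "\<And>w. w \<in> hstrip a b \<Longrightarrow> X \<le> \<bar>Re w\<bar> \<Longrightarrow> cmod (h w) \<le> C * exp (- s * \<bar>Re w\<bar>)"
    using assms(2) unfolding decaying_def by blast
  have cont': "continuous_on UNIV (\<lambda>u. h (Complex u c))"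
    by (rule continuous_on_line[OF cont c])
  then have "compact ((\<lambda>u. h (Complex u c)) ` {-\<bar>X\<bar>..\<bar>X\<bar>})"
    by (intro compact_continuous_image) (auto intro: continuous_on_subset)
  then obtain B where B: "\<And>u. u \<in> {-\<bar>X\<bar>..\<bar>X\<bar>} \<Longrightarrow> cmod (h (Complex u c)) \<le> B"
    using bounded_iff[of "(\<lambda>u. h (Complex u c)) ` {-\<bar>X\<bar>..\<bar>X\<bar>}"] compact_imp_bounded by fastforce
  have le: "cmod (h (Complex u c)) \<le> (\<bar>C\<bar> + \<bar>B\<bar> * exp (s * \<bar>X\<bar>)) * exp (- s * \<bar>u\<bar>)" for u
  proof (cases "\<bar>u\<bar> \<le> \<bar>X\<bar>")
    case True
    then have "cmod (h (Complex u c)) \<le> \<bar>B\<bar> * 1"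
      using B[of u] abs_ge_self[of B] by (auto simp: abs_le_iff intro: order_trans)
    also have "\<dots> \<le> \<bar>B\<bar> * (exp (s * \<bar>X\<bar>) * exp (- s * \<bar>u\<bar>))"
      using True s by (intro mult_left_mono) (auto simp: exp_add[symmetric] mult_left_mono)
    also have "\<dots> \<le> \<bar>C\<bar> * exp (- s * \<bar>u\<bar>) + \<bar>B\<bar> * (exp (s * \<bar>X\<bar>) * exp (- s * \<bar>u\<bar>))"
      by simp
    finally show ?thesis by (simp add: algebra_simps)
  next
    case False
    then have "cmod (h (Complex u c)) \<le> C * exp (- s * \<bar>u\<bar>)"
      using h[of "Complex u c"] c by simp
    also have "\<dots> \<le> \<bar>C\<bar> * exp (- s * \<bar>u\<bar>)" by (intro mult_right_mono) auto
    also have "\<dots> \<le> \<bar>C\<bar> * exp (- s * \<bar>u\<bar>) + \<bar>B\<bar> * (exp (s * \<bar>X\<bar>) * exp (- s * \<bar>u\<bar>))"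
      by simp
    finally show ?thesis by (simp add: algebra_simps)
  qed
  show ?thesis
  proof (rule Bochner_Integration.integrable_bound)
    show "integrable lborel (\<lambda>u. (\<bar>C\<bar> + \<bar>B\<bar> * exp (s * \<bar>X\<bar>)) * exp (- s * \<bar>u\<bar>))"
      by (intro integrable_mult_right integrable_exp_abs s)
    show "(\<lambda>u. h (Complex u c)) \<in> borel_measurable lborel"
      using borel_measurable_continuous_onI[OF cont'] by simp
  qed (use le in \<open>auto intro!: AE_I2 order_trans[OF le abs_ge_self]\<close>)
qed

text \<open>
  A strip is convex, so \<open>h\<close> has a primitive \<open>P\<close> there.  The integrals of \<open>h\<close> over \<open>{-n..n}\<close> on the two lines are
  differences of values of \<open>P\<close>, and they differ by the increments of \<open>P\<close> along the vertical segments at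
  \<open>\<plusminus> n\<close>, which tend to zero because \<open>P' = h\<close> does.
\<close>

lemma line_shift:
  assumes hol: "h holomorphic_on hstrip a b" and dec: "decaying a b h"
    and c: "a < c" "c < b" and d: "a < d" "d < b"
  shows "line_int c h = line_int d h"
proof -
  obtain C s X where s: "0 < s"
    and h: "\<And>w. w \<in> hstrip a b \<Longrightarrow> X \<le> \<bar>Re w\<bar> \<Longrightarrow> cmod (h w) \<le> C * exp (- s * \<bar>Re w\<bar>)"
    using dec unfolding decaying_def by blast
  note cont = holomorphic_on_imp_continuous_on[OF hol]
  obtain P where P: "\<And>w. w \<in> hstrip a b \<Longrightarrow> (P has_field_derivative h w) (at w within hstrip a b)"
    using holomorphic_convex_primitive'[OF convex_hstrip open_hstrip hol] by blast
  have P': "(P has_field_derivative h w) (at w)" if "w \<in> hstrip a b" for w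
    using P[OF that] at_within_open[OF that open_hstrip] by simp
  have lim: "(\<lambda>n. P (Complex (real n) e) - P (Complex (- real n) e)) \<longlonglongrightarrow> line_int e h"
    if e: "a < e" "e < b" for e
  proof -
    have int: "integrable lborel (\<lambda>u. h (Complex u e))"
      by (rule line_integrable[OF cont dec e])
    have "(\<lambda>n. LINT u|lborel. indicator {- real n..real n} u *\<^sub>R h (Complex u e)) \<longlonglongrightarrow> line_int e h"
      unfolding line_int_def
    proof (rule integral_dominated_convergence[where w = "\<lambda>u. cmod (h (Complex u e))"])
      show "AE u in lborel. (\<lambda>n. indicator {- real n..real n} u *\<^sub>R h (Complex u e)) \<longlonglongrightarrow> h (Complex u e)"
      proof (rule AE_I2, rule tendsto_eventually)
        fix u :: real
        obtain N :: nat where "\<bar>u\<bar> \<le> real N" using real_arch_simple by blast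
        then have "\<forall>n\<ge>N. u \<in> {- real n..real n}" by (auto simp: abs_le_iff)
        then show "\<forall>\<^sub>F n in sequentially. indicator {- real n..real n} u *\<^sub>R h (Complex u e) = h (Complex u e)"
          unfolding eventually_sequentially by (intro exI[of _ N]) (auto simp: indicator_def)
      qed
    qed (use int in \<open>auto simp: indicator_def intro!: integrable_norm\<close>)
    moreover have "(LINT u|lborel. indicator {- real n..real n} u *\<^sub>R h (Complex u e))
        = P (Complex (real n) e) - P (Complex (- real n) e)" for n
    proof (rule integral_FTC_Icc)
      show "((\<lambda>u. P (Complex u e)) has_vector_derivative h (Complex u e)) (at u within {- real n..real n})" for u
      proof -
        have "((\<lambda>u. Complex u e) has_vector_derivative 1) (at u within {- real n..real n})"
          unfolding Complex_eq by (auto intro!: derivative_eq_intros)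
        from field_vector_diff_chain_within[OF this has_field_derivative_at_within[OF P']] e
        show ?thesis by (simp add: o_def)
      qed
      show "continuous_on {- real n..real n} (\<lambda>u. h (Complex u e))"
        using continuous_on_line[OF cont e] continuous_on_subset by blast
    qed simp
    ultimately show ?thesis by simp
  qed
  have bd: "cmod (P (Complex x c) - P (Complex x d)) \<le> C * exp (- s * \<bar>x\<bar>) * \<bar>c - d\<bar>" if "X \<le> \<bar>x\<bar>" for x
  proof -
    have "cmod (P (Complex x c) - P (Complex x d)) \<le> C * exp (- s * \<bar>x\<bar>) * cmod (Complex x c - Complex x d)"
    proof (rule field_differentiable_bound[where S = "hstrip a b \<inter> {w. Re w = x}"])
      have "convex {w. Re w = x}"
        by (rule convexI) (auto simp: distrib_right[symmetric])
      then show "convex (hstrip a b \<inter> {w. Re w = x})"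
        by (intro convex_Int convex_hstrip)
      show "(P has_field_derivative h z) (at z within hstrip a b \<inter> {w. Re w = x})"
        if "z \<in> hstrip a b \<inter> {w. Re w = x}" for z
        using P' that has_field_derivative_at_within by blast
      show "cmod (h z) \<le> C * exp (- s * \<bar>x\<bar>)" if "z \<in> hstrip a b \<inter> {w. Re w = x}" for z
        using h[of z] that \<open>X \<le> \<bar>x\<bar>\<close> by auto
    qed (use c d in auto)
    also have "cmod (Complex x c - Complex x d) = \<bar>c - d\<bar>"
      by (simp add: complex_diff cmod_def)
    finally show ?thesis .
  qed
  let ?D = "\<lambda>n. (P (Complex (real n) c) - P (Complex (- real n) c)) - (P (Complex (real n) d) - P (Complex (- real n) d))"
  have "?D \<longlonglongrightarrow> 0"
  proof (rule Lim_null_comparison)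
    show "\<forall>\<^sub>F n in sequentially. norm (?D n) \<le> (2 * C * \<bar>c - d\<bar>) * exp (- s * real n)"
    proof (rule eventually_sequentiallyI)
      fix n assume "nat \<lceil>X\<rceil> \<le> n"
      then have n: "X \<le> real n" by linarith
      have "norm (?D n) \<le> cmod (P (Complex (real n) c) - P (Complex (real n) d))
          + cmod (P (Complex (- real n) c) - P (Complex (- real n) d))"
        using norm_triangle_ineq4[of "P (Complex (real n) c) - P (Complex (real n) d)"
            "P (Complex (- real n) c) - P (Complex (- real n) d)"]
        by (simp add: algebra_simps)
      also have "\<dots> \<le> (2 * C * \<bar>c - d\<bar>) * exp (- s * real n)"
        using bd[of "real n"] bd[of "- real n"] n by (simp add: algebra_simps)
      finally show "norm (?D n) \<le> (2 * C * \<bar>c - d\<bar>) * exp (- s * real n)" .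
    qed
    have "(\<lambda>n. exp (- s) ^ n) \<longlonglongrightarrow> 0"
      using s by (intro LIMSEQ_realpow_zero) auto
    then have "(\<lambda>n. exp (- s * real n)) \<longlonglongrightarrow> 0"
      by (simp add: exp_of_nat_mult[symmetric] mult.commute)
    then show "(\<lambda>n. (2 * C * \<bar>c - d\<bar>) * exp (- s * real n)) \<longlonglongrightarrow> 0"
      by (rule tendsto_mult_right_zero)
  qed
  moreover have "?D \<longlonglongrightarrow> line_int c h - line_int d h"
    by (intro tendsto_diff lim c d)
  ultimately have "line_int c h - line_int d h = 0"
    using LIMSEQ_unique by blast
  then show ?thesis by simp
qed

text \<open>
  With \<open>r = \<bar>exp w\<bar>\<close> and \<open>s = sin (Im w / 2)\<close> one has
  \<open>\<bar>1 - exp w\<bar>\<^sup>2 = (1 - r)\<^sup>2 (1 - s\<^sup>2) + s\<^sup>2 (1 + r)\<^sup>2\<close>.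
\<close>

lemma cmod_one_minus_exp_ge: "\<bar>sin (Im w / 2)\<bar> \<le> cmod (1 - exp w)"
proof -
  define r a s where "r = exp (Re w)" and "a = Im w" and "s = sin (Im w / 2)"
  have ca: "cos a = 1 - 2 * s\<^sup>2"
    using cos_double_sin[of "Im w / 2"] unfolding a_def s_def by simp
  have s1: "s\<^sup>2 \<le> 1" unfolding s_def by (simp add: abs_square_le_1)
  have r: "0 < r" unfolding r_def by simp
  have "(cmod (1 - exp w))\<^sup>2 = (1 - r * cos a)\<^sup>2 + (r * sin a)\<^sup>2"
    unfolding cmod_power2 by (simp add: Re_exp Im_exp r_def a_def)
  also have "\<dots> = 1 - 2 * r * cos a + r\<^sup>2 * ((sin a)\<^sup>2 + (cos a)\<^sup>2)"
    unfolding power2_diff power_mult_distrib distrib_left by simp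
  also have "\<dots> = 1 - 2 * r * cos a + r\<^sup>2"
    by simp
  also have "\<dots> = (1 - r)\<^sup>2 * (1 - s\<^sup>2) + s\<^sup>2 * (1 + r)\<^sup>2"
    unfolding ca by (simp add: power2_eq_square algebra_simps)
  also have "\<dots> \<ge> 0 + s\<^sup>2 * 1"
    using r s1 one_le_power[of "1 + r" 2] by (intro add_mono mult_left_mono mult_nonneg_nonneg) auto
  finally have "\<bar>s\<bar>\<^sup>2 \<le> (cmod (1 - exp w))\<^sup>2" by simp
  then show ?thesis unfolding s_def by (rule power2_le_imp_le) simp
qed

lemma one_minus_exp_nonzero:
  assumes "0 < \<bar>Im w\<bar>" "\<bar>Im w\<bar> < 2 * pi"
  shows "1 - exp w \<noteq> 0"
proof -
  have "0 < \<bar>sin (Im w / 2)\<bar>"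
  proof (cases "0 < Im w")
    case True
    then show ?thesis using assms sin_gt_zero[of "Im w / 2"] by auto
  next
    case False
    then show ?thesis using assms sin_gt_zero[of "- Im w / 2"] by auto
  qed
  then show ?thesis using cmod_one_minus_exp_ge[of w] by force
qed

lemma cmod_one_minus_exp_tail:
  assumes "1 \<le> \<bar>Re w\<bar>"
  shows "(1 - exp (-1)) * max 1 (exp (Re w)) \<le> cmod (1 - exp w)"
proof (cases "0 \<le> Re w")
  case True
  then have "1 \<le> Re w" using assms by simp
  then have "exp (-1) * exp (Re w) \<ge> 1" by (simp add: exp_add[symmetric])
  then have "(1 - exp (-1)) * max 1 (exp (Re w)) \<le> exp (Re w) - 1"
    using True by (simp add: max_def algebra_simps)
  also have "\<dots> \<le> cmod (1 - exp w)"
    using norm_triangle_ineq2[of "exp w" 1] by (simp add: norm_minus_commute)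
  finally show ?thesis .
next
  case False
  then have "Re w \<le> -1" using assms by simp
  then have "(1 - exp (-1)) * max 1 (exp (Re w)) \<le> 1 - exp (Re w)"
    by (simp add: max_def)
  also have "\<dots> \<le> cmod (1 - exp w)"
    using norm_triangle_ineq2[of 1 "exp w"] by simp
  finally show ?thesis .
qed

text \<open>
  Under \<open>exp\<close> the two lines become the two rays that bound the sector of angle \<open>c\<close>; the signs are those of the
  orientation in \<open>sector_path\<close>.
\<close>

definition two_lines :: "real \<Rightarrow> (complex \<Rightarrow> complex) \<Rightarrow> complex"
  where "two_lines c h = line_int (- c) h - line_int c h"

text \<open>
  This is \<open>1 / (2 sinh (w / 2))\<close>: it decays at both ends of the line, and on the strip \<open>\<bar>Im w\<bar> < 2 \<pi>\<close> its only pole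
  is at the origin, with residue one.
\<close>

definition csch_half :: "complex \<Rightarrow> complex"
  where "csch_half w = exp (- w / 2) / (1 - exp (- w))"

lemma csch_half_holomorphic:
  assumes "\<And>w. w \<in> hstrip a b \<Longrightarrow> 0 < \<bar>Im w\<bar> \<and> \<bar>Im w\<bar> < 2 * pi"
  shows "csch_half holomorphic_on hstrip a b"
proof -
  have "1 - exp (- w) \<noteq> 0" if "w \<in> hstrip a b" for w
    using one_minus_exp_nonzero[of "- w"] assms[OF that] by simp
  then show ?thesis
    unfolding csch_half_def[abs_def] by (auto intro!: holomorphic_intros)
qed

lemma cmod_csch_half_tail:
  assumes "1 \<le> \<bar>Re w\<bar>"
  shows "cmod (csch_half w) \<le> 1 / (1 - exp (-1)) * exp (- \<bar>Re w\<bar> / 2)"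
proof -
  define k where "k = 1 - exp (-1::real)"
  have k: "0 < k" unfolding k_def by simp
  have d: "k * max 1 (exp (- Re w)) \<le> cmod (1 - exp (- w))"
    using cmod_one_minus_exp_tail[of "- w"] assms unfolding k_def by simp
  have "cmod (csch_half w) = exp (- Re w / 2) / cmod (1 - exp (- w))"
    unfolding csch_half_def by (simp add: norm_divide)
  also have "\<dots> \<le> exp (- Re w / 2) / (k * max 1 (exp (- Re w)))"
    using d k by (intro divide_left_mono) (auto intro!: mult_pos_pos order.strict_trans2[OF _ d] simp: max_def)
  also have "\<dots> = exp (- \<bar>Re w\<bar> / 2) / k"
    by (auto simp: max_def abs_if exp_diff[symmetric] exp_minus field_simps exp_add[symmetric])
  finally show ?thesis unfolding k_def by (simp add: field_simps)
qed

lemma decaying_csch_half_shift: "decaying a b (\<lambda>w. csch_half (w - v))"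
proof -
  define k where "k = 1 / (1 - exp (-1::real))"
  have k: "0 < k" unfolding k_def by simp
  have "cmod (csch_half (w - v)) \<le> (k * exp (\<bar>Re v\<bar> / 2)) * exp (- (1/2) * \<bar>Re w\<bar>)"
    if "\<bar>Re v\<bar> + 1 \<le> \<bar>Re w\<bar>" for w
  proof -
    have "cmod (csch_half (w - v)) \<le> k * exp (- \<bar>Re (w - v)\<bar> / 2)"
      unfolding k_def by (rule cmod_csch_half_tail) (use that in auto)
    also have "\<dots> \<le> k * (exp (\<bar>Re v\<bar> / 2) * exp (- (1/2) * \<bar>Re w\<bar>))"
    proof -
      have "\<bar>Re w\<bar> \<le> \<bar>Re (w - v)\<bar> + \<bar>Re v\<bar>"
        using abs_triangle_ineq[of "Re (w - v)" "Re v"] by simp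
      then show ?thesis
        using k by (intro mult_left_mono) (auto simp: exp_add[symmetric] simp del: minus_complex.sel)
    qed
    finally show ?thesis by (simp add: algebra_simps)
  qed
  then show ?thesis
    unfolding decaying_def by (intro exI[of _ "k * exp (\<bar>Re v\<bar> / 2)"] exI[of _ "1/2"] exI[of _ "\<bar>Re v\<bar> + 1"]) auto
qed

lemma decaying_csch_half: "decaying a b csch_half"
  using decaying_csch_half_shift[of a b 0] by simp

lemma integral_sech: "(LINT x|lborel. exp (- x / 2) / (1 + exp (- x))) = (pi::real)"
proof -
  have lim1: "((\<lambda>x::real. - 2 * arctan (exp (- x / 2))) \<longlongrightarrow> - pi) at_bot"
  proof -
    have "((\<lambda>x::real. arctan (exp (- x / 2))) \<longlongrightarrow> pi / 2) at_bot"
      by (rule filterlim_compose[OF tendsto_arctan_at_top]) real_asymp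
    from tendsto_mult[OF tendsto_const[of "-2::real"] this] show ?thesis by simp
  qed
  have lim2: "((\<lambda>x::real. - 2 * arctan (exp (- x / 2))) \<longlongrightarrow> 0) at_top"
  proof -
    have "((\<lambda>x::real. exp (- x / 2)) \<longlongrightarrow> 0) at_top" by real_asymp
    from tendsto_mult[OF tendsto_const[of "-2::real"] tendsto_arctan[OF this]] show ?thesis by simp
  qed
  have "(LBINT x=-\<infinity>..\<infinity>. exp (- x / 2) / (1 + exp (- x))) = 0 - (- pi)"
  proof (rule interval_integral_FTC_nonneg(2)[where F = "\<lambda>x. - 2 * arctan (exp (- x / 2))"])
    show "((\<lambda>x. - 2 * arctan (exp (- x / 2))) has_real_derivative exp (- x / 2) / (1 + exp (- x))) (at x)" for x :: real
    proof -
      have "1 + exp (- x) \<noteq> 0" using exp_gt_zero[of "- x"] by linarith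
      moreover have "exp (- x / 2) ^ 2 = exp (- x)"
        by (simp add: power2_eq_square exp_add[symmetric])
      ultimately show ?thesis
        by (auto intro!: derivative_eq_intros simp: field_simps)
    qed
    show "isCont (\<lambda>x. exp (- x / 2) / (1 + exp (- x))) x" for x :: real
    proof -
      have "1 + exp (- x) \<noteq> 0" using exp_gt_zero[of "- x"] by linarith
      then show ?thesis by (auto intro!: continuous_intros)
    qed
    show "(((\<lambda>x. - 2 * arctan (exp (- x / 2))) \<circ> real_of_ereal) \<longlongrightarrow> - pi) (at_right (- \<infinity>))"
      using lim1 by (simp add: ereal_tendsto_simps)
    show "(((\<lambda>x. - 2 * arctan (exp (- x / 2))) \<circ> real_of_ereal) \<longlongrightarrow> 0) (at_left \<infinity>)"
      using lim2 by (simp add: ereal_tendsto_simps)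
  qed (auto intro!: AE_I2 divide_nonneg_nonneg add_nonneg_nonneg)
  then show ?thesis
    by (simp add: interval_integral_to_infinity_eq interval_lebesgue_integral_def einterval_def set_lebesgue_integral_def)
qed

text \<open>
  This replaces the residue theorem.  The two lines can be moved to height \<open>\<plusminus> \<pi>\<close>, where the function is
  \<open>\<mp> i / (2 cosh (x / 2))\<close>.
\<close>

lemma csch_half_jump:
  assumes "0 < c" "c < 2 * pi" "- 2 * pi < d" "d < 0"
  shows "line_int d csch_half - line_int c csch_half = 2 * complex_of_real pi * \<i>"
proof -
  have "line_int c csch_half = line_int pi csch_half"
    using assms by (intro line_shift[of _ 0 "2 * pi"] csch_half_holomorphic decaying_csch_half) auto
  moreover have "line_int d csch_half = line_int (- pi) csch_half"
    using assms by (intro line_shift[of _ "- 2 * pi" 0] csch_half_holomorphic decaying_csch_half) auto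
  moreover have "line_int pi csch_half = - \<i> * pi"
  proof -
    have "csch_half (Complex u pi) = - \<i> * complex_of_real (exp (- u / 2) / (1 + exp (- u)))" for u
    proof -
      have "exp (- Complex u pi / 2) = - \<i> * complex_of_real (exp (- u / 2))"
        "exp (- Complex u pi) = - complex_of_real (exp (- u))"
        by (simp_all add: complex_eq_iff Re_exp Im_exp)
      then show ?thesis unfolding csch_half_def by simp
    qed
    then show ?thesis unfolding line_int_def
      by (simp only: integral_mult_right_zero integral_complex_of_real integral_sech)
  qed
  moreover have "line_int (- pi) csch_half = \<i> * pi"
  proof -
    have "csch_half (Complex u (- pi)) = \<i> * complex_of_real (exp (- u / 2) / (1 + exp (- u)))" for u
    proof -
      have "exp (- Complex u (- pi) / 2) = \<i> * complex_of_real (exp (- u / 2))"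
        "exp (- Complex u (- pi)) = - complex_of_real (exp (- u))"
        by (simp_all add: complex_eq_iff Re_exp Im_exp)
      then show ?thesis unfolding csch_half_def by simp
    qed
    then show ?thesis unfolding line_int_def
      by (simp only: integral_mult_right_zero integral_complex_of_real integral_sech)
  qed
  ultimately show ?thesis by (simp add: algebra_simps)
qed

lemma line_int_shift: "line_int d (\<lambda>w. h (w - v)) = line_int (d - Im v) h"
proof -
  have "line_int (d - Im v) h = (LINT u|lborel. h (Complex (- Re v + 1 * u) (d - Im v)))"
    unfolding line_int_def by (subst lborel_integral_real_affine[of 1 _ "- Re v"]) simp_all
  also have "\<dots> = line_int d (\<lambda>w. h (w - v))"
    unfolding line_int_def by (intro Bochner_Integration.integral_cong refl arg_cong[of _ _ h]) (auto simp: complex_eq_iff)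
  finally show ?thesis ..
qed

text \<open>
  Cauchy's formula for a strip, with the kernel \<open>1 / (1 - exp (v - w))\<close> that corresponds to \<open>dz / (z - \<lambda>)\<close> for
  \<open>z = exp w\<close> and \<open>\<lambda> = exp v\<close>.  Subtracting \<open>g v\<close> times the translated \<open>csch_half\<close> removes the pole at \<open>v\<close>
  without spoiling the decay.  The difference has the same integral over both lines, and the
  subtracted term contributes \<open>csch_half_jump\<close>.
\<close>

lemma cauchy_strip:
  assumes hol: "g holomorphic_on hstrip (- \<beta>) \<beta>" and dec: "decaying (- \<beta>) \<beta> g"
    and \<beta>: "\<beta> \<le> pi" and v: "\<bar>Im v\<bar> < \<gamma>" and \<gamma>: "\<gamma> < \<beta>"
  shows "two_lines \<gamma> (\<lambda>w. g w / (1 - exp (v - w))) = 2 * complex_of_real pi * \<i> * g v"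
proof -
  let ?S = "hstrip (- \<beta>) \<beta>"
  define N where "N w = g w - g v * exp (- (w - v) / 2)" for w
  define E where "E w = 1 - exp (v - w)" for w
  define N' where "N' w = (if w = v then deriv N v else (N w - N v) / (w - v))" for w
  define E' where "E' w = (if w = v then deriv E v else (E w - E v) / (w - v))" for w
  have vS: "v \<in> ?S" using v \<gamma> by auto
  then have vI: "v \<in> interior ?S" by (simp add: open_hstrip interior_open)
  have N0: "N v = 0" and E0: "E v = 0" by (simp_all add: N_def E_def)
  have N': "N' holomorphic_on ?S"
    unfolding N'_def[abs_def] by (intro pole_lemma vI) (auto simp: N_def[abs_def] intro!: holomorphic_intros hol)
  have E': "E' holomorphic_on ?S"
    unfolding E'_def[abs_def] by (intro pole_lemma vI) (auto simp: E_def[abs_def] intro!: holomorphic_intros)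
  have dE: "deriv E v = 1"
    unfolding E_def[abs_def] by (rule DERIV_imp_deriv) (auto intro!: derivative_eq_intros)
  have Enz: "E w \<noteq> 0" if "w \<in> ?S" "w \<noteq> v" for w
  proof
    assume "E w = 0"
    then have "exp v = exp w" by (simp add: E_def exp_diff field_simps)
    moreover have "\<bar>Im v - Im w\<bar> < 2 * pi"
    proof -
      have "- \<beta> < Im w" "Im w < \<beta>" "\<bar>Im v\<bar> < \<beta>"
        using that v \<gamma> by auto
      then show ?thesis using \<beta> by linarith
    qed
    ultimately have "v = w" by (rule exp_complex_eqI[rotated])
    then show False using that by simp
  qed
  have E'nz: "E' w \<noteq> 0" if "w \<in> ?S" for w
    using that Enz[OF that] by (auto simp: E'_def dE E0)
  \<comment> \<open>Numerator and denominator of the difference both vanish at \<open>v\<close>; dividing each by \<open>w - v\<close> removes the pole.\<close>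
  define R where "R w = N' w / E' w" for w
  have R: "R holomorphic_on ?S"
    unfolding R_def[abs_def] by (intro holomorphic_intros N' E' E'nz)
  have R_eq: "R w = g w * inverse (1 - exp (v - w)) - csch_half (w - v) * g v" if "w \<noteq> v" for w
  proof -
    have "R w = N w / E w"
      using that by (simp add: R_def N'_def E'_def N0 E0)
    moreover have "csch_half (w - v) = exp (- (w - v) / 2) / E w"
      unfolding csch_half_def E_def by (simp only: minus_diff_eq)
    ultimately show ?thesis
      unfolding N_def E_def[symmetric] by (simp only: diff_divide_distrib divide_inverse mult_ac right_diff_distrib)
  qed
  have dec1: "decaying (- \<beta>) \<beta> (\<lambda>w. g w * inverse (1 - exp (v - w)))"
  proof (rule decaying_mult_bounded[OF dec, of "\<bar>Re v\<bar> + 1" _ "1 / (1 - exp (-1))"])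
    fix w assume "\<bar>Re v\<bar> + 1 \<le> \<bar>Re w\<bar>"
    then have "(1 - exp (-1)) * max 1 (exp (Re (v - w))) \<le> cmod (1 - exp (v - w))"
      by (intro cmod_one_minus_exp_tail) auto
    moreover have "(1 - exp (-1)) * 1 \<le> (1 - exp (-1)) * max 1 (exp (Re (v - w)))"
      by (intro mult_left_mono) auto
    ultimately have "1 - exp (-1) \<le> cmod (1 - exp (v - w))"
      using order_trans mult.right_neutral by metis
    then show "cmod (inverse (1 - exp (v - w))) \<le> 1 / (1 - exp (-1))"
      unfolding norm_inverse divide_inverse by (simp add: le_imp_inverse_le)
  qed
  have dec2: "decaying (- \<beta>) \<beta> (\<lambda>w. csch_half (w - v) * g v)"
    by (rule decaying_mult_bounded[OF decaying_csch_half_shift order_refl])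
  have decR: "decaying (- \<beta>) \<beta> R"
  proof -
    obtain C s X where 1: "s > 0" "\<And>w. w \<in> ?S \<Longrightarrow> X \<le> \<bar>Re w\<bar> \<Longrightarrow>
        cmod (g w * inverse (1 - exp (v - w)) - csch_half (w - v) * g v) \<le> C * exp (- s * \<bar>Re w\<bar>)"
      using decaying_diff[OF dec1 dec2] unfolding decaying_def by blast
    have "cmod (R w) \<le> C * exp (- s * \<bar>Re w\<bar>)" if "w \<in> ?S" "max X (\<bar>Re v\<bar> + 1) \<le> \<bar>Re w\<bar>" for w
    proof -
      from that have "w \<noteq> v" by auto
      then show ?thesis using 1(2)[of w] that by (simp add: R_eq)
    qed
    then show ?thesis unfolding decaying_def using 1 by blast
  qed
  have line: "line_int c R = line_int c (\<lambda>w. g w / (1 - exp (v - w))) - line_int (c - Im v) csch_half * g v"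
    if c: "c = \<gamma> \<or> c = - \<gamma>" for c
  proof -
    define a b where "a = (if c = \<gamma> then Im v else - \<beta>)" and "b = (if c = \<gamma> then \<beta> else Im v)"
    have ab: "a < c" "c < b" "- \<beta> \<le> a" "b \<le> \<beta>"
      using c v \<gamma> unfolding a_def b_def by auto
    have sub: "hstrip a b \<subseteq> ?S" using ab by auto
    have nv: "v \<notin> hstrip a b" unfolding a_def b_def by auto
    have nz: "1 - exp (v - w) \<noteq> 0" if "w \<in> hstrip a b" for w
      using Enz[of w] that sub nv unfolding E_def by blast
    have nz': "1 - exp (- (w - v)) \<noteq> 0" if "w \<in> hstrip a b" for w
      using nz[OF that] by simp
    have c1: "continuous_on (hstrip a b) (\<lambda>w. g w * inverse (1 - exp (v - w)))"
      by (intro continuous_intros continuous_on_subset[OF holomorphic_on_imp_continuous_on[OF hol] sub]) (use nz in auto)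
    have c2: "continuous_on (hstrip a b) (\<lambda>w. csch_half (w - v) * g v)"
      unfolding csch_half_def by (intro continuous_intros) (use nz' in auto)
    have i1: "integrable lborel (\<lambda>u. g (Complex u c) * inverse (1 - exp (v - Complex u c)))"
      by (rule line_integrable[OF c1 decaying_mono[OF dec1 ab(3,4)] ab(1,2)])
    have i2: "integrable lborel (\<lambda>u. csch_half (Complex u c - v) * g v)"
      by (rule line_integrable[OF c2 decaying_mono[OF dec2 ab(3,4)] ab(1,2)])
    have "line_int c R = (LINT u|lborel. g (Complex u c) * inverse (1 - exp (v - Complex u c)) - csch_half (Complex u c - v) * g v)"
      unfolding line_int_def
      by (intro Bochner_Integration.integral_cong refl R_eq) (use v c in auto)
    also have "\<dots> = (LINT u|lborel. g (Complex u c) * inverse (1 - exp (v - Complex u c))) - (LINT u|lborel. csch_half (Complex u c - v) * g v)"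
      by (rule Bochner_Integration.integral_diff[OF i1 i2])
    also have "(LINT u|lborel. csch_half (Complex u c - v) * g v) = line_int (c - Im v) csch_half * g v"
      using line_int_shift[of c csch_half v] by (simp add: line_int_def)
    finally show ?thesis by (simp add: line_int_def divide_inverse)
  qed
  have "line_int (- \<gamma>) R = line_int \<gamma> R"
    by (rule line_shift[OF R decR]) (use v \<gamma> in auto)
  then have "two_lines \<gamma> (\<lambda>w. g w / (1 - exp (v - w)))
      = (line_int (- \<gamma> - Im v) csch_half - line_int (\<gamma> - Im v) csch_half) * g v"
    using line[of \<gamma>] line[of "- \<gamma>"] by (simp add: two_lines_def algebra_simps)
  also have "line_int (- \<gamma> - Im v) csch_half - line_int (\<gamma> - Im v) csch_half = 2 * complex_of_real pi * \<i>"
    by (rule csch_half_jump) (use v \<gamma> \<beta> in auto)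
  finally show ?thesis .
qed

section \<open>The substitution of the exponential function\<close>

text \<open>
  Stated for measures, so that it serves both nonnegative and Bochner integrals.
\<close>

lemma lborel_exp:
  "distr (density lborel (\<lambda>u. ennreal (exp u))) borel exp = density lborel (indicator {0::real<..})"
proof (rule measure_eqI)
  fix X assume "X \<in> sets (distr (density lborel (\<lambda>u. ennreal (exp u))) borel (exp :: real \<Rightarrow> real))"
  then have X[measurable]: "X \<in> sets borel" by simp
  have inc: "incseq (\<lambda>n x. ennreal (indicator X x) * indicator {exp (- real n)..exp (real n)} x)"
  proof (unfold incseq_def le_fun_def, intro allI impI)
    fix m n :: nat and x :: real assume "m \<le> n"
    then have sub: "{exp (- real m)..exp (real m)} \<subseteq> {exp (- real n)..exp (real n)}" by simp
    show "ennreal (indicator X x) * indicator {exp (- real m)..exp (real m)} x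
        \<le> ennreal (indicator X x) * indicator {exp (- real n)..exp (real n)} x"
      by (intro mult_left_mono indicator_leI subsetD[OF sub]) simp_all
  qed
  have inc': "incseq (\<lambda>n x. indicator X (exp x) * ennreal (exp x) * indicator {- real n..real n} x)"
    by (auto simp: incseq_def le_fun_def indicator_def intro: order_trans)
  have 1: "(SUP n. ennreal (indicator X x) * indicator {exp (- real n)..exp (real n)} x) = indicator {0<..} x * indicator X x" for x :: real
  proof -
    obtain N :: nat where N: "\<bar>ln x\<bar> \<le> real N" using real_arch_simple by blast
    show ?thesis
    proof (cases "0 < x")
      case True
      then have "x \<in> {exp (- real N)..exp (real N)}"
        using N by (metis abs_le_iff atLeastAtMost_iff exp_le_cancel_iff exp_ln minus_le_iff)
      then show ?thesis
        using True by (intro antisym SUP_least SUP_upper2[of N]) (auto simp: indicator_def)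
    next
      case False
      then have "x \<notin> {exp (- real n)..exp (real n)}" for n
        using exp_gt_zero[of "- real n"] by (auto intro: order.strict_trans2 simp del: exp_gt_zero)
      then show ?thesis using False by simp
    qed
  qed
  have 2: "(SUP n. indicator X (exp x) * ennreal (exp x) * indicator {- real n..real n} x) = ennreal (exp x) * indicator X (exp x)" for x :: real
  proof -
    obtain N :: nat where "\<bar>x\<bar> \<le> real N" using real_arch_simple by blast
    then have "x \<in> {- real N..real N}" by auto
    then show ?thesis
      by (intro antisym SUP_least SUP_upper2[of N]) (auto simp: indicator_def)
  qed
  have "emeasure (distr (density lborel (\<lambda>u. ennreal (exp u))) borel exp) X
      = (\<integral>\<^sup>+x. ennreal (exp x) * indicator X (exp x) \<partial>lborel)"
    by (subst emeasure_distr) (auto simp: emeasure_density indicator_def vimage_def intro!: nn_integral_cong)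
  also have "\<dots> = (SUP n. \<integral>\<^sup>+x. indicator X (exp x) * ennreal (exp x) * indicator {- real n..real n} x \<partial>lborel)"
    unfolding 2[symmetric] by (rule nn_integral_monotone_convergence_SUP[OF inc']) measurable
  also have "\<dots> = (SUP n. \<integral>\<^sup>+x. indicator X x * indicator {exp (- real n)..exp (real n)} x \<partial>lborel)"
  proof (intro SUP_cong refl)
    fix n :: nat
    show "(\<integral>\<^sup>+x. indicator X (exp x) * ennreal (exp x) * indicator {- real n..real n} x \<partial>lborel)
      = (\<integral>\<^sup>+x. indicator X x * indicator {exp (- real n)..exp (real n)} x \<partial>lborel)"
    proof (cases "n = 0")
      case True
      have "(\<integral>\<^sup>+x. h x * indicator {c..c} x \<partial>lborel) = 0" for h :: "real \<Rightarrow> ennreal" and c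
      proof -
        have "(\<integral>\<^sup>+x. h x * indicator {c..c} x \<partial>lborel) = (\<integral>\<^sup>+(x::real). 0 \<partial>lborel)"
          by (rule nn_integral_cong_AE) (use AE_lborel_singleton[of c] in \<open>eventually_elim, simp\<close>)
        then show ?thesis by simp
      qed
      then show ?thesis using True by simp
    next
      case False
      then show ?thesis
        by (intro nn_integral_substitution_aux[symmetric]) (auto intro!: derivative_eq_intros continuous_intros)
    qed
  qed
  also have "\<dots> = (\<integral>\<^sup>+x. indicator {0<..} x * indicator X x \<partial>lborel)"
    unfolding 1[symmetric] by (subst nn_integral_monotone_convergence_SUP[OF inc]) (auto simp: ennreal_indicator)
  also have "\<dots> = emeasure (density lborel (indicator {0::real<..})) X"
    by (subst emeasure_density) auto
  finally show "emeasure (distr (density lborel (\<lambda>u. ennreal (exp u))) borel exp) X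
    = emeasure (density lborel (indicator {0::real<..})) X" .
qed simp

lemma nn_integral_exp_subst:
  fixes f :: "real \<Rightarrow> ennreal"
  assumes [measurable]: "(\<lambda>x. f x * indicator {0<..} x) \<in> borel_measurable borel"
  shows "(\<integral>\<^sup>+x\<in>{0<..}. f x \<partial>lborel) = (\<integral>\<^sup>+u. ennreal (exp u) * f (exp u) \<partial>lborel)"
proof -
  define g where "g x = f x * indicator {0<..} x" for x
  have [measurable]: "g \<in> borel_measurable borel" unfolding g_def by measurable
  have "(\<integral>\<^sup>+x\<in>{0<..}. f x \<partial>lborel) = (\<integral>\<^sup>+x. g x \<partial>density lborel (indicator {0<..}))"
    by (subst nn_integral_density) (auto simp: g_def indicator_def intro!: nn_integral_cong)
  also have "\<dots> = (\<integral>\<^sup>+u. ennreal (exp u) * g (exp u) \<partial>lborel)"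
    unfolding lborel_exp[symmetric]
    by (simp add: nn_integral_distr nn_integral_density)
  finally show ?thesis by (simp add: g_def)
qed

lemma integral_exp_subst:
  fixes f :: "real \<Rightarrow> 'b::{banach, second_countable_topology}"
  assumes [measurable]: "(\<lambda>x. indicator {0<..} x *\<^sub>R f x) \<in> borel_measurable borel"
  shows "integrable lborel (\<lambda>x. indicator {0<..} x *\<^sub>R f x) \<longleftrightarrow> integrable lborel (\<lambda>u. exp u *\<^sub>R f (exp u))"
    and "(LINT x|lborel. indicator {0<..} x *\<^sub>R f x) = (LINT u|lborel. exp u *\<^sub>R f (exp u))"
proof -
  define g where "g x = indicator {0<..} x *\<^sub>R f x" for x
  have m[measurable]: "g \<in> borel_measurable borel" unfolding g_def by measurable
  have g: "indicator {0<..} x *\<^sub>R g x = g x" for x by (simp add: g_def indicator_def)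
  have G: "(\<lambda>x. indicator {0<..} x *\<^sub>R f x) = g" by (rule ext) (simp add: g_def)
  have ge: "g (exp u) = f (exp u)" for u by (simp add: g_def)
  have e: "density lborel (indicator {0<..}) = density lborel (\<lambda>x. ennreal (indicator {0::real<..} x))"
    by (simp add: ennreal_indicator)
  have "integrable lborel g \<longleftrightarrow> integrable (density lborel (indicator {0<..})) g"
    unfolding e by (subst integrable_density) (auto simp: g)
  also have "\<dots> \<longleftrightarrow> integrable lborel (\<lambda>u. exp u *\<^sub>R g (exp u))"
    unfolding lborel_exp[symmetric] by (subst integrable_distr_eq) (auto simp: integrable_density)
  finally show "integrable lborel (\<lambda>x. indicator {0<..} x *\<^sub>R f x) \<longleftrightarrow> integrable lborel (\<lambda>u. exp u *\<^sub>R f (exp u))"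
    unfolding G by (simp only: ge)
  have "integral\<^sup>L lborel g = integral\<^sup>L (density lborel (indicator {0<..})) g"
    unfolding e by (subst integral_density) (auto simp: g)
  also have "\<dots> = (LINT u|lborel. exp u *\<^sub>R g (exp u))"
    unfolding lborel_exp[symmetric] by (subst integral_distr) (auto simp: integral_density)
  finally show "(LINT x|lborel. indicator {0<..} x *\<^sub>R f x) = (LINT u|lborel. exp u *\<^sub>R f (exp u))"
    unfolding G by (simp only: ge)
qed

section \<open>Operator-valued gauge integrals\<close>

text \<open>
  Dominated approximation for the gauge integral in an arbitrary Banach space: Riemann sums of \<open>f - fn n\<close> are at
  most Riemann sums of \<open>gn n\<close>, which along fine divisions are close to the integral of \<open>gn n\<close>, so the Cauchy criterion
  passes from \<open>fn n\<close> to \<open>f\<close>.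
\<close>

lemma integrable_on_cbox_if_approx:
  fixes f :: "'n::euclidean_space \<Rightarrow> 'b::banach"
  assumes fn: "\<And>n. fn n integrable_on cbox a b"
    and gn: "\<And>n. gn n integrable_on cbox a b"
    and le: "\<And>n x. x \<in> cbox a b \<Longrightarrow> norm (f x - fn n x) \<le> gn n x"
    and lim: "(\<lambda>n::nat. integral (cbox a b) (gn n)) \<longlonglongrightarrow> 0"
  shows "f integrable_on cbox a b"
  unfolding integrable_Cauchy
proof (intro allI impI)
  let ?R = "\<lambda>D h. \<Sum>(x, K)\<in>D. measure lborel K *\<^sub>R h x"
  fix e :: real assume e: "0 < e"
  then obtain n where n: "norm (integral (cbox a b) (gn n)) < e / 8"
    using LIMSEQ_D[OF lim, of "e / 8"] by auto
  from fn[of n, unfolded integrable_Cauchy, rule_format, of "e / 4"] e obtain \<gamma>1 where \<gamma>1: "gauge \<gamma>1"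
      "\<And>D1 D2. D1 tagged_division_of cbox a b \<Longrightarrow> \<gamma>1 fine D1 \<Longrightarrow> D2 tagged_division_of cbox a b \<Longrightarrow> \<gamma>1 fine D2
        \<Longrightarrow> norm (?R D1 (fn n) - ?R D2 (fn n)) < e / 4"
    by auto
  have "(gn n has_integral integral (cbox a b) (gn n)) (cbox a b)" using gn by (rule integrable_integral)
  from this[unfolded has_integral, rule_format, of "e / 8"] e obtain \<gamma>2 where \<gamma>2: "gauge \<gamma>2"
      "\<And>D. D tagged_division_of cbox a b \<Longrightarrow> \<gamma>2 fine D \<Longrightarrow> norm (?R D (gn n) - integral (cbox a b) (gn n)) < e / 8"
    by auto
  have close: "norm (?R D f - ?R D (fn n)) < e / 4" if D: "D tagged_division_of cbox a b" "\<gamma>2 fine D" for D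
  proof -
    have "?R D f - ?R D (fn n) = (\<Sum>(x, K)\<in>D. measure lborel K *\<^sub>R (f x - fn n x))"
      unfolding sum_subtractf[symmetric] by (intro sum.cong) (auto simp: scaleR_diff_right)
    also have "norm \<dots> \<le> ?R D (gn n)"
    proof (rule sum_norm_le)
      fix p assume p: "p \<in> D"
      obtain x K where xK: "p = (x, K)" by fastforce
      then have "x \<in> cbox a b" using tagged_division_ofD(2,3)[OF D(1)] p by blast
      from le[OF this, of n] show "norm (case p of (x, K) \<Rightarrow> measure lborel K *\<^sub>R (f x - fn n x)) \<le> (case p of (x, K) \<Rightarrow> measure lborel K *\<^sub>R gn n x)"
        unfolding xK by (simp add: mult_left_mono)
    qed
    also have "\<dots> < e / 4"
      using \<gamma>2(2)[OF D] n unfolding real_norm_def by linarith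
    finally show ?thesis .
  qed
  show "\<exists>\<gamma>. gauge \<gamma> \<and> (\<forall>D1 D2. D1 tagged_division_of cbox a b \<and> \<gamma> fine D1 \<and>
          D2 tagged_division_of cbox a b \<and> \<gamma> fine D2 \<longrightarrow> norm (?R D1 f - ?R D2 f) < e)"
  proof (intro exI[of _ "\<lambda>x. \<gamma>1 x \<inter> \<gamma>2 x"] conjI allI impI gauge_Int \<gamma>1(1) \<gamma>2(1))
    fix D1 D2
    assume "D1 tagged_division_of cbox a b \<and> (\<lambda>x. \<gamma>1 x \<inter> \<gamma>2 x) fine D1 \<and>
          D2 tagged_division_of cbox a b \<and> (\<lambda>x. \<gamma>1 x \<inter> \<gamma>2 x) fine D2"
    then have D: "D1 tagged_division_of cbox a b" "\<gamma>1 fine D1" "\<gamma>2 fine D1"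
        "D2 tagged_division_of cbox a b" "\<gamma>1 fine D2" "\<gamma>2 fine D2"
      by (auto simp: fine_Int)
    have tri: "norm (a - b) \<le> norm (a - c) + norm (c - d) + norm (b - d)" for a b c d :: 'b
      using norm_triangle_ineq[of "a - c" "c - b"] norm_triangle_ineq4[of "c - d" "b - d"] by simp
    show "norm (?R D1 f - ?R D2 f) < e"
      using tri[of "?R D1 f" "?R D2 f" "?R D1 (fn n)" "?R D2 (fn n)"]
        close[OF D(1,3)] close[OF D(4,6)] \<gamma>1(2)[OF D(1,2,4,5)] e by linarith
  qed
qed

text \<open>
  The integrand of the functional calculus is continuous except at the vertex of the contour, where it may be
  unbounded.
\<close>

lemma integrable_on_punctured_line:
  fixes f :: "real \<Rightarrow> 'b::banach"
  assumes cont: "continuous_on (- {0}) f" and g: "integrable lborel g"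
    and le: "\<And>t. t \<noteq> 0 \<Longrightarrow> norm (f t) \<le> g t"
  shows "f integrable_on UNIV"
proof -
  define f0 where "f0 t = (if t = 0 then 0 else f t)" for t
  define J where "J n = {- inverse (real (Suc n))<..<inverse (real (Suc n))}" for n
  define fn where "fn n t = (if t \<in> J n then 0 else f0 t)" for n t
  define gn where "gn n t = indicator (J n) t * \<bar>g t\<bar>" for n t
  have cont0: "continuous_on (- {0}) f0"
    by (rule iffD1[OF continuous_on_cong cont]) (auto simp: f0_def)
  have J0: "0 \<in> J n" and openJ: "open (J n)" for n by (auto simp: J_def)
  have meas[measurable]: "J n \<in> sets borel" for n unfolding J_def by simp
  have gn_int: "integrable lborel (gn n)" for n
    unfolding gn_def
    by (rule Bochner_Integration.integrable_bound[OF g]) (use g in \<open>auto simp: indicator_def\<close>)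
  have "(\<lambda>n. integral\<^sup>L lborel (gn n)) \<longlonglongrightarrow> (LINT t|(lborel :: real measure). 0 :: real)"
  proof (rule integral_dominated_convergence[where w = "\<lambda>t. \<bar>g t\<bar>"])
    show "AE t in lborel. (\<lambda>n. gn n t) \<longlonglongrightarrow> 0"
      using AE_lborel_singleton[of 0]
    proof eventually_elim
      case (elim t)
      then obtain N where N: "inverse (real (Suc N)) < \<bar>t\<bar>" using reals_Archimedean[of "\<bar>t\<bar>"] by auto
      have "t \<notin> J n" if "N \<le> n" for n
      proof -
        have "inverse (real (Suc n)) \<le> inverse (real (Suc N))" using that by (intro le_imp_inverse_le) auto
        moreover have "\<bar>t\<bar> < inverse (real (Suc n))" if "t \<in> J n"
          using that unfolding J_def by (auto simp: abs_less_iff simp del: of_nat_Suc)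
        ultimately show ?thesis using N by linarith
      qed
      then show ?case
        by (intro tendsto_eventually eventually_sequentiallyI[of N]) (simp add: gn_def)
    qed
  qed (use g gn_int in \<open>auto simp: gn_def indicator_def intro!: AE_I2\<close>)
  then have lim: "(\<lambda>n. integral\<^sup>L lborel (gn n)) \<longlonglongrightarrow> 0" by simp
  have cbox: "f0 integrable_on cbox a b" for a b
  proof (rule integrable_on_cbox_if_approx[of fn a b gn])
    show "gn n integrable_on cbox a b" for n
      using integrable_on_lborel[OF gn_int[of n]] integrable_on_subcbox by blast
    show "norm (f0 t - fn n t) \<le> gn n t" for n t
      using le[of t] by (auto simp: fn_def f0_def gn_def intro: order_trans)
    show "fn n integrable_on cbox a b" for n
    proof -
      have 1: "f0 integrable_on (cbox a b \<inter> {..- inverse (real (Suc n))})"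
        "f0 integrable_on (cbox a b \<inter> {inverse (real (Suc n))..})"
        by (auto simp: cbox_interval Int_atLeastAtMostR1 Int_atLeastAtMostL1 simp del: of_nat_Suc
            intro!: integrable_continuous_interval continuous_on_subset[OF cont0])
      have 2: "(cbox a b \<inter> {..- inverse (real (Suc n))}) \<inter> (cbox a b \<inter> {inverse (real (Suc n))..}) = {}"
        using inverse_positive_iff_positive[of "real (Suc n)"] by (auto simp del: of_nat_Suc inverse_positive_iff_positive)
      have "f0 integrable_on ((cbox a b \<inter> {..- inverse (real (Suc n))}) \<union> (cbox a b \<inter> {inverse (real (Suc n))..}))"
        by (rule integrable_Un[OF _ 1]) (simp add: 2)
      then have "(\<lambda>t. if t \<in> (cbox a b \<inter> {..- inverse (real (Suc n))}) \<union> (cbox a b \<inter> {inverse (real (Suc n))..}) then f0 t else 0) integrable_on cbox a b"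
        unfolding integrable_on_def by (subst has_integral_restrict) auto
      then show ?thesis
        by (rule integrable_eq) (auto simp: fn_def J_def)
    qed
    show "(\<lambda>n. integral (cbox a b) (gn n)) \<longlonglongrightarrow> 0"
    proof (rule Lim_null_comparison[OF _ lim], rule always_eventually, rule allI)
      fix n
      have "0 \<le> gn n t" for t by (simp add: gn_def indicator_def)
      moreover have "gn n integrable_on UNIV" "gn n integrable_on cbox a b"
        using integrable_on_lborel[OF gn_int[of n]] integrable_on_subcbox by blast+
      ultimately have "integral (cbox a b) (gn n) \<le> integral UNIV (gn n)" "0 \<le> integral (cbox a b) (gn n)"
        by (auto intro!: integral_subset_le integral_nonneg)
      then show "norm (integral (cbox a b) (gn n)) \<le> integral\<^sup>L lborel (gn n)"
        using integral_lborel[OF gn_int[of n]] by simp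
    qed
  qed
  have "f0 integrable_on UNIV"
  proof (rule integrable_on_all_intervals_integrable_bound[where g = "\<lambda>t. \<bar>g t\<bar>"])
    show "norm (f0 t) \<le> \<bar>g t\<bar>" for t using le[of t] by (auto simp: f0_def intro: order_trans)
    show "(\<lambda>t. \<bar>g t\<bar>) integrable_on UNIV" using g by (intro integrable_on_lborel integrable_abs)
  qed (use cbox in simp)
  then show ?thesis
    by (rule integrable_spike[of _ _ "{0}"]) (auto simp: f0_def)
qed

section \<open>Exponentially decaying functions on strips\<close>

text \<open>
  The logarithmic form of \<open>Hinf0\<close>; see \<open>Hinf0_strip_fun\<close>.
\<close>

definition strip_fun :: "real \<Rightarrow> (complex \<Rightarrow> complex) \<Rightarrow> bool"
  where "strip_fun \<beta> p \<longleftrightarrow> p holomorphic_on hstrip (- \<beta>) \<beta> \<and>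
    (\<exists>C \<sigma>. 0 \<le> C \<and> 0 < \<sigma> \<and> (\<forall>w\<in>hstrip (- \<beta>) \<beta>. cmod (p w) \<le> C * exp (- \<sigma> * \<bar>Re w\<bar>)))"

lemma strip_funE:
  assumes "strip_fun \<beta> p"
  obtains C \<sigma> where "0 \<le> C" "0 < \<sigma>" "\<And>w. w \<in> hstrip (- \<beta>) \<beta> \<Longrightarrow> cmod (p w) \<le> C * exp (- \<sigma> * \<bar>Re w\<bar>)"
  using assms unfolding strip_fun_def by blast

lemma strip_fun_holomorphic: "strip_fun \<beta> p \<Longrightarrow> p holomorphic_on hstrip (- \<beta>) \<beta>"
  by (simp add: strip_fun_def)

lemma strip_fun_continuous: "strip_fun \<beta> p \<Longrightarrow> continuous_on (hstrip (- \<beta>) \<beta>) p"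
  by (simp add: strip_fun_def holomorphic_on_imp_continuous_on)

lemma strip_fun_decaying: "strip_fun \<beta> p \<Longrightarrow> decaying (- \<beta>) \<beta> p"
  unfolding strip_fun_def decaying_def by blast

lemma strip_fun_mono:
  assumes "strip_fun \<beta> p" "\<beta>' \<le> \<beta>"
  shows "strip_fun \<beta>' p"
proof -
  have "hstrip (- \<beta>') \<beta>' \<subseteq> hstrip (- \<beta>) \<beta>" using assms(2) by auto
  then show ?thesis using assms(1) unfolding strip_fun_def by (meson holomorphic_on_subset subsetD)
qed

lemma strip_fun_shift:
  assumes "strip_fun \<beta> p" "\<bar>Im l\<bar> \<le> a"
  shows "strip_fun (\<beta> - a) (\<lambda>w. p (l + w))"
  unfolding strip_fun_def
proof
  have sub: "(\<lambda>w. l + w) ` hstrip (- (\<beta> - a)) (\<beta> - a) \<subseteq> hstrip (- \<beta>) \<beta>"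
    using assms(2) by (auto simp: abs_le_iff)
  show "(\<lambda>w. p (l + w)) holomorphic_on hstrip (- (\<beta> - a)) (\<beta> - a)"
  proof -
    have "(p \<circ> (\<lambda>w. l + w)) holomorphic_on hstrip (- (\<beta> - a)) (\<beta> - a)"
      by (rule holomorphic_on_compose_gen[OF _ strip_fun_holomorphic[OF assms(1)] sub]) (intro holomorphic_intros)
    then show ?thesis by (simp add: o_def)
  qed
  obtain C \<sigma> where C: "0 \<le> C" "0 < \<sigma>" and bd: "\<And>w. w \<in> hstrip (- \<beta>) \<beta> \<Longrightarrow> cmod (p w) \<le> C * exp (- \<sigma> * \<bar>Re w\<bar>)"
    using strip_funE[OF assms(1)] by metis
  have "cmod (p (l + w)) \<le> (C * exp (\<sigma> * \<bar>Re l\<bar>)) * exp (- \<sigma> * \<bar>Re w\<bar>)" if "w \<in> hstrip (- (\<beta> - a)) (\<beta> - a)" for w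
  proof -
    have "\<bar>Re w\<bar> \<le> \<bar>Re (l + w)\<bar> + \<bar>Re l\<bar>" by simp
    then have "\<sigma> * \<bar>Re w\<bar> \<le> \<sigma> * (\<bar>Re (l + w)\<bar> + \<bar>Re l\<bar>)" using C by (intro mult_left_mono) auto
    then have "exp (- \<sigma> * \<bar>Re (l + w)\<bar>) \<le> exp (\<sigma> * \<bar>Re l\<bar>) * exp (- \<sigma> * \<bar>Re w\<bar>)"
      by (simp add: exp_add[symmetric] algebra_simps)
    then have "C * exp (- \<sigma> * \<bar>Re (l + w)\<bar>) \<le> C * (exp (\<sigma> * \<bar>Re l\<bar>) * exp (- \<sigma> * \<bar>Re w\<bar>))"
      using C by (intro mult_left_mono)
    moreover have "cmod (p (l + w)) \<le> C * exp (- \<sigma> * \<bar>Re (l + w)\<bar>)"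
      using that sub by (intro bd) blast
    ultimately show ?thesis by simp
  qed
  then show "\<exists>C \<sigma>. 0 \<le> C \<and> 0 < \<sigma> \<and> (\<forall>w\<in>hstrip (- (\<beta> - a)) (\<beta> - a). cmod (p (l + w)) \<le> C * exp (- \<sigma> * \<bar>Re w\<bar>))"
    using C by (intro exI[of _ "C * exp (\<sigma> * \<bar>Re l\<bar>)"] exI[of _ \<sigma>]) auto
qed

lemma strip_fun_bounded:
  assumes "strip_fun \<beta> p"
  obtains B where "0 \<le> B" "\<And>w. w \<in> hstrip (- \<beta>) \<beta> \<Longrightarrow> cmod (p w) \<le> B"
proof -
  obtain C \<sigma> where C: "0 \<le> C" "0 < \<sigma>" "\<And>w. w \<in> hstrip (- \<beta>) \<beta> \<Longrightarrow> cmod (p w) \<le> C * exp (- \<sigma> * \<bar>Re w\<bar>)"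
    using strip_funE[OF assms] by metis
  have "cmod (p w) \<le> C" if "w \<in> hstrip (- \<beta>) \<beta>" for w
  proof -
    have "C * exp (- \<sigma> * \<bar>Re w\<bar>) \<le> C * 1" using C by (intro mult_left_mono) auto
    then show ?thesis using C(3)[OF that] by simp
  qed
  then show thesis using that C(1) by blast
qed

lemma strip_fun_mult:
  assumes p: "strip_fun \<beta> p" and q: "strip_fun \<beta> q"
  shows "strip_fun \<beta> (\<lambda>w. p w * q w)"
proof -
  obtain C \<sigma> where C: "0 \<le> C" "0 < \<sigma>" "\<And>w. w \<in> hstrip (- \<beta>) \<beta> \<Longrightarrow> cmod (p w) \<le> C * exp (- \<sigma> * \<bar>Re w\<bar>)"
    using strip_funE[OF p] by metis
  obtain B where B: "0 \<le> B" "\<And>w. w \<in> hstrip (- \<beta>) \<beta> \<Longrightarrow> cmod (q w) \<le> B"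
    using strip_fun_bounded[OF q] by metis
  have "cmod (p w * q w) \<le> (C * B) * exp (- \<sigma> * \<bar>Re w\<bar>)" if "w \<in> hstrip (- \<beta>) \<beta>" for w
    using mult_mono[OF C(3)[OF that] B(2)[OF that]] C by (simp add: norm_mult algebra_simps)
  then show ?thesis
    using C B unfolding strip_fun_def
    by (intro conjI holomorphic_intros strip_fun_holomorphic[OF p] strip_fun_holomorphic[OF q]
        exI[of _ "C * B"] exI[of _ \<sigma>]) auto
qed

lemma strip_fun_line_integrable:
  assumes "strip_fun \<beta> p" "\<bar>c\<bar> < \<beta>"
  shows "integrable lborel (\<lambda>u. p (Complex u c))"
  by (rule line_integrable[OF strip_fun_continuous[OF assms(1)] strip_fun_decaying[OF assms(1)]]) (use assms(2) in auto)

section \<open>The resolvent in logarithmic coordinates\<close>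

lemma sector_subset_cone:
  assumes "0 < \<omega>" "\<omega> \<le> pi" "z \<in> sector \<omega>"
  shows "cmod z * cos \<omega> \<le> Re z"
proof -
  have "Re z = cmod z * cos (Arg z)"
    by (metis Re_rcis rcis_cmod_Arg)
  also have "cos (Arg z) = cos \<bar>Arg z\<bar>" by simp
  also have "cmod z * cos \<bar>Arg z\<bar> \<ge> cmod z * cos \<omega>"
    using assms by (intro mult_left_mono cos_monotone_0_pi_le) (auto simp: sector_def)
  finally show ?thesis .
qed

lemma exp_notin_closure_sector:
  assumes "0 < \<theta>" "\<theta> < \<bar>Im w\<bar>" "\<bar>Im w\<bar> < pi"
  shows "exp w \<notin> closure (sector \<theta>)"
proof
  assume "exp w \<in> closure (sector \<theta>)"
  moreover have "closure (sector \<theta>) \<subseteq> {z. cmod z * cos \<theta> \<le> Re z}"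
    using assms by (intro closure_minimal closed_Collect_le continuous_intros) (auto intro: sector_subset_cone)
  ultimately have "exp (Re w) * cos \<theta> \<le> exp (Re w) * cos (Im w)"
    by (auto simp: Re_exp)
  then have "cos \<theta> \<le> cos \<bar>Im w\<bar>" by simp
  moreover have "cos \<bar>Im w\<bar> < cos \<theta>"
    using assms by (intro cos_monotone_0_pi) auto
  ultimately show False by simp
qed

locale sectorial_operator =
  fixes D :: "'a::complex_hilbert set" and A :: "'a \<Rightarrow> 'a" and \<omega> :: real
  assumes \<omega>_pos: "0 < \<omega>" and sectorial: "sectorial \<omega> D A"
begin

text \<open>
  The factor \<open>exp w\<close> is the derivative of the substitution \<open>z = exp w\<close>, and it makes the sectoriality estimate a plain
  bound.
\<close>

definition scaled_res :: "complex \<Rightarrow> ('a \<Rightarrow>\<^sub>L 'a)"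
  where "scaled_res w = scaleC_op (exp w) (resolvent D A (exp w))"

text \<open>
  The map \<open>exp\<close> sends this onto the complement of the union of the closed sector of angle \<open>\<omega>\<close> and the
  negative real axis.
\<close>

definition off_sector :: "complex set"
  where "off_sector = {w. \<omega> < \<bar>Im w\<bar> \<and> \<bar>Im w\<bar> < pi}"

lemma exp_in_resolvent_set: "w \<in> off_sector \<Longrightarrow> exp w \<in> resolvent_set D A"
  using exp_notin_closure_sector[of \<omega> w] \<omega>_pos sectorial unfolding sectorial_def op_spectrum_def off_sector_def by blast

lemma resolvent_props:
  assumes "z \<in> resolvent_set D A"
  shows "blinfun_apply (resolvent D A z) x \<in> D"
    and "z *\<^sub>C blinfun_apply (resolvent D A z) x - A (blinfun_apply (resolvent D A z) x) = x"
    and "u \<in> D \<Longrightarrow> blinfun_apply (resolvent D A z) (z *\<^sub>C u - A u) = u"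
proof -
  have bij: "bij_betw (\<lambda>x. z *\<^sub>C x - A x) D UNIV" and bl: "bounded_linear (inv_into D (\<lambda>x. z *\<^sub>C x - A x))"
    using assms by (auto simp: resolvent_set_def)
  have R: "blinfun_apply (resolvent D A z) = inv_into D (\<lambda>x. z *\<^sub>C x - A x)"
    unfolding resolvent_def by (rule bounded_linear_Blinfun_apply[OF bl])
  show "blinfun_apply (resolvent D A z) x \<in> D"
    unfolding R using bij by (metis UNIV_I bij_betw_imp_surj_on inv_into_into)
  show "z *\<^sub>C blinfun_apply (resolvent D A z) x - A (blinfun_apply (resolvent D A z) x) = x"
    unfolding R using bij_betw_inv_into_right[OF bij, of x] by simp
  show "u \<in> D \<Longrightarrow> blinfun_apply (resolvent D A z) (z *\<^sub>C u - A u) = u"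
    unfolding R using bij_betw_inv_into_left[OF bij, of u] by simp
qed

lemma domain_linear:
  shows "x \<in> D \<Longrightarrow> y \<in> D \<Longrightarrow> x + y \<in> D" "x \<in> D \<Longrightarrow> y \<in> D \<Longrightarrow> A (x + y) = A x + A y"
    and "x \<in> D \<Longrightarrow> c *\<^sub>C x \<in> D" "x \<in> D \<Longrightarrow> A (c *\<^sub>C x) = c *\<^sub>C A x"
  using sectorial unfolding sectorial_def closed_densely_defined_def by blast+

lemma resolvent_scaleC:
  assumes "z \<in> resolvent_set D A"
  shows "blinfun_apply (resolvent D A z) (c *\<^sub>C x) = c *\<^sub>C blinfun_apply (resolvent D A z) x"
proof -
  let ?R = "blinfun_apply (resolvent D A z)"
  have "c *\<^sub>C x = z *\<^sub>C (c *\<^sub>C ?R x) - A (c *\<^sub>C ?R x)"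
    by (subst (1) resolvent_props(2)[OF assms, of x, symmetric])
      (simp add: domain_linear resolvent_props(1)[OF assms] scaleC_diff_right scaleC_scaleC mult.commute)
  then show ?thesis
    by (metis assms domain_linear(3) resolvent_props(1,3))
qed

lemma resolvent_identity:
  assumes z: "z \<in> resolvent_set D A" and z': "z' \<in> resolvent_set D A"
  shows "blinfun_apply (resolvent D A z) x - blinfun_apply (resolvent D A z') x
    = (z' - z) *\<^sub>C blinfun_apply (resolvent D A z) (blinfun_apply (resolvent D A z') x)"
proof -
  define u where "u = blinfun_apply (resolvent D A z') x"
  have u: "u \<in> D" "z' *\<^sub>C u - A u = x" unfolding u_def using resolvent_props[OF z'] by auto
  have "z *\<^sub>C u - A u = (z *\<^sub>C u - z' *\<^sub>C u) + x" using u(2) by (simp add: algebra_simps)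
  also have "z *\<^sub>C u - z' *\<^sub>C u = (z - z') *\<^sub>C u"
    using scaleC_add_left[of "z - z'" z' u] by (simp add: algebra_simps)
  finally have "u = blinfun_apply (resolvent D A z) ((z - z') *\<^sub>C u + x)"
    using resolvent_props(3)[OF z u(1)] by simp
  also have "\<dots> = (z - z') *\<^sub>C blinfun_apply (resolvent D A z) u + blinfun_apply (resolvent D A z) x"
    by (simp add: blinfun.add_right resolvent_scaleC[OF z])
  finally have "blinfun_apply (resolvent D A z) x - u = - ((z - z') *\<^sub>C blinfun_apply (resolvent D A z) u)"
    by (simp add: algebra_simps)
  also have "\<dots> = (z' - z) *\<^sub>C blinfun_apply (resolvent D A z) u"
    using scaleC_add_left[of "z - z'" "z' - z" "blinfun_apply (resolvent D A z) u"] by (intro minus_unique) simp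
  finally show ?thesis unfolding u_def .
qed

lemma scaled_res_scaleC: "w \<in> off_sector \<Longrightarrow> blinfun_apply (scaled_res w) (c *\<^sub>C x) = c *\<^sub>C blinfun_apply (scaled_res w) x"
  unfolding scaled_res_def by (simp add: resolvent_scaleC exp_in_resolvent_set scaleC_scaleC mult.commute)

text \<open>
  The resolvent identity in a form without division, from which both the continuity and the derivative of the
  scaled resolvent are read off.
\<close>

lemma scaled_res_identity:
  assumes "v \<in> off_sector" "w \<in> off_sector"
  shows "blinfun_apply (scaled_res v) x - exp (v - w) *\<^sub>C blinfun_apply (scaled_res w) x
    = (1 - exp (v - w)) *\<^sub>C blinfun_apply (scaled_res v) (blinfun_apply (scaled_res w) x)"
proof -
  note rv = exp_in_resolvent_set[OF assms(1)] and rw = exp_in_resolvent_set[OF assms(2)]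
  let ?R = "\<lambda>w. blinfun_apply (resolvent D A (exp w))"
  have "exp (v - w) * exp w = exp v" by (simp add: exp_diff)
  then have "blinfun_apply (scaled_res v) x - exp (v - w) *\<^sub>C blinfun_apply (scaled_res w) x = exp v *\<^sub>C (?R v x - ?R w x)"
    by (simp add: scaled_res_def scaleC_scaleC scaleC_diff_right)
  also have "\<dots> = (exp v * (exp w - exp v)) *\<^sub>C ?R v (?R w x)"
    by (simp add: resolvent_identity[OF rv rw] scaleC_scaleC)
  also have "exp v * (exp w - exp v) = (1 - exp (v - w)) * (exp v * exp w)"
    by (simp add: exp_diff algebra_simps)
  also have "\<dots> *\<^sub>C ?R v (?R w x) = (1 - exp (v - w)) *\<^sub>C blinfun_apply (scaled_res v) (blinfun_apply (scaled_res w) x)"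
    by (simp add: scaled_res_def scaleC_scaleC resolvent_scaleC[OF rv])
  finally show ?thesis .
qed

lemma scaled_res_bounded:
  assumes "\<omega> < \<gamma>" "\<gamma> < pi"
  obtains K where "0 < K" "\<And>w. \<gamma> \<le> \<bar>Im w\<bar> \<Longrightarrow> \<bar>Im w\<bar> < pi \<Longrightarrow> norm (scaled_res w) \<le> K"
proof -
  define \<theta> where "\<theta> = (\<omega> + \<gamma>) / 2"
  have \<theta>: "\<theta> \<in> {\<omega><..<pi}" "0 < \<theta>" "\<theta> < \<gamma>" using assms \<omega>_pos unfolding \<theta>_def by auto
  obtain K where K: "0 < K" "\<forall>z\<in>- closure (sector \<theta>). norm (scaleC_op z (resolvent D A z)) \<le> K"
    using sectorial \<theta>(1) unfolding sectorial_def by blast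
  show thesis
  proof (rule that[OF K(1)])
    fix w :: complex assume "\<gamma> \<le> \<bar>Im w\<bar>" "\<bar>Im w\<bar> < pi"
    then have "exp w \<in> - closure (sector \<theta>)" using exp_notin_closure_sector[of \<theta> w] \<theta> by auto
    then show "norm (scaled_res w) \<le> K" using K(2) unfolding scaled_res_def by blast
  qed
qed

lemma open_off_sector: "open off_sector"
  unfolding off_sector_def by (intro open_Collect_conj open_Collect_less continuous_intros)

lemma scaled_res_tendsto:
  assumes "w \<in> off_sector"
  shows "(scaled_res \<longlongrightarrow> scaled_res w) (at w)"
proof -
  define \<gamma> where "\<gamma> = (\<omega> + \<bar>Im w\<bar>) / 2"
  have \<gamma>: "\<omega> < \<gamma>" "\<gamma> < \<bar>Im w\<bar>" "\<bar>Im w\<bar> < pi" using assms unfolding \<gamma>_def off_sector_def by auto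
  then obtain K where K: "0 < K" "\<And>w. \<gamma> \<le> \<bar>Im w\<bar> \<Longrightarrow> \<bar>Im w\<bar> < pi \<Longrightarrow> norm (scaled_res w) \<le> K"
    using scaled_res_bounded[of \<gamma>] by (metis order_less_trans)
  have op: "open {v. \<gamma> < \<bar>Im v\<bar> \<and> \<bar>Im v\<bar> < pi}"
    by (intro open_Collect_conj open_Collect_less continuous_intros)
  have "\<forall>\<^sub>F v in at w. v \<in> {v. \<gamma> < \<bar>Im v\<bar> \<and> \<bar>Im v\<bar> < pi}"
    by (rule eventually_at_in_open'[OF op]) (use \<gamma> in auto)
  then have bd: "\<forall>\<^sub>F v in at w. norm (scaled_res v - scaled_res w) \<le> cmod (1 - exp (v - w)) * (K * K + K)"
  proof eventually_elim
    case (elim v)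
    then have v: "v \<in> off_sector" "norm (scaled_res v) \<le> K" using \<gamma> K(2)[of v] by (auto simp: off_sector_def)
    have w: "norm (scaled_res w) \<le> K" using K(2)[of w] \<gamma> by simp
    show ?case
    proof (rule norm_blinfun_bound)
      fix x
      have "blinfun_apply (scaled_res v - scaled_res w) x = (1 - exp (v - w)) *\<^sub>C blinfun_apply (scaled_res v) (blinfun_apply (scaled_res w) x) - (1 - exp (v - w)) *\<^sub>C blinfun_apply (scaled_res w) x"
        using scaled_res_identity[OF v(1) assms, of x] scaleC_add_left[of "1 - exp (v - w)" "exp (v - w)" "blinfun_apply (scaled_res w) x"]
        by (simp add: blinfun.diff_left algebra_simps)
      also have "norm \<dots> \<le> cmod (1 - exp (v - w)) * norm (blinfun_apply (scaled_res v) (blinfun_apply (scaled_res w) x)) + cmod (1 - exp (v - w)) * norm (blinfun_apply (scaled_res w) x)"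
        by (rule order_trans[OF norm_triangle_ineq4]) (simp add: norm_scaleC)
      also have "\<dots> \<le> cmod (1 - exp (v - w)) * (K * (K * norm x)) + cmod (1 - exp (v - w)) * (K * norm x)"
      proof (intro add_mono mult_left_mono)
        show 1: "norm (blinfun_apply (scaled_res w) x) \<le> K * norm x"
          using norm_blinfun[of "scaled_res w" x] w by (meson mult_right_mono norm_ge_zero order_trans)
        show "norm (blinfun_apply (scaled_res v) (blinfun_apply (scaled_res w) x)) \<le> K * (K * norm x)"
          using norm_blinfun[of "scaled_res v" "blinfun_apply (scaled_res w) x"] mult_mono[OF v(2) 1] K(1) by simp
      qed auto
      finally show "norm (blinfun_apply (scaled_res v - scaled_res w) x) \<le> cmod (1 - exp (v - w)) * (K * K + K) * norm x"
        by (simp add: algebra_simps)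
    qed (use K in auto)
  qed
  have "((\<lambda>v. cmod (1 - exp (v - w)) * (K * K + K)) \<longlongrightarrow> cmod (1 - exp (w - w)) * (K * K + K)) (at w)"
    by (intro tendsto_intros)
  then have "((\<lambda>v. scaled_res v - scaled_res w) \<longlongrightarrow> 0) (at w)"
    by (intro Lim_null_comparison[OF bd]) simp
  then show ?thesis by (simp add: LIM_zero_iff)
qed

lemma scaled_res_continuous: "continuous_on off_sector scaled_res"
  using scaled_res_tendsto at_within_open[OF _ open_off_sector] unfolding continuous_on_def by metis

text \<open>
  By \<open>scaled_res_identity\<close> the increment of \<open>S(w) x\<close> from \<open>w\<close> to \<open>v\<close> is \<open>exp (v - w) - 1\<close> times
  \<open>S(w) x - S(v) S(w) x\<close>, which gives the derivative \<open>\<langle>S(w) x - S(w)\<^sup>2 x, y\<rangle>\<close>.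
\<close>

lemma scaled_res_cinner_holomorphic: "(\<lambda>w. cinner (blinfun_apply (scaled_res w) x) y) holomorphic_on off_sector"
proof -
  have "((\<lambda>w. cinner (blinfun_apply (scaled_res w) x) y) has_field_derivative
      cinner (blinfun_apply (scaled_res w) x - blinfun_apply (scaled_res w) (blinfun_apply (scaled_res w) x)) y) (at w)" if w: "w \<in> off_sector" for w
    unfolding has_field_derivative_iff
  proof (rule Lim_transform_eventually)
    let ?z = "blinfun_apply (scaled_res w) x"
    have "((\<lambda>v. (exp (v - w) - 1) / (v - w)) \<longlongrightarrow> 1) (at w)"
    proof -
      have "((\<lambda>v. exp (v - w)) has_field_derivative 1) (at w)"
        by (auto intro!: derivative_eq_intros)
      then show ?thesis by (simp add: has_field_derivative_iff)
    qed
    moreover have "((\<lambda>v. cinner (?z - blinfun_apply (scaled_res v) ?z) y) \<longlongrightarrow> cinner (?z - blinfun_apply (scaled_res w) ?z) y) (at w)"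
      by (intro bounded_linear.tendsto[OF bounded_linear_cinner_left] tendsto_intros scaled_res_tendsto w)
    ultimately show "((\<lambda>v. (exp (v - w) - 1) / (v - w) * cinner (?z - blinfun_apply (scaled_res v) ?z) y) \<longlongrightarrow> cinner (?z - blinfun_apply (scaled_res w) ?z) y) (at w)"
      using tendsto_mult by fastforce
    have "\<forall>\<^sub>F v in at w. v \<in> off_sector" by (rule eventually_at_in_open'[OF open_off_sector w])
    then show "\<forall>\<^sub>F v in at w. (exp (v - w) - 1) / (v - w) * cinner (?z - blinfun_apply (scaled_res v) ?z) y
        = (cinner (blinfun_apply (scaled_res v) x) y - cinner (blinfun_apply (scaled_res w) x) y) / (v - w)"
    proof eventually_elim
      case (elim v)
      have "blinfun_apply (scaled_res v) x - ?z = (exp (v - w) - 1) *\<^sub>C (?z - blinfun_apply (scaled_res v) ?z)"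
        using scaled_res_identity[OF elim w, of x] scaleC_add_left[of "exp (v - w) - 1" 1 ?z] scaleC_add_left[of "1 - exp (v - w)" "exp (v - w) - 1" "blinfun_apply (scaled_res v) ?z"]
        by (simp add: scaleC_diff_right algebra_simps add_eq_0_iff)
      then have "cinner (blinfun_apply (scaled_res v) x - ?z) y = (exp (v - w) - 1) * cinner (?z - blinfun_apply (scaled_res v) ?z) y"
        by (simp add: cinner_scaleC_left)
      moreover have "cinner (blinfun_apply (scaled_res v) x - ?z) y = cinner (blinfun_apply (scaled_res v) x) y - cinner ?z y"
        by (rule cinner_diff_left)
      ultimately show ?case by simp
    qed
  qed
  then show ?thesis
    unfolding holomorphic_on_def field_differentiable_def using has_field_derivative_at_within by blast
qed

end

section \<open>The functional calculus as a scalar contour integral\<close>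

lemma strip_fun_mult_integrable:
  assumes p: "strip_fun \<beta> p" and c: "\<bar>c\<bar> < \<beta>"
    and m: "continuous_on UNIV m" "\<And>u. cmod (m u) \<le> B"
  shows "integrable lborel (\<lambda>u. p (Complex u c) * m u)"
proof (rule Bochner_Integration.integrable_bound)
  show "integrable lborel (\<lambda>u. p (Complex u c) * B)"
    using strip_fun_line_integrable[OF p c] by simp
  have "continuous_on UNIV (\<lambda>u. p (Complex u c) * m u)"
    by (intro continuous_on_mult continuous_on_line[OF strip_fun_continuous[OF p]] m) (use c in auto)
  then show "(\<lambda>u. p (Complex u c) * m u) \<in> borel_measurable lborel"
    using borel_measurable_continuous_onI by simp
  have "norm (p (Complex u c) * m u) \<le> norm (p (Complex u c) * B)" for u
    using m(2)[of u] by (auto simp: norm_mult intro!: mult_left_mono)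
  then show "AE u in lborel. norm (p (Complex u c) * m u) \<le> norm (p (Complex u c) * B)" by simp
qed

context sectorial_operator
begin

text \<open>
  The functional calculus with an explicit angle \<open>\<gamma>\<close> of the contour.
\<close>

definition contour_calc :: "real \<Rightarrow> (complex \<Rightarrow> complex) \<Rightarrow> ('a \<Rightarrow>\<^sub>L 'a)"
  where "contour_calc \<gamma> f = scaleC_op (1 / (2 * complex_of_real pi * \<i>)) (sector_integral D A \<gamma> f)"

lemma scaled_res_line_continuous:
  assumes "\<omega> < \<bar>c\<bar>" "\<bar>c\<bar> < pi"
  shows "continuous_on UNIV (\<lambda>u. scaled_res (Complex u c))"
proof (rule continuous_on_compose2[OF scaled_res_continuous])
  show "continuous_on UNIV (\<lambda>u. Complex u c)"
    unfolding Complex_eq by (intro continuous_intros)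
qed (use assms in \<open>auto simp: off_sector_def\<close>)

lemma cinner_scaled_res_le:
  assumes "norm (scaled_res w) \<le> K"
  shows "cmod (cinner (blinfun_apply V (scaled_res w x)) y) \<le> norm V * K * norm x * norm y"
proof -
  have "norm (blinfun_apply V (scaled_res w x)) \<le> norm V * norm (scaled_res w x)"
    by (rule norm_blinfun)
  also have "\<dots> \<le> norm V * (K * norm x)"
    by (intro mult_left_mono order_trans[OF norm_blinfun] mult_right_mono assms) auto
  finally have "norm (blinfun_apply V (scaled_res w x)) * norm y \<le> norm V * (K * norm x) * norm y"
    by (intro mult_right_mono) auto
  with cmod_cinner_le[of "blinfun_apply V (scaled_res w x)" y] show ?thesis
    by (simp add: mult.assoc)
qed

lemma cinner_scaled_res_line_continuous:
  assumes "\<omega> < \<bar>c\<bar>" "\<bar>c\<bar> < pi"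
  shows "continuous_on UNIV (\<lambda>u. cinner (blinfun_apply V (scaled_res (Complex u c) x)) y)"
  by (intro bounded_linear.continuous_on[OF bounded_linear_cinner_left]
      bounded_linear.continuous_on[OF blinfun.bounded_linear_right]
      bounded_linear.continuous_on[OF blinfun.bounded_linear_left] scaled_res_line_continuous assms)

text \<open>
  The bounded functional \<open>U \<mapsto> \<langle>V U x, y\<rangle>\<close> may be moved inside the operator-valued integral.  The operator \<open>V\<close> is the
  identity in \<open>contour_calc_inner\<close> and the scaled resolvent at a point of another contour in
  \<open>product_formula\<close>.
\<close>

lemma contour_calc_weak:
  assumes f: "strip_fun \<beta> (\<lambda>w. f (exp w))" and \<gamma>: "\<omega> < \<gamma>" "\<gamma> < \<beta>" and \<beta>: "\<beta> \<le> pi"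
    and V: "\<And>c x. blinfun_apply V (c *\<^sub>C x) = c *\<^sub>C blinfun_apply V x"
  shows "cinner (blinfun_apply V (contour_calc \<gamma> f x)) y
    = 1 / (2 * complex_of_real pi * \<i>) * two_lines \<gamma> (\<lambda>w. f (exp w) * cinner (blinfun_apply V (scaled_res w x)) y)"
proof -
  define w where "w t = Complex (ln \<bar>t\<bar>) (if 0 < t then - \<gamma> else \<gamma>)" for t :: real
  define \<Phi> where "\<Phi> t = scaleC_op (f (sector_path \<gamma> t) * vector_derivative (sector_path \<gamma>) (at t)) (resolvent D A (sector_path \<gamma> t))" for t
  \<comment> \<open>On both rays \<open>sector_path \<gamma> t = exp (w t)\<close>, with derivative \<open>exp (w t) / t\<close>.\<close>
  define \<Phi>0 where "\<Phi>0 t = scaleC_op (f (exp (w t)) / complex_of_real t) (scaled_res (w t))" for t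
  define Z where "Z w = cinner (blinfun_apply V (scaled_res w x)) y" for w
  define \<Lambda> where "\<Lambda> U = cinner (blinfun_apply V (blinfun_apply U x)) y" for U
  define \<Psi> where "\<Psi> t = f (exp (w t)) / complex_of_real t * Z (w t)" for t
  have \<gamma>0: "0 < \<gamma>" "\<gamma> < pi" using \<gamma> \<beta> \<omega>_pos by auto
  obtain K where K: "0 < K" "\<And>w. \<gamma> \<le> \<bar>Im w\<bar> \<Longrightarrow> \<bar>Im w\<bar> < pi \<Longrightarrow> norm (scaled_res w) \<le> K"
    using scaled_res_bounded[OF \<gamma>(1) \<gamma>0(2)] by metis
  obtain C \<sigma> where C: "0 \<le> C" "0 < \<sigma>" "\<And>w. w \<in> hstrip (- \<beta>) \<beta> \<Longrightarrow> cmod (f (exp w)) \<le> C * exp (- \<sigma> * \<bar>Re w\<bar>)"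
    using strip_funE[OF f] by metis
  have w_exp: "sector_path \<gamma> t = exp (w t)" if "t \<noteq> 0" for t
    using that by (simp add: sector_path_def w_def exp_eq_polar)
  have w_deriv: "vector_derivative (sector_path \<gamma>) (at t) = exp (w t) / complex_of_real t" if "t \<noteq> 0" for t
  proof (rule vector_derivative_at, cases "0 < t")
    case True
    have "((\<lambda>t. complex_of_real t * cis (- \<gamma>)) has_vector_derivative exp (w t) / complex_of_real t) (at t)"
      using True by (auto intro!: derivative_eq_intros simp: w_def exp_eq_polar)
    then show "(sector_path \<gamma> has_vector_derivative exp (w t) / complex_of_real t) (at t)"
      by (rule has_vector_derivative_transform_within_open[of _ _ _ "{0<..}"]) (use True in \<open>auto simp: sector_path_def\<close>)
  next
    case False
    have "((\<lambda>t. - complex_of_real t * cis \<gamma>) has_vector_derivative exp (w t) / complex_of_real t) (at t)"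
      using False that by (auto intro!: derivative_eq_intros simp: w_def exp_eq_polar)
    then show "(sector_path \<gamma> has_vector_derivative exp (w t) / complex_of_real t) (at t)"
      by (rule has_vector_derivative_transform_within_open[of _ _ _ "{..<0}"]) (use False that in \<open>auto simp: sector_path_def\<close>)
  qed
  have \<Phi>_eq: "\<Phi> t = \<Phi>0 t" if "t \<noteq> 0" for t
    unfolding \<Phi>_def \<Phi>0_def scaled_res_def w_exp[OF that] w_deriv[OF that] scaleC_op_scaleC_op by simp
  have w_strip: "w t \<in> hstrip (- \<beta>) \<beta>" "w t \<in> off_sector" "norm (scaled_res (w t)) \<le> K" for t
    using \<gamma> \<gamma>0 K(2)[of "w t"] by (auto simp: w_def off_sector_def)
  have cont_w: "continuous_on (- {0}) w"
  proof -
    have "- {0::real} = {0<..} \<union> {..<0}" by auto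
    moreover have "continuous_on {0<..} w"
      by (rule continuous_on_eq[of _ "\<lambda>t. of_real (ln t) - \<i> * \<gamma>"])
        (auto intro!: continuous_intros simp: w_def Complex_eq)
    moreover have "continuous_on {..<0} w"
      by (rule continuous_on_eq[of _ "\<lambda>t. of_real (ln (- t)) + \<i> * \<gamma>"])
        (auto intro!: continuous_intros simp: w_def Complex_eq)
    ultimately show ?thesis by (simp add: continuous_on_open_Un)
  qed
  have cont_coeff: "continuous_on (- {0}) (\<lambda>t. f (exp (w t)) / complex_of_real t)"
    by (intro continuous_intros continuous_on_compose2[OF strip_fun_continuous[OF f] cont_w]) (use w_strip in auto)
  have cont_\<Phi>0: "continuous_on (- {0}) \<Phi>0"
    unfolding \<Phi>0_def
    by (intro bounded_bilinear.continuous_on[OF bounded_bilinear_scaleC_op] cont_coeff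
        continuous_on_compose2[OF scaled_res_continuous cont_w]) (use w_strip in auto)
  define h where "h r = C * K * exp (- \<sigma> * \<bar>ln r\<bar>) / r" for r :: real
  define g where "g t = indicator {0<..} t *\<^sub>R h t + indicator {0<..} (- t) *\<^sub>R h (- t)" for t
  have meas_h: "(\<lambda>t. indicator {0<..} t *\<^sub>R h t) \<in> borel_measurable borel"
    unfolding h_def by measurable
  have int_h: "integrable lborel (\<lambda>t. indicator {0<..} t *\<^sub>R h t)"
  proof -
    have "integrable lborel (\<lambda>u. C * K * exp (- \<sigma> * \<bar>u\<bar>))"
      by (intro integrable_mult_right integrable_exp_abs C)
    then show ?thesis
      unfolding integral_exp_subst(1)[OF meas_h] by (simp add: h_def)
  qed
  have int_g: "integrable lborel g"
    unfolding g_def using lborel_integrable_real_affine[OF int_h, of "- 1" 0]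
    by (intro Bochner_Integration.integrable_add int_h) simp
  have coeff_le: "cmod (f (exp (w t)) / complex_of_real t) * K \<le> g t" if "t \<noteq> 0" for t
  proof -
    have "cmod (f (exp (w t)) / complex_of_real t) * K \<le> (C * exp (- \<sigma> * \<bar>ln \<bar>t\<bar>\<bar>)) / \<bar>t\<bar> * K"
      using C(3)[OF w_strip(1)[of t]] K(1) by (intro mult_right_mono) (auto simp: norm_divide w_def divide_right_mono)
    also have "\<dots> = g t" using that by (cases "0 < t") (auto simp: g_def h_def)
    finally show ?thesis .
  qed
  have \<Phi>0_le: "norm (\<Phi>0 t) \<le> g t" if "t \<noteq> 0" for t
  proof -
    have "norm (\<Phi>0 t) \<le> cmod (f (exp (w t)) / complex_of_real t) * K"
      unfolding \<Phi>0_def by (intro order_trans[OF norm_scaleC_op_le] mult_left_mono w_strip) auto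
    then show ?thesis using coeff_le[OF that] by simp
  qed
  have int_\<Phi>0: "\<Phi>0 integrable_on UNIV"
    by (rule integrable_on_punctured_line[OF cont_\<Phi>0 int_g \<Phi>0_le])
  have bl: "bounded_linear \<Lambda>"
    unfolding \<Lambda>_def
    by (intro bounded_linear_compose[OF bounded_linear_cinner_left] bounded_linear_compose[OF blinfun.bounded_linear_right]
        blinfun.bounded_linear_left)
  have \<Lambda>_scaleC: "\<Lambda> (scaleC_op c U) = c * \<Lambda> U" for c U
    by (simp add: \<Lambda>_def V cinner_scaleC_left)
  have "\<Lambda> (sector_integral D A \<gamma> f) = \<Lambda> (integral UNIV \<Phi>0)"
  proof -
    have "integral UNIV \<Phi> = integral UNIV \<Phi>0"
      by (rule integral_spike[of "{0}"]) (use \<Phi>_eq in auto)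
    then show ?thesis unfolding sector_integral_def \<Phi>_def[symmetric] by simp
  qed
  also have "\<dots> = integral UNIV (\<Lambda> \<circ> \<Phi>0)"
    by (rule integral_linear[OF int_\<Phi>0 bl, symmetric])
  also have "\<Lambda> \<circ> \<Phi>0 = \<Psi>"
    by (rule ext) (simp add: \<Phi>0_def \<Psi>_def Z_def \<Lambda>_def V cinner_scaleC_left)
  also have "integral UNIV \<Psi> = two_lines \<gamma> (\<lambda>w. f (exp w) * Z w)"
  proof -
    define B where "B = norm V * norm x * norm y"
    have B: "0 \<le> B" by (simp add: B_def)
    have Z_le: "cmod (Z (w t)) \<le> K * B" for t
      unfolding Z_def B_def using cinner_scaled_res_le[OF w_strip(3)[of t], of V x y] by (simp add: mult_ac)
    have cont_\<Psi>: "continuous_on (- {0}) \<Psi>"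
      unfolding \<Psi>_def Z_def
      by (intro continuous_on_mult cont_coeff bounded_linear.continuous_on[OF bounded_linear_cinner_left]
        bounded_linear.continuous_on[OF blinfun.bounded_linear_right]
        bounded_linear.continuous_on[OF blinfun.bounded_linear_left]
        continuous_on_compose2[OF scaled_res_continuous cont_w]) (use w_strip in auto)
    have \<Psi>0: "\<Psi> 0 = 0" by (simp add: \<Psi>_def)
    have ind: "\<Psi> t = indicator (- {0}) t *\<^sub>R \<Psi> t" for t using \<Psi>0 by (auto simp: indicator_def)
    have meas[measurable]: "\<Psi> \<in> borel_measurable borel"
      using borel_measurable_continuous_on_indicator[OF _ cont_\<Psi>] ind by simp
    have int_\<Psi>: "integrable lborel \<Psi>"
    proof (rule Bochner_Integration.integrable_bound)
      show "integrable lborel (\<lambda>t. g t * B)" using int_g by simp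
      have "norm (\<Psi> t) \<le> norm (g t * B)" for t
      proof (cases "t = 0")
        case False
        have "norm (\<Psi> t) \<le> cmod (f (exp (w t)) / complex_of_real t) * (K * B)"
          unfolding \<Psi>_def norm_mult by (intro mult_left_mono Z_le) simp
        also have "\<dots> \<le> g t * B"
          using coeff_le[OF False] B by (simp add: mult.assoc[symmetric] mult_right_mono)
        also have "\<dots> \<le> norm (g t * B)" by simp
        finally show ?thesis .
      qed (simp add: \<Psi>0)
      then show "AE t in lborel. norm (\<Psi> t) \<le> norm (g t * B)" by simp
    qed simp
    have half: "integrable lborel (\<lambda>t. indicator {0<..} t *\<^sub>R \<Psi> t)" "integrable lborel (\<lambda>t. indicator {..<0} t *\<^sub>R \<Psi> t)"
      by (rule Bochner_Integration.integrable_bound[OF int_\<Psi>]; simp add: indicator_def)+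
    have m1: "(\<lambda>t. indicator {0<..} t *\<^sub>R \<Psi> t) \<in> borel_measurable borel"
      and m2: "(\<lambda>t. indicator {0<..} t *\<^sub>R \<Psi> (- t)) \<in> borel_measurable borel"
      by measurable
    have "integral UNIV \<Psi> = (LINT t|lborel. \<Psi> t)"
      by (rule integral_lborel[OF int_\<Psi>])
    also have "\<dots> = (LINT t|lborel. indicator {0<..} t *\<^sub>R \<Psi> t + indicator {..<0} t *\<^sub>R \<Psi> t)"
      by (intro Bochner_Integration.integral_cong refl) (auto simp: indicator_def \<Psi>0 not_less_iff_gr_or_eq)
    also have "\<dots> = (LINT t|lborel. indicator {0<..} t *\<^sub>R \<Psi> t) + (LINT t|lborel. indicator {..<0} t *\<^sub>R \<Psi> t)"
      by (rule Bochner_Integration.integral_add[OF half])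
    also have "(LINT t|lborel. indicator {..<0} t *\<^sub>R \<Psi> t) = (LINT t|lborel. indicator {0<..} t *\<^sub>R \<Psi> (- t))"
      by (subst lborel_integral_real_affine[of "- 1" _ 0]) (auto simp: indicator_def intro!: Bochner_Integration.integral_cong)
    also have "(LINT t|lborel. indicator {0<..} t *\<^sub>R \<Psi> t) = line_int (- \<gamma>) (\<lambda>w. f (exp w) * Z w)"
      unfolding integral_exp_subst(2)[OF m1] by (simp add: line_int_def \<Psi>_def w_def scaleR_conv_of_real)
    also have "(LINT t|lborel. indicator {0<..} t *\<^sub>R \<Psi> (- t)) = - line_int \<gamma> (\<lambda>w. f (exp w) * Z w)"
      unfolding integral_exp_subst(2)[OF m2] by (simp add: line_int_def \<Psi>_def w_def scaleR_conv_of_real)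
    finally show ?thesis by (simp add: two_lines_def)
  qed
  finally have "\<Lambda> (sector_integral D A \<gamma> f) = two_lines \<gamma> (\<lambda>w. f (exp w) * Z w)" .
  then show ?thesis
    using \<Lambda>_scaleC[of "1 / (2 * complex_of_real pi * \<i>)" "sector_integral D A \<gamma> f"]
    unfolding contour_calc_def \<Lambda>_def Z_def by simp
qed

end

section \<open>Exchanging contour integrals\<close>

lemma fubini_dominated:
  fixes h :: "real \<Rightarrow> real \<Rightarrow> complex"
  assumes [measurable]: "(\<lambda>(u, v). h u v) \<in> borel_measurable (lborel \<Otimes>\<^sub>M lborel)"
    and int: "\<And>u. integrable lborel (h u)" and a: "integrable lborel a"
    and le: "\<And>u. (LINT v|lborel. cmod (h u v)) \<le> a u"
  shows "integrable (lborel \<Otimes>\<^sub>M lborel) (\<lambda>(u, v). h u v)"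
    and "(LINT u|lborel. LINT v|lborel. h u v) = (LINT v|lborel. LINT u|lborel. h u v)"
    and "integrable lborel (\<lambda>u. LINT v|lborel. h u v)"
    and "integrable lborel (\<lambda>v. LINT u|lborel. h u v)"
proof -
  show P: "integrable (lborel \<Otimes>\<^sub>M lborel) (\<lambda>(u, v). h u v)"
  proof (rule lborel_pair.Fubini_integrable)
    show "integrable lborel (\<lambda>u. LINT v|lborel. norm (case (u, v) of (u, v) \<Rightarrow> h u v))"
    proof (rule Bochner_Integration.integrable_bound[OF a])
      have "\<bar>LINT v|lborel. cmod (h u v)\<bar> \<le> \<bar>a u\<bar>" for u
        using le[of u] Bochner_Integration.integral_nonneg[of lborel "\<lambda>v. cmod (h u v)"] by simp
      then show "AE u in lborel. norm (LINT v|lborel. norm (case (u, v) of (u, v) \<Rightarrow> h u v)) \<le> norm (a u)" by simp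
    qed measurable
  qed (use int in simp_all)
  show "(LINT u|lborel. LINT v|lborel. h u v) = (LINT v|lborel. LINT u|lborel. h u v)"
    using lborel_pair.Fubini_integral[of h] P by simp
  show "integrable lborel (\<lambda>u. LINT v|lborel. h u v)"
    using lborel_pair.integrable_fst'[OF P] by simp
  show "integrable lborel (\<lambda>v. LINT u|lborel. h u v)"
    using lborel_pair.integrable_snd[of h] P by simp
qed

lemma borel_measurable_pair_continuous:
  fixes h :: "real \<Rightarrow> real \<Rightarrow> complex"
  assumes "continuous_on UNIV (\<lambda>z. h (fst z) (snd z))"
  shows "(\<lambda>(u, v). h u v) \<in> borel_measurable (lborel \<Otimes>\<^sub>M lborel)"
  using borel_measurable_continuous_onI[OF assms] by (simp add: lborel_prod case_prod_beta')

lemma line_int_swap: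
  assumes a: "integrable lborel (\<lambda>u. a (Complex u c))" "continuous_on UNIV (\<lambda>u. a (Complex u c))"
    and b: "integrable lborel (\<lambda>v. b (Complex v d))" "continuous_on UNIV (\<lambda>v. b (Complex v d))"
    and k: "continuous_on UNIV (\<lambda>z. k (Complex (fst z) c) (Complex (snd z) d))"
      "\<And>u v. cmod (k (Complex u c) (Complex v d)) \<le> B"
  shows "line_int c (\<lambda>w. a w * line_int d (\<lambda>z. b z * k w z)) = line_int d (\<lambda>z. b z * line_int c (\<lambda>w. a w * k w z))"
    and "integrable lborel (\<lambda>u. a (Complex u c) * line_int d (\<lambda>z. b z * k (Complex u c) z))"
    and "integrable lborel (\<lambda>v. b (Complex v d) * line_int c (\<lambda>w. a w * k w (Complex v d)))"
proof -
  define h where "h u v = a (Complex u c) * (b (Complex v d) * k (Complex u c) (Complex v d))" for u v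
  have cont: "continuous_on UNIV (\<lambda>z. h (fst z) (snd z))"
    unfolding h_def
    by (intro continuous_on_mult k continuous_on_compose2[OF a(2) continuous_on_fst[OF continuous_on_id]]
        continuous_on_compose2[OF b(2) continuous_on_snd[OF continuous_on_id]]) auto
  have contu: "continuous_on UNIV (h u)" for u
  proof -
    have "continuous_on UNIV (\<lambda>v. (\<lambda>z. h (fst z) (snd z)) (u, v))"
      by (rule continuous_on_compose2[OF cont]) (auto intro!: continuous_intros)
    then show ?thesis by simp
  qed
  have B: "0 \<le> B" using k(2) norm_ge_zero order_trans by blast
  have le: "cmod (h u v) \<le> cmod (a (Complex u c)) * (cmod (b (Complex v d)) * B)" for u v
    unfolding h_def norm_mult by (intro mult_left_mono k) auto
  have intb: "integrable lborel (\<lambda>v. cmod (a (Complex u c)) * (cmod (b (Complex v d)) * B))" for u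
    using b(1) by (intro integrable_mult_right integrable_mult_left integrable_norm)
  have inth: "integrable lborel (h u)" for u
  proof (rule Bochner_Integration.integrable_bound[OF intb[of u]])
    show "h u \<in> borel_measurable lborel"
      using borel_measurable_continuous_onI[OF contu[of u]] by simp
    show "AE v in lborel. norm (h u v) \<le> norm (cmod (a (Complex u c)) * (cmod (b (Complex v d)) * B))"
      using le[of u] B by (simp add: abs_mult)
  qed
  have "(LINT v|lborel. cmod (h u v)) \<le> cmod (a (Complex u c)) * ((LINT v|lborel. cmod (b (Complex v d))) * B)" for u
  proof -
    have "(LINT v|lborel. cmod (h u v)) \<le> (LINT v|lborel. cmod (a (Complex u c)) * (cmod (b (Complex v d)) * B))"
      by (intro integral_mono intb le) (use inth in auto)
    then show ?thesis by simp
  qed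
  note F = fubini_dominated[OF borel_measurable_pair_continuous[OF cont] inth _ this]
  have inta: "integrable lborel (\<lambda>u. cmod (a (Complex u c)) * ((LINT v|lborel. cmod (b (Complex v d))) * B))"
    using a(1) by (intro integrable_mult_left integrable_norm)
  have 1: "(LINT v|lborel. h u v) = a (Complex u c) * line_int d (\<lambda>z. b z * k (Complex u c) z)" for u
    unfolding h_def line_int_def by simp
  have 2: "(LINT u|lborel. h u v) = b (Complex v d) * line_int c (\<lambda>w. a w * k w (Complex v d))" for v
  proof -
    have "(LINT u|lborel. h u v) = (LINT u|lborel. b (Complex v d) * (a (Complex u c) * k (Complex u c) (Complex v d)))"
      unfolding h_def by (intro Bochner_Integration.integral_cong) auto
    then show ?thesis unfolding line_int_def by simp
  qed
  show "line_int c (\<lambda>w. a w * line_int d (\<lambda>z. b z * k w z)) = line_int d (\<lambda>z. b z * line_int c (\<lambda>w. a w * k w z))"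
    using F(2)[OF inta] unfolding 1 2 unfolding line_int_def .
  show "integrable lborel (\<lambda>u. a (Complex u c) * line_int d (\<lambda>z. b z * k (Complex u c) z))"
    using F(3)[OF inta] unfolding 1 .
  show "integrable lborel (\<lambda>v. b (Complex v d) * line_int c (\<lambda>w. a w * k w (Complex v d)))"
    using F(4)[OF inta] unfolding 2 .
qed

lemma line_int_cong: "(\<And>w. Im w = c \<Longrightarrow> f w = g w) \<Longrightarrow> line_int c f = line_int c g"
  unfolding line_int_def by (intro Bochner_Integration.integral_cong) auto

lemma line_int_add:
  "integrable lborel (\<lambda>u. f (Complex u c)) \<Longrightarrow> integrable lborel (\<lambda>u. g (Complex u c)) \<Longrightarrow>
    line_int c (\<lambda>w. f w + g w) = line_int c f + line_int c g"
  unfolding line_int_def by (rule Bochner_Integration.integral_add)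

lemma line_int_diff:
  "integrable lborel (\<lambda>u. f (Complex u c)) \<Longrightarrow> integrable lborel (\<lambda>u. g (Complex u c)) \<Longrightarrow>
    line_int c (\<lambda>w. f w - g w) = line_int c f - line_int c g"
  unfolding line_int_def by (rule Bochner_Integration.integral_diff)

lemma line_int_mult_left: "line_int c (\<lambda>w. k * f w) = k * line_int c f"
  unfolding line_int_def by simp

lemma two_lines_mult_left: "two_lines c (\<lambda>w. k * f w) = k * two_lines c f"
  unfolding two_lines_def line_int_mult_left by (simp add: algebra_simps)

lemma two_lines_cong: "(\<And>w. \<bar>Im w\<bar> = \<bar>c\<bar> \<Longrightarrow> f w = g w) \<Longrightarrow> two_lines c f = two_lines c g"
  unfolding two_lines_def by (intro arg_cong2[of _ _ _ _ minus] line_int_cong) auto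

lemma two_lines_add:
  assumes "\<And>e. \<bar>e\<bar> = \<bar>c\<bar> \<Longrightarrow> integrable lborel (\<lambda>u. f (Complex u e))"
    "\<And>e. \<bar>e\<bar> = \<bar>c\<bar> \<Longrightarrow> integrable lborel (\<lambda>u. g (Complex u e))"
  shows "two_lines c (\<lambda>w. f w + g w) = two_lines c f + two_lines c g"
  unfolding two_lines_def by (simp add: line_int_add assms)

lemma two_lines_swap:
  assumes a: "\<And>e. \<bar>e\<bar> = \<bar>c\<bar> \<Longrightarrow> integrable lborel (\<lambda>u. a (Complex u e))" "\<And>e. \<bar>e\<bar> = \<bar>c\<bar> \<Longrightarrow> continuous_on UNIV (\<lambda>u. a (Complex u e))"
    and b: "\<And>e. \<bar>e\<bar> = \<bar>d\<bar> \<Longrightarrow> integrable lborel (\<lambda>v. b (Complex v e))" "\<And>e. \<bar>e\<bar> = \<bar>d\<bar> \<Longrightarrow> continuous_on UNIV (\<lambda>v. b (Complex v e))"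
    and k: "\<And>e e'. \<bar>e\<bar> = \<bar>c\<bar> \<Longrightarrow> \<bar>e'\<bar> = \<bar>d\<bar> \<Longrightarrow> continuous_on UNIV (\<lambda>z. k (Complex (fst z) e) (Complex (snd z) e'))"
      "\<And>w z. \<bar>Im w\<bar> = \<bar>c\<bar> \<Longrightarrow> \<bar>Im z\<bar> = \<bar>d\<bar> \<Longrightarrow> cmod (k w z) \<le> B"
  shows "two_lines c (\<lambda>w. a w * two_lines d (\<lambda>z. b z * k w z)) = two_lines d (\<lambda>z. b z * two_lines c (\<lambda>w. a w * k w z))"
    and "\<bar>e\<bar> = \<bar>c\<bar> \<Longrightarrow> integrable lborel (\<lambda>u. a (Complex u e) * two_lines d (\<lambda>z. b z * k (Complex u e) z))"
proof -
  have k2: "cmod (k (Complex u e) (Complex v e')) \<le> B" if "\<bar>e\<bar> = \<bar>c\<bar>" "\<bar>e'\<bar> = \<bar>d\<bar>" for e e' u v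
    using k(2) that by simp
  note sw = line_int_swap[OF a(1) a(2) b(1) b(2) k(1) k2]
  show "two_lines c (\<lambda>w. a w * two_lines d (\<lambda>z. b z * k w z)) = two_lines d (\<lambda>z. b z * two_lines c (\<lambda>w. a w * k w z))"
    unfolding two_lines_def right_diff_distrib by (simp add: line_int_diff sw)
  show "integrable lborel (\<lambda>u. a (Complex u e) * two_lines d (\<lambda>z. b z * k (Complex u e) z))" if "\<bar>e\<bar> = \<bar>c\<bar>"
    unfolding two_lines_def right_diff_distrib using that
    by (intro Bochner_Integration.integrable_diff sw(2)) simp_all
qed

text \<open>
  On the strip \<open>\<bar>Im w\<bar> \<le> a\<close> and the two lines \<open>\<bar>Im z\<bar> = b\<close> outside it, the height difference stays away from the
  multiples of \<open>2 \<pi>\<close>, where the kernel of \<open>cauchy_strip\<close> has its poles.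
\<close>

lemma cmod_one_minus_exp_diff_ge:
  assumes w: "\<bar>Im w\<bar> \<le> a" and z: "\<bar>Im z\<bar> = b" and ab: "0 \<le> a" "a < b" "a + b < 2 * pi"
  shows "min (sin ((b - a) / 2)) (sin ((b + a) / 2)) \<le> cmod (1 - exp (z - w))"
proof -
  have *: "min (sin ((b - a) / 2)) (sin ((b + a) / 2)) \<le> sin (x / 2)" if "b - a \<le> x" "x \<le> b + a" for x
  proof (cases "x \<le> pi")
    case True
    then have "sin ((b - a) / 2) \<le> sin (x / 2)"
      using that ab by (intro sin_monotone_2pi_le) auto
    then show ?thesis by simp
  next
    case False
    have "(b + a) / 2 < pi" "x / 2 \<le> (b + a) / 2" "pi / 2 < x / 2"
      using that ab False by simp_all
    then have "- (pi / 2) \<le> pi - (b + a) / 2" "pi - (b + a) / 2 \<le> pi - x / 2" "pi - x / 2 \<le> pi / 2"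
      using pi_gt_zero by argo+
    then have "sin (pi - (b + a) / 2) \<le> sin (pi - x / 2)"
      by (rule sin_monotone_2pi_le)
    then show ?thesis by (simp del: sin_pi_minus add: sin_pi_minus[of "(b + a) / 2"] sin_pi_minus[of "x / 2"])
  qed
  have "\<bar>sin (Im (z - w) / 2)\<bar> \<le> cmod (1 - exp (z - w))" by (rule cmod_one_minus_exp_ge)
  moreover have "min (sin ((b - a) / 2)) (sin ((b + a) / 2)) \<le> \<bar>sin (Im (z - w) / 2)\<bar>"
  proof (cases "0 \<le> Im z")
    case True
    then have "min (sin ((b - a) / 2)) (sin ((b + a) / 2)) \<le> sin (Im (z - w) / 2)"
      using w z by (intro *) auto
    then show ?thesis by linarith
  next
    case False
    then have "min (sin ((b - a) / 2)) (sin ((b + a) / 2)) \<le> sin (- Im (z - w) / 2)"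
      using w z by (intro *) auto
    moreover have "sin (- Im (z - w) / 2) = - sin (Im (z - w) / 2)"
      unfolding minus_divide_left[symmetric] by (rule sin_minus)
    ultimately show ?thesis by linarith
  qed
  ultimately show ?thesis by linarith
qed

context sectorial_operator
begin

abbreviation res_form :: "'a \<Rightarrow> 'a \<Rightarrow> complex \<Rightarrow> complex"
  where "res_form x y w \<equiv> cinner (scaled_res w x) y"

lemma res_form_le: "norm (scaled_res w) \<le> K \<Longrightarrow> cmod (res_form x y w) \<le> K * (norm x * norm y)"
  using cmod_cinner_le[of "scaled_res w x" y] norm_blinfun[of "scaled_res w" x]
  by (metis (no_types, opaque_lifting) mult.assoc mult_right_mono norm_ge_zero order_trans)

lemma res_form_line_continuous:
  assumes "\<omega> < \<bar>c\<bar>" "\<bar>c\<bar> < pi"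
  shows "continuous_on UNIV (\<lambda>u. res_form x y (Complex u c))"
  using cinner_scaled_res_line_continuous[OF assms, of id_blinfun] by simp

lemma contour_calc_inner:
  assumes "strip_fun \<beta> (\<lambda>w. f (exp w))" "\<omega> < \<gamma>" "\<gamma> < \<beta>" "\<beta> \<le> pi"
  shows "cinner (contour_calc \<gamma> f x) y
    = 1 / (2 * complex_of_real pi * \<i>) * two_lines \<gamma> (\<lambda>w. f (exp w) * res_form x y w)"
  using contour_calc_weak[OF assms, of id_blinfun] by simp

text \<open>
  On the strips \<open>c < Im w < \<beta>\<close> and \<open>-\<beta> < Im w < -c\<close> with \<open>\<omega> < c\<close> the integrand is holomorphic and decays, so each
  of the two lines can be moved separately.
\<close>

lemma contour_independent:
  assumes p: "strip_fun \<beta> p" and \<beta>: "\<beta> \<le> pi" and \<gamma>: "\<omega> < \<gamma>" "\<gamma> < \<beta>" "\<omega> < \<gamma>'" "\<gamma>' < \<beta>"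
  shows "two_lines \<gamma> (\<lambda>w. p w * res_form x y w) = two_lines \<gamma>' (\<lambda>w. p w * res_form x y w)"
proof -
  define c where "c = (\<omega> + min \<gamma> \<gamma>') / 2"
  have c: "\<omega> < c" "c < \<gamma>" "c < \<gamma>'" using \<gamma> unfolding c_def by auto
  have c0: "0 < c" "c < pi" using c \<omega>_pos \<gamma> \<beta> by auto
  obtain K where K: "0 < K" "\<And>w. c \<le> \<bar>Im w\<bar> \<Longrightarrow> \<bar>Im w\<bar> < pi \<Longrightarrow> norm (scaled_res w) \<le> K"
    using scaled_res_bounded[OF c(1) c0(2)] by metis
  have shift: "line_int e (\<lambda>w. p w * res_form x y w) = line_int e' (\<lambda>w. p w * res_form x y w)"
    if ab: "- \<beta> \<le> a" "b \<le> \<beta>" "\<And>w. w \<in> hstrip a b \<Longrightarrow> c \<le> \<bar>Im w\<bar>" and e: "a < e" "e < b" "a < e'" "e' < b" for a b e e'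
  proof (rule line_shift[OF _ _ e])
    have sub: "hstrip a b \<subseteq> hstrip (- \<beta>) \<beta>" using ab by auto
    have off_sector: "w \<in> off_sector" if "w \<in> hstrip a b" for w
      using ab(1,2) ab(3)[OF that] that c \<beta> unfolding off_sector_def by auto
    show "(\<lambda>w. p w * res_form x y w) holomorphic_on hstrip a b"
      by (intro holomorphic_on_mult holomorphic_on_subset[OF strip_fun_holomorphic[OF p] sub]
        holomorphic_on_subset[OF scaled_res_cinner_holomorphic]) (use off_sector in blast)
    show "decaying a b (\<lambda>w. p w * res_form x y w)"
    proof (rule decaying_mult_bounded[OF decaying_mono[OF strip_fun_decaying[OF p] ab(1,2)]])
      show "cmod (res_form x y w) \<le> K * (norm x * norm y)" if "w \<in> hstrip a b" for w
        using off_sector[OF that] ab(3)[OF that] by (intro res_form_le K(2)) (auto simp: off_sector_def)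
    qed
  qed
  have "line_int \<gamma> (\<lambda>w. p w * res_form x y w) = line_int \<gamma>' (\<lambda>w. p w * res_form x y w)"
    by (rule shift[of c \<beta>]) (use c c0 \<gamma> in auto)
  moreover have "line_int (- \<gamma>) (\<lambda>w. p w * res_form x y w) = line_int (- \<gamma>') (\<lambda>w. p w * res_form x y w)"
    by (rule shift[of "- \<beta>" "- c"]) (use c c0 \<gamma> in auto)
  ultimately show ?thesis by (simp add: two_lines_def)
qed

text \<open>
  The resolvent identity splits the product into two terms, each with only one of the two operators and a
  scalar Cauchy kernel.
\<close>

lemma scaled_res_cinner_product:
  assumes "v \<in> off_sector" "w \<in> off_sector" "exp (v - w) \<noteq> 1"
  shows "cinner (scaled_res v (scaled_res w x)) y
    = res_form x y v / (1 - exp (v - w)) + res_form x y w / (1 - exp (w - v))"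
proof -
  define e where "e = exp (v - w)"
  have e: "e \<noteq> 0" "e \<noteq> 1" "exp (w - v) = 1 / e"
    using assms(3) unfolding e_def by (auto simp: exp_diff)
  have "res_form x y v - e * res_form x y w = (1 - e) * cinner (scaled_res v (scaled_res w x)) y"
    using arg_cong[OF scaled_res_identity[OF assms(1,2), of x], of "\<lambda>z. cinner z y"]
    by (simp add: cinner_diff_left cinner_scaleC_left e_def)
  then have "cinner (scaled_res v (scaled_res w x)) y = (res_form x y v - e * res_form x y w) / (1 - e)"
    using e(2) by (simp add: eq_divide_eq mult.commute)
  moreover have "res_form x y w / (1 - 1 / e) = - (e * res_form x y w) / (1 - e)"
  proof -
    have "1 - 1 / e = - ((1 - e) / e)" using e(1) by (simp add: field_simps)
    then have "res_form x y w / (1 - 1 / e) = res_form x y w / (- ((1 - e) / e))" by (simp only:)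
    also have "\<dots> = - (e * res_form x y w) / (1 - e)"
      unfolding divide_minus_right divide_divide_eq_right minus_divide_left by (simp only: mult.commute)
    finally show ?thesis .
  qed
  ultimately show ?thesis
    unfolding e_def[symmetric] e(3) by (simp add: diff_divide_distrib)
qed

text \<open>
  Multiplicativity of the calculus, tested against \<open>f\<close> on the inner one of two contours.  After
  \<open>scaled_res_cinner_product\<close> the term with \<open>S(w)\<close>, for \<open>w\<close> on the inner contour, is integrated over the
  outer one and yields \<open>g w\<close> by \<open>cauchy_strip\<close>.  In the term with \<open>S(z)\<close>, for \<open>z\<close> on the outer contour, the order of
  integration is exchanged; the integral over the inner contour then has no singularity between its
  two lines and vanishes.
\<close>

lemma product_formula:
  assumes f: "strip_fun \<beta>1 f" and g: "strip_fun \<beta>2 (\<lambda>w. G (exp w))" and \<beta>2: "\<beta>2 \<le> pi"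
    and \<gamma>: "\<omega> < \<gamma>1" "\<gamma>1 < \<gamma>2" "\<gamma>1 < \<beta>1" "\<gamma>2 < \<beta>2"
  shows "two_lines \<gamma>1 (\<lambda>w. f w * cinner (scaled_res w (contour_calc \<gamma>2 G x)) y)
    = two_lines \<gamma>1 (\<lambda>w. f w * G (exp w) * res_form x y w)"
proof -
  define g where "g w = G (exp w)" for w
  have g: "strip_fun \<beta>2 g" using g unfolding g_def .
  \<comment> \<open>The kernel is bounded on the strip of half-width \<open>\<gamma>0\<close>, which contains the inner contour in its interior.\<close>
  define \<gamma>0 where "\<gamma>0 = (\<gamma>1 + min \<gamma>2 \<beta>1) / 2"
  have "\<gamma>1 < \<gamma>0" "\<gamma>0 < \<gamma>2" "\<gamma>0 < \<beta>1"
    using \<gamma> unfolding \<gamma>0_def by auto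
  then have \<gamma>0: "\<gamma>1 < \<gamma>0" "\<gamma>0 < \<gamma>2" "\<gamma>0 < \<beta>1" "\<gamma>0 + \<gamma>2 < 2 * pi" "0 < \<gamma>0" "0 < \<gamma>1"
    using \<gamma> \<beta>2 \<omega>_pos by auto
  define \<delta> where "\<delta> = min (sin ((\<gamma>2 - \<gamma>0) / 2)) (sin ((\<gamma>2 + \<gamma>0) / 2))"
  have \<delta>: "0 < \<delta>" unfolding \<delta>_def using \<gamma>0 \<gamma> \<beta>2 by (auto intro!: sin_gt_zero)
  have ge: "\<delta> \<le> cmod (1 - exp (z - w))" if "\<bar>Im w\<bar> \<le> \<gamma>0" "\<bar>Im z\<bar> = \<gamma>2" for w z
    unfolding \<delta>_def by (rule cmod_one_minus_exp_diff_ge[OF that]) (use \<gamma>0 in auto)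
  have nz: "1 - exp (z - w) \<noteq> 0" if "\<bar>Im w\<bar> \<le> \<gamma>0" "\<bar>Im z\<bar> = \<gamma>2" for w z
    using ge[OF that] \<delta> by auto
  have inv_le: "cmod (1 / (1 - exp (z - w))) \<le> 1 / \<delta>" if "\<bar>Im w\<bar> \<le> \<gamma>0" "\<bar>Im z\<bar> = \<gamma>2" for w z
    using ge[OF that] \<delta> by (simp add: norm_divide frac_le)
  have ge': "\<delta> \<le> cmod (1 - exp (w - z))" if "\<bar>Im w\<bar> \<le> \<gamma>0" "\<bar>Im z\<bar> = \<gamma>2" for w z
    using ge[of "- w" "- z"] that by simp
  have inv_le': "cmod (1 / (1 - exp (w - z))) \<le> 1 / \<delta>" if "\<bar>Im w\<bar> \<le> \<gamma>0" "\<bar>Im z\<bar> = \<gamma>2" for w z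
    using ge'[OF that] \<delta> by (simp add: norm_divide frac_le)
  have nz': "1 - exp (w - z) \<noteq> 0" if "\<bar>Im w\<bar> \<le> \<gamma>0" "\<bar>Im z\<bar> = \<gamma>2" for w z
    using ge'[OF that] \<delta> by auto
  have off1: "w \<in> off_sector" if "\<bar>Im w\<bar> = \<gamma>1" for w using that \<gamma> \<beta>2 unfolding off_sector_def by auto
  have off2: "z \<in> off_sector" if "\<bar>Im z\<bar> = \<gamma>2" for z using that \<gamma> \<beta>2 unfolding off_sector_def by auto
  obtain K where K: "0 < K" "\<And>w. \<gamma>1 \<le> \<bar>Im w\<bar> \<Longrightarrow> \<bar>Im w\<bar> < pi \<Longrightarrow> norm (scaled_res w) \<le> K"
    using scaled_res_bounded[OF \<gamma>(1)] \<gamma> \<beta>2 by (metis order_less_le_trans order_less_trans)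
  have contC: "continuous_on UNIV (\<lambda>u. Complex u e)" for e
    unfolding Complex_eq by (intro continuous_intros)
  have contC2: "continuous_on UNIV (\<lambda>z. Complex (fst z) e)" "continuous_on UNIV (\<lambda>z. Complex (snd z) e)" for e
    unfolding Complex_eq by (intro continuous_intros)+
  have int_gZ: "integrable lborel (\<lambda>u. g (Complex u e) * res_form x y (Complex u e))"
    and cont_gZ: "continuous_on UNIV (\<lambda>u. g (Complex u e) * res_form x y (Complex u e))" if e: "\<bar>e\<bar> = \<bar>\<gamma>2\<bar>" for e
  proof -
    show "integrable lborel (\<lambda>u. g (Complex u e) * res_form x y (Complex u e))"
      by (rule strip_fun_mult_integrable[OF g _ res_form_line_continuous res_form_le[OF K(2)]]) (use e \<gamma> \<gamma>0 \<beta>2 in auto)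
    show "continuous_on UNIV (\<lambda>u. g (Complex u e) * res_form x y (Complex u e))"
      by (intro continuous_on_mult res_form_line_continuous continuous_on_line[OF strip_fun_continuous[OF g]])
         (use e \<gamma> \<gamma>0 \<beta>2 in auto)
  qed
  have inner: "cinner (scaled_res w (contour_calc \<gamma>2 G x)) y
      = g w * res_form x y w + 1 / (2 * complex_of_real pi * \<i>) * two_lines \<gamma>2 (\<lambda>z. (g z * res_form x y z) * (1 / (1 - exp (z - w))))"
    if w: "\<bar>Im w\<bar> = \<gamma>1" for w
  proof -
    have i1: "integrable lborel (\<lambda>u. res_form x y w * (g (Complex u e) / (1 - exp (w - Complex u e))))" if e: "\<bar>e\<bar> = \<bar>\<gamma>2\<bar>" for e
    proof -
      have "integrable lborel (\<lambda>u. g (Complex u e) * (1 / (1 - exp (w - Complex u e))))"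
      proof (rule strip_fun_mult_integrable[OF g])
        show "continuous_on UNIV (\<lambda>u. 1 / (1 - exp (w - Complex u e)))"
          by (intro continuous_intros contC) (use nz' w e \<gamma> \<gamma>0 in auto)
        show "cmod (1 / (1 - exp (w - Complex u e))) \<le> 1 / \<delta>" for u
          by (rule inv_le') (use w e \<gamma> \<gamma>0 in auto)
      qed (use e \<gamma> \<gamma>0 in auto)
      from integrable_mult_right[OF this, of "res_form x y w"] show ?thesis by simp
    qed
    have i2: "integrable lborel (\<lambda>u. (g (Complex u e) * res_form x y (Complex u e)) * (1 / (1 - exp (Complex u e - w))))" if e: "\<bar>e\<bar> = \<bar>\<gamma>2\<bar>" for e
    proof (rule Bochner_Integration.integrable_bound)
      show "integrable lborel (\<lambda>u. (g (Complex u e) * res_form x y (Complex u e)) * complex_of_real (1 / \<delta>))"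
        using int_gZ[OF e] by simp
      have "continuous_on UNIV (\<lambda>u. (g (Complex u e) * res_form x y (Complex u e)) * (1 / (1 - exp (Complex u e - w))))"
        by (intro continuous_on_mult[OF cont_gZ[OF e]] continuous_intros contC) (use nz w e \<gamma> \<gamma>0 in auto)
      then show "(\<lambda>u. (g (Complex u e) * res_form x y (Complex u e)) * (1 / (1 - exp (Complex u e - w)))) \<in> borel_measurable lborel"
        using borel_measurable_continuous_onI by simp
      have "cmod (1 / (1 - exp (Complex u e - w))) \<le> cmod (complex_of_real (1 / \<delta>))" for u
        using inv_le[of w "Complex u e"] w e \<gamma> \<gamma>0 \<delta> by (simp add: norm_divide)
      then show "AE u in lborel. norm ((g (Complex u e) * res_form x y (Complex u e)) * (1 / (1 - exp (Complex u e - w))))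
          \<le> norm ((g (Complex u e) * res_form x y (Complex u e)) * complex_of_real (1 / \<delta>))"
        unfolding norm_mult by (intro AE_I2 mult_left_mono) auto
    qed
    have "two_lines \<gamma>2 (\<lambda>z. g z * cinner (scaled_res w (scaled_res z x)) y)
        = two_lines \<gamma>2 (\<lambda>z. res_form x y w * (g z / (1 - exp (w - z))) + (g z * res_form x y z) * (1 / (1 - exp (z - w))))"
    proof (rule two_lines_cong)
      fix z assume "\<bar>Im z\<bar> = \<bar>\<gamma>2\<bar>"
      then have z: "\<bar>Im z\<bar> = \<gamma>2" using \<gamma>0 by simp
      have "exp (w - z) \<noteq> 1" using nz'[of w z] w z \<gamma>0 by auto
      then show "g z * cinner (scaled_res w (scaled_res z x)) y
          = res_form x y w * (g z / (1 - exp (w - z))) + (g z * res_form x y z) * (1 / (1 - exp (z - w)))"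
        by (simp add: scaled_res_cinner_product off1[OF w] off2[OF z] algebra_simps)
    qed
    also have "\<dots> = two_lines \<gamma>2 (\<lambda>z. res_form x y w * (g z / (1 - exp (w - z)))) + two_lines \<gamma>2 (\<lambda>z. (g z * res_form x y z) * (1 / (1 - exp (z - w))))"
      by (rule two_lines_add[OF i1 i2])
    also have "two_lines \<gamma>2 (\<lambda>z. res_form x y w * (g z / (1 - exp (w - z)))) = res_form x y w * (2 * complex_of_real pi * \<i> * g w)"
      unfolding two_lines_mult_left
      by (subst cauchy_strip[OF strip_fun_holomorphic[OF g] strip_fun_decaying[OF g] \<beta>2]) (use w \<gamma> in auto)
    finally show ?thesis
      using contour_calc_weak[of \<beta>2 G \<gamma>2 "scaled_res w" x y] g \<gamma> \<beta>2 scaled_res_scaleC[OF off1[OF w]]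
      by (simp add: g_def[symmetric] field_simps)
  qed
  have f_int: "integrable lborel (\<lambda>u. f (Complex u e))" "continuous_on UNIV (\<lambda>u. f (Complex u e))" if "\<bar>e\<bar> = \<bar>\<gamma>1\<bar>" for e
    by (rule strip_fun_line_integrable[OF f] continuous_on_line[OF strip_fun_continuous[OF f]]; use that \<gamma> \<gamma>0 in auto)+
  have k1: "continuous_on UNIV (\<lambda>z. 1 / (1 - exp (Complex (snd z) e' - Complex (fst z) e)))"
    if "\<bar>e\<bar> = \<bar>\<gamma>1\<bar>" "\<bar>e'\<bar> = \<bar>\<gamma>2\<bar>" for e e'
    by (intro continuous_intros contC2) (use nz that \<gamma>0 in auto)
  have k2: "cmod (1 / (1 - exp (z - w))) \<le> 1 / \<delta>" if "\<bar>Im w\<bar> = \<bar>\<gamma>1\<bar>" "\<bar>Im z\<bar> = \<bar>\<gamma>2\<bar>" for w z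
    by (rule inv_le) (use that \<gamma>0 in auto)
  note swap = two_lines_swap[where k = "\<lambda>w z. 1 / (1 - exp (z - w))" and B = "1 / \<delta>", OF f_int int_gZ cont_gZ k1 k2]
  have zero: "two_lines \<gamma>1 (\<lambda>w. f w * (1 / (1 - exp (z - w)))) = 0" if z: "\<bar>Im z\<bar> = \<gamma>2" for z
  proof -
    have sub: "hstrip (- \<gamma>0) \<gamma>0 \<subseteq> hstrip (- \<beta>1) \<beta>1" using \<gamma>0 by auto
    have "line_int (- \<gamma>1) (\<lambda>w. f w * (1 / (1 - exp (z - w)))) = line_int \<gamma>1 (\<lambda>w. f w * (1 / (1 - exp (z - w))))"
    proof (rule line_shift[of _ "- \<gamma>0" \<gamma>0])
      show "(\<lambda>w. f w * (1 / (1 - exp (z - w)))) holomorphic_on hstrip (- \<gamma>0) \<gamma>0"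
        by (intro holomorphic_intros holomorphic_on_subset[OF strip_fun_holomorphic[OF f] sub]) (use nz z in auto)
      show "decaying (- \<gamma>0) \<gamma>0 (\<lambda>w. f w * (1 / (1 - exp (z - w))))"
        by (rule decaying_mult_bounded[OF decaying_mono[OF strip_fun_decaying[OF f]] inv_le]) (use z \<gamma>0 in auto)
    qed (use \<gamma>0 in auto)
    then show ?thesis by (simp add: two_lines_def)
  qed
  have fgZ_int: "integrable lborel (\<lambda>u. f (Complex u e) * (g (Complex u e) * res_form x y (Complex u e)))" if e: "\<bar>e\<bar> = \<bar>\<gamma>1\<bar>" for e
  proof -
    obtain B where B: "0 \<le> B" "\<And>w. w \<in> hstrip (- \<beta>2) \<beta>2 \<Longrightarrow> cmod (g w) \<le> B"
      using strip_fun_bounded[OF g] by metis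
    show ?thesis
    proof (rule strip_fun_mult_integrable[OF f])
      show "continuous_on UNIV (\<lambda>u. g (Complex u e) * res_form x y (Complex u e))"
        by (intro continuous_on_mult res_form_line_continuous continuous_on_line[OF strip_fun_continuous[OF g]])
         (use e \<gamma> \<gamma>0 \<beta>2 in auto)
      show "cmod (g (Complex u e) * res_form x y (Complex u e)) \<le> B * (K * (norm x * norm y))" for u
        unfolding norm_mult using e \<gamma> \<gamma>0 \<beta>2 B by (intro mult_mono B(2) res_form_le[OF K(2)]) auto
    qed (use e \<gamma> \<gamma>0 in auto)
  qed
  have "two_lines \<gamma>1 (\<lambda>w. f w * cinner (scaled_res w (contour_calc \<gamma>2 G x)) y)
      = two_lines \<gamma>1 (\<lambda>w. f w * (g w * res_form x y w) + 1 / (2 * complex_of_real pi * \<i>) * (f w * two_lines \<gamma>2 (\<lambda>z. (g z * res_form x y z) * (1 / (1 - exp (z - w))))))"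
    by (rule two_lines_cong) (use \<gamma>0 in \<open>simp add: inner algebra_simps\<close>)
  also have "\<dots> = two_lines \<gamma>1 (\<lambda>w. f w * (g w * res_form x y w)) +
      1 / (2 * complex_of_real pi * \<i>) * two_lines \<gamma>1 (\<lambda>w. f w * two_lines \<gamma>2 (\<lambda>z. (g z * res_form x y z) * (1 / (1 - exp (z - w)))))"
    unfolding two_lines_mult_left[of \<gamma>1 "1 / (2 * complex_of_real pi * \<i>)", symmetric] by (intro two_lines_add fgZ_int integrable_mult_right swap(2))
  also have "two_lines \<gamma>1 (\<lambda>w. f w * two_lines \<gamma>2 (\<lambda>z. (g z * res_form x y z) * (1 / (1 - exp (z - w)))))
      = two_lines \<gamma>2 (\<lambda>z. (g z * res_form x y z) * two_lines \<gamma>1 (\<lambda>w. f w * (1 / (1 - exp (z - w)))))"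
    by (rule swap(1))
  also have "\<dots> = two_lines \<gamma>2 (\<lambda>z. 0)"
    by (rule two_lines_cong) (use \<gamma> \<gamma>0 in \<open>simp add: zero del: times_divide_eq_right\<close>)
  also have "\<dots> = 0" by (simp add: two_lines_def line_int_def)
  finally show ?thesis by (simp add: g_def mult.assoc)
qed

end

section \<open>Schur's test and the reproducing constant\<close>

lemma line_int_le_nn: "ennreal (cmod (line_int c f)) \<le> (\<integral>\<^sup>+u. ennreal (cmod (f (Complex u c))) \<partial>lborel)"
proof (cases "integrable lborel (\<lambda>u. f (Complex u c))")
  case True
  then show ?thesis unfolding line_int_def by (rule integral_norm_bound_ennreal)
next
  case False
  then show ?thesis unfolding line_int_def by (simp add: not_integrable_integral_eq)
qed

lemma nn_integral_translate:
  assumes "f \<in> borel_measurable borel"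
  shows "(\<integral>\<^sup>+x. f (t + x) \<partial>lborel) = (\<integral>\<^sup>+x. f (x::real) \<partial>lborel)"
  using nn_integral_real_affine[OF assms, of 1 t] by simp

text \<open>
  The Cauchy--Schwarz inequality with respect to the measure of density \<open>k t\<close>, whose total mass is \<open>H\<close>,
  and then Fubini's theorem, as the column integrals of the kernel are \<open>H\<close> as well.
\<close>

lemma schur_test:
  fixes h1 h2 \<phi> :: "real \<Rightarrow> ennreal"
  assumes [measurable]: "h1 \<in> borel_measurable borel" "h2 \<in> borel_measurable borel" "\<phi> \<in> borel_measurable borel"
  defines "k \<equiv> \<lambda>t s. \<integral>\<^sup>+u. h1 (t + u) * h2 (s + u) \<partial>lborel"
  defines "H \<equiv> (\<integral>\<^sup>+u. h1 u \<partial>lborel) * (\<integral>\<^sup>+u. h2 u \<partial>lborel)"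
  shows "(\<integral>\<^sup>+t. (\<integral>\<^sup>+s. k t s * \<phi> s \<partial>lborel)\<^sup>2 \<partial>lborel) \<le> H\<^sup>2 * (\<integral>\<^sup>+s. (\<phi> s)\<^sup>2 \<partial>lborel)"
proof -
  have k_meas[measurable]: "(\<lambda>(t, s). k t s) \<in> borel_measurable (lborel \<Otimes>\<^sub>M lborel)"
    unfolding k_def by measurable
  have tr: "(\<integral>\<^sup>+t. h1 (t + u) \<partial>lborel) = (\<integral>\<^sup>+t. h1 t \<partial>lborel)"
    "(\<integral>\<^sup>+t. h2 (t + u) \<partial>lborel) = (\<integral>\<^sup>+t. h2 t \<partial>lborel)" for u
    using nn_integral_translate[of h1 u] nn_integral_translate[of h2 u] by (simp_all add: add.commute)
  have k_s: "(\<integral>\<^sup>+s. k t s \<partial>lborel) = H" for t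
  proof -
    have "(\<integral>\<^sup>+s. k t s \<partial>lborel) = (\<integral>\<^sup>+u. \<integral>\<^sup>+s. h1 (t + u) * h2 (s + u) \<partial>lborel \<partial>lborel)"
      unfolding k_def by (subst lborel_pair.Fubini') measurable
    also have "\<dots> = (\<integral>\<^sup>+u. h1 (t + u) * (\<integral>\<^sup>+s. h2 s \<partial>lborel) \<partial>lborel)"
      by (simp add: nn_integral_cmult tr)
    also have "\<dots> = H"
      by (simp add: nn_integral_multc nn_integral_translate[of h1] H_def)
    finally show ?thesis .
  qed
  have k_t: "(\<integral>\<^sup>+t. k t s \<partial>lborel) = H" for s
  proof -
    have "(\<integral>\<^sup>+t. k t s \<partial>lborel) = (\<integral>\<^sup>+u. \<integral>\<^sup>+t. h1 (t + u) * h2 (s + u) \<partial>lborel \<partial>lborel)"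
      unfolding k_def by (subst lborel_pair.Fubini') measurable
    also have "\<dots> = (\<integral>\<^sup>+u. (\<integral>\<^sup>+t. h1 t \<partial>lborel) * h2 (s + u) \<partial>lborel)"
      by (simp add: nn_integral_multc tr)
    also have "\<dots> = H"
      by (simp add: nn_integral_cmult nn_integral_translate[of h2] H_def)
    finally show ?thesis .
  qed
  have cs: "(\<integral>\<^sup>+s. k t s * \<phi> s \<partial>lborel)\<^sup>2 \<le> H * (\<integral>\<^sup>+s. k t s * (\<phi> s)\<^sup>2 \<partial>lborel)" for t
  proof -
    have kt[measurable]: "k t \<in> borel_measurable borel"
      using measurable_compose[OF measurable_Pair1' k_meas, of t] by simp
    have "(\<integral>\<^sup>+s. \<phi> s * 1 \<partial>density lborel (k t))\<^sup>2 \<le> (\<integral>\<^sup>+s. \<phi> s ^ 2 \<partial>density lborel (k t)) * (\<integral>\<^sup>+s. 1 ^ 2 \<partial>density lborel (k t))"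
      by (rule Cauchy_Schwarz_nn_integral) measurable
    then show ?thesis
      by (simp add: nn_integral_density emeasure_density k_s mult.commute)
  qed
  have "(\<integral>\<^sup>+t. (\<integral>\<^sup>+s. k t s * \<phi> s \<partial>lborel)\<^sup>2 \<partial>lborel) \<le> (\<integral>\<^sup>+t. H * (\<integral>\<^sup>+s. k t s * (\<phi> s)\<^sup>2 \<partial>lborel) \<partial>lborel)"
    by (intro nn_integral_mono cs)
  also have "\<dots> = H * (\<integral>\<^sup>+t. \<integral>\<^sup>+s. k t s * (\<phi> s)\<^sup>2 \<partial>lborel \<partial>lborel)"
    by (rule nn_integral_cmult) measurable
  also have "(\<integral>\<^sup>+t. \<integral>\<^sup>+s. k t s * (\<phi> s)\<^sup>2 \<partial>lborel \<partial>lborel) = (\<integral>\<^sup>+s. \<integral>\<^sup>+t. k t s * (\<phi> s)\<^sup>2 \<partial>lborel \<partial>lborel)"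
    by (subst lborel_pair.Fubini') measurable
  also have "\<dots> = (\<integral>\<^sup>+s. H * (\<phi> s)\<^sup>2 \<partial>lborel)"
    by (subst nn_integral_multc) (auto simp: k_t)
  also have "\<dots> = H * (\<integral>\<^sup>+s. (\<phi> s)\<^sup>2 \<partial>lborel)"
    by (rule nn_integral_cmult) measurable
  finally show ?thesis by (simp add: power2_eq_square mult.assoc)
qed

lemma strip_fun_conj:
  assumes "strip_fun \<beta> q"
  shows "strip_fun \<beta> (\<lambda>w. cnj (q (cnj w)))"
proof -
  have "cnj ` hstrip (- \<beta>) \<beta> \<subseteq> hstrip (- \<beta>) \<beta>" by auto
  then have "(cnj \<circ> q \<circ> cnj) holomorphic_on hstrip (- \<beta>) \<beta>"
    by (intro holomorphic_on_compose_cnj_cnj open_hstrip holomorphic_on_subset[OF strip_fun_holomorphic[OF assms]])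
  moreover obtain C \<sigma> where C: "0 \<le> C" "0 < \<sigma>" "\<And>w. w \<in> hstrip (- \<beta>) \<beta> \<Longrightarrow> cmod (q w) \<le> C * exp (- \<sigma> * \<bar>Re w\<bar>)"
    using strip_funE[OF assms] by metis
  have "cmod (cnj (q (cnj w))) \<le> C * exp (- \<sigma> * \<bar>Re w\<bar>)" if "w \<in> hstrip (- \<beta>) \<beta>" for w
    using C(3)[of "cnj w"] that by simp
  ultimately show ?thesis
    using C unfolding strip_fun_def o_def by blast
qed

text \<open>
  The identity theorem; it provides \<open>c > 0\<close> in \<open>integral_norm_square_pos\<close>.
\<close>

lemma strip_fun_zero_if_zero_on_real:
  assumes q: "strip_fun \<beta> q" and \<beta>: "0 < \<beta>" and zero: "\<And>u. q (Complex u 0) = 0" and w: "w \<in> hstrip (- \<beta>) \<beta>"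
  shows "q w = 0"
proof (rule analytic_continuation[OF strip_fun_holomorphic[OF q] open_hstrip convex_connected[OF convex_hstrip], of "range (\<lambda>u. Complex u 0)" 0])
  show "0 islimpt range (\<lambda>u. Complex u 0)"
    unfolding islimpt_approachable
  proof (intro allI impI)
    fix e :: real assume "0 < e"
    then show "\<exists>x'\<in>range (\<lambda>u. Complex u 0). x' \<noteq> 0 \<and> dist x' 0 < e"
      by (intro bexI[of _ "Complex (e / 2) 0"]) (auto simp: complex_eq_iff cmod_def)
  qed
qed (use \<beta> zero w in auto)

lemma integral_norm_square_pos:
  assumes q: "strip_fun \<beta> q" and \<beta>: "0 < \<beta>" and w: "w \<in> hstrip (- \<beta>) \<beta>" "q w \<noteq> 0"
  shows "0 < (LINT u|lborel. (cmod (q (Complex u 0)))\<^sup>2)"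
proof -
  have int: "integrable lborel (\<lambda>u. (cmod (q (Complex u 0)))\<^sup>2)"
    using integrable_norm[OF strip_fun_line_integrable[OF strip_fun_mult[OF q q], of 0]] \<beta>
    by (simp add: norm_mult power2_eq_square)
  have cont: "continuous_on UNIV (\<lambda>u. q (Complex u 0))"
    by (rule continuous_on_line[OF strip_fun_continuous[OF q]]) (use \<beta> in auto)
  obtain u0 where u0: "q (Complex u0 0) \<noteq> 0"
    using strip_fun_zero_if_zero_on_real[OF q \<beta> _ w(1)] w(2) by blast
  have "open {u. q (Complex u 0) \<noteq> 0}"
    using open_Collect_neq[OF cont continuous_on_const] by simp
  then obtain d where d: "0 < d" "ball u0 d \<subseteq> {u. q (Complex u 0) \<noteq> 0}"
    using u0 unfolding open_contains_ball by blast
  have "(LINT u|lborel. (cmod (q (Complex u 0)))\<^sup>2) \<noteq> 0"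
  proof
    assume "(LINT u|lborel. (cmod (q (Complex u 0)))\<^sup>2) = 0"
    then have "AE u in lborel. q (Complex u 0) = 0"
      using integral_nonneg_eq_0_iff_AE[OF int] by simp
    then have "AE u in lborel. u \<notin> ball u0 d"
      by eventually_elim (use d in auto)
    then have "emeasure lborel (ball u0 d) = 0"
      by (subst (asm) AE_iff_measurable[where N = "ball u0 d"]) auto
    then show False using d(1) by (simp add: ball_eq_greaterThanLessThan)
  qed
  moreover have "0 \<le> (LINT u|lborel. (cmod (q (Complex u 0)))\<^sup>2)" by simp
  ultimately show ?thesis by linarith
qed

text \<open>
  The integrand is holomorphic in \<open>w\<close>, so the line of integration can be moved to the real axis, where the two
  factors are conjugate to each other.  That the value is the same for all \<open>w\<close> makes the
  comparison of square functions uniform in the ray.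
\<close>

lemma reproducing_constant:
  assumes q: "strip_fun \<beta> q" and w: "\<bar>Im w\<bar> < \<beta>"
  shows "(LINT s|lborel. cnj (q (cnj (complex_of_real s + w))) * q (complex_of_real s + w))
    = complex_of_real (LINT u|lborel. (cmod (q (Complex u 0)))\<^sup>2)"
proof -
  define h where "h w = cnj (q (cnj w)) * q w" for w
  have h: "strip_fun \<beta> h" unfolding h_def by (rule strip_fun_mult[OF strip_fun_conj[OF q] q])
  have "(LINT s|lborel. h (complex_of_real s + w)) = (LINT s|lborel. h (Complex (Re w + 1 * s) (Im w)))"
    by (intro Bochner_Integration.integral_cong refl arg_cong[of _ _ h]) (auto simp: complex_eq_iff)
  also have "\<dots> = line_int (Im w) h"
    unfolding line_int_def by (subst lborel_integral_real_affine[of 1 _ "Re w"]) simp_all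
  also have "\<dots> = line_int 0 h"
    by (rule line_shift[OF strip_fun_holomorphic[OF h] strip_fun_decaying[OF h]]) (use w in auto)
  also have "\<dots> = (LINT u|lborel. complex_of_real ((cmod (q (Complex u 0)))\<^sup>2))"
  proof -
    have "h (Complex u 0) = complex_of_real ((cmod (q (Complex u 0)))\<^sup>2)" for u
    proof -
      have "cnj (Complex u 0) = Complex u 0" by (simp add: complex_eq_iff)
      then show ?thesis unfolding h_def complex_norm_square by (simp add: mult.commute)
    qed
    then show ?thesis unfolding line_int_def by simp
  qed
  also have "\<dots> = complex_of_real (LINT u|lborel. (cmod (q (Complex u 0)))\<^sup>2)"
    by (rule integral_complex_of_real)
  finally show ?thesis unfolding h_def .
qed

context sectorial_operator
begin

section \<open>Comparison of square functions\<close>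

abbreviation dilate :: "(complex \<Rightarrow> complex) \<Rightarrow> complex \<Rightarrow> complex \<Rightarrow> complex"
  where "dilate F l \<equiv> \<lambda>z. F (exp l * z)"

text \<open>
  The squared square function of \<open>F(\<zeta> \<sqdot>)\<close> with \<open>\<zeta> = exp l\<close>; the variable is the logarithm of the dilation parameter.
\<close>

abbreviation sq_int :: "real \<Rightarrow> (complex \<Rightarrow> complex) \<Rightarrow> complex \<Rightarrow> 'a \<Rightarrow> ennreal"
  where "sq_int \<gamma> F l x \<equiv> \<integral>\<^sup>+u. ennreal ((norm (contour_calc \<gamma> (dilate F (complex_of_real u + l)) x))\<^sup>2) \<partial>lborel"

text \<open>
  Dominated convergence on the two lines, uniformly in the vector against which the operators are tested.  It is the
  source of all measurability statements below.
\<close>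

lemma contour_calc_shift_continuous:
  assumes Q: "strip_fun \<beta> (\<lambda>w. Q (exp w))" and \<beta>: "\<beta> \<le> pi" and \<gamma>: "\<omega> < \<gamma>"
  shows "continuous_on {l. \<bar>Im l\<bar> < \<beta> - \<gamma>} (\<lambda>l. contour_calc \<gamma> (dilate Q l) x)"
proof (rule continuous_on_sequentiallyI)
  define q where "q w = Q (exp w)" for w
  have q: "strip_fun \<beta> q" using Q unfolding q_def .
  fix l :: "nat \<Rightarrow> complex" and a
  assume l: "\<forall>n. l n \<in> {l. \<bar>Im l\<bar> < \<beta> - \<gamma>}" and a: "a \<in> {l. \<bar>Im l\<bar> < \<beta> - \<gamma>}" and lim: "l \<longlonglongrightarrow> a"
  have \<gamma>': "0 < \<gamma>" "\<gamma> < \<beta>" "\<gamma> < pi" using \<gamma> \<omega>_pos a \<beta> by auto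
  obtain K where K: "0 < K" "\<And>w. \<gamma> \<le> \<bar>Im w\<bar> \<Longrightarrow> \<bar>Im w\<bar> < pi \<Longrightarrow> norm (scaled_res w) \<le> K"
    using scaled_res_bounded[OF \<gamma> \<gamma>'(3)] by metis
  obtain C \<sigma> where C: "0 \<le> C" "0 < \<sigma>" "\<And>w. w \<in> hstrip (- \<beta>) \<beta> \<Longrightarrow> cmod (q w) \<le> C * exp (- \<sigma> * \<bar>Re w\<bar>)"
    using strip_funE[OF q] by metis
  define I where "I n e = (LINT u|lborel. cmod (q (l n + Complex u e) - q (a + Complex u e)))" for n e
  have int: "integrable lborel (\<lambda>u. q (b + Complex u e))" and contb: "continuous_on UNIV (\<lambda>u. q (b + Complex u e))"
    if "\<bar>Im b\<bar> < \<beta> - \<gamma>" "\<bar>e\<bar> = \<gamma>" for b e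
  proof -
    have "strip_fun (\<beta> - \<bar>Im b\<bar>) (\<lambda>w. q (b + w))" by (rule strip_fun_shift[OF q]) simp
    from strip_fun_line_integrable[OF this, of e] continuous_on_line[OF strip_fun_continuous[OF this], of e]
    show "integrable lborel (\<lambda>u. q (b + Complex u e))" "continuous_on UNIV (\<lambda>u. q (b + Complex u e))"
      using that by auto
  qed
  have diff_le: "norm (contour_calc \<gamma> (dilate Q (l n)) x - contour_calc \<gamma> (dilate Q a) x)
      \<le> (I n \<gamma> + I n (- \<gamma>)) * (K * norm x)" for n
  proof (rule norm_le_if_cinner_le)
    fix y
    define d where "d w = q (l n + w) - q (a + w)" for w
    have ci: "cinner (contour_calc \<gamma> (dilate Q b) x) y = 1 / (2 * complex_of_real pi * \<i>) * two_lines \<gamma> (\<lambda>w. q (b + w) * res_form x y w)"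
      and intZ: "\<bar>e\<bar> = \<gamma> \<Longrightarrow> integrable lborel (\<lambda>u. q (b + Complex u e) * res_form x y (Complex u e))"
      if b: "\<bar>Im b\<bar> < \<beta> - \<gamma>" for b e
    proof -
      have s: "strip_fun (\<beta> - \<bar>Im b\<bar>) (\<lambda>w. q (b + w))" by (rule strip_fun_shift[OF q]) simp
      then have "strip_fun (\<beta> - \<bar>Im b\<bar>) (\<lambda>w. (\<lambda>z. Q (exp b * z)) (exp w))"
        by (simp add: q_def exp_add)
      from contour_calc_inner[OF this \<gamma>, of x y] b \<beta>
      show "cinner (contour_calc \<gamma> (dilate Q b) x) y = 1 / (2 * complex_of_real pi * \<i>) * two_lines \<gamma> (\<lambda>w. q (b + w) * res_form x y w)"
        by (simp add: q_def exp_add)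
      show "\<bar>e\<bar> = \<gamma> \<Longrightarrow> integrable lborel (\<lambda>u. q (b + Complex u e) * res_form x y (Complex u e))"
        by (rule strip_fun_mult_integrable[OF s _ res_form_line_continuous res_form_le[OF K(2)]]) (use b \<gamma> \<gamma>' in auto)
    qed
    have line_le: "cmod (line_int e (\<lambda>w. d w * res_form x y w)) \<le> I n e * (K * norm x) * norm y" if e: "\<bar>e\<bar> = \<gamma>" for e
    proof -
      have "cmod (line_int e (\<lambda>w. d w * res_form x y w)) \<le> (LINT u|lborel. cmod (d (Complex u e)) * (K * (norm x * norm y)))"
        unfolding line_int_def
      proof (rule order_trans[OF integral_norm_bound], rule integral_mono)
        show "integrable lborel (\<lambda>u. norm (d (Complex u e) * res_form x y (Complex u e)))"
          unfolding d_def left_diff_distrib using l a e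
          by (intro integrable_norm Bochner_Integration.integrable_diff intZ) auto
        show "integrable lborel (\<lambda>u. cmod (d (Complex u e)) * (K * (norm x * norm y)))"
          unfolding d_def using l a e
          by (intro integrable_mult_left integrable_norm Bochner_Integration.integrable_diff int) auto
        show "norm (d (Complex u e) * res_form x y (Complex u e)) \<le> cmod (d (Complex u e)) * (K * (norm x * norm y))" for u
          unfolding norm_mult using e \<gamma>' by (intro mult_left_mono res_form_le K(2)) auto
      qed
      then show ?thesis by (simp add: d_def I_def mult_ac)
    qed
    have "cinner (contour_calc \<gamma> (dilate Q (l n)) x - contour_calc \<gamma> (dilate Q a) x) y
        = 1 / (2 * complex_of_real pi * \<i>) * (two_lines \<gamma> (\<lambda>w. q (l n + w) * res_form x y w) - two_lines \<gamma> (\<lambda>w. q (a + w) * res_form x y w))"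
      using l a ci by (simp add: cinner_diff_left right_diff_distrib)
    also have "two_lines \<gamma> (\<lambda>w. q (l n + w) * res_form x y w) - two_lines \<gamma> (\<lambda>w. q (a + w) * res_form x y w) = two_lines \<gamma> (\<lambda>w. d w * res_form x y w)"
      unfolding two_lines_def d_def left_diff_distrib using l a \<gamma>'
      by (subst (1 2) line_int_diff) (auto intro!: intZ)
    finally have "cmod (cinner (contour_calc \<gamma> (dilate Q (l n)) x - contour_calc \<gamma> (dilate Q a) x) y)
        = cmod (two_lines \<gamma> (\<lambda>w. d w * res_form x y w)) / (2 * pi)"
      by (simp add: norm_divide norm_mult)
    also have "\<dots> \<le> cmod (two_lines \<gamma> (\<lambda>w. d w * res_form x y w)) / 1"
      using pi_gt3 by (intro divide_left_mono) auto
    also have "\<dots> \<le> cmod (line_int (- \<gamma>) (\<lambda>w. d w * res_form x y w)) + cmod (line_int \<gamma> (\<lambda>w. d w * res_form x y w))"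
      unfolding two_lines_def using norm_triangle_ineq4 by simp
    also have "\<dots> \<le> (I n \<gamma> + I n (- \<gamma>)) * (K * norm x) * norm y"
      using line_le[of \<gamma>] line_le[of "- \<gamma>"] \<gamma>' by (simp add: algebra_simps)
    finally show "cmod (cinner (contour_calc \<gamma> (dilate Q (l n)) x - contour_calc \<gamma> (dilate Q a) x) y)
        \<le> (I n \<gamma> + I n (- \<gamma>)) * (K * norm x) * norm y" .
  qed (use K in \<open>auto simp: I_def intro!: mult_nonneg_nonneg add_nonneg_nonneg\<close>)
  have I_lim: "(\<lambda>n. I n e) \<longlonglongrightarrow> 0" if e: "\<bar>e\<bar> = \<gamma>" for e
  proof -
    obtain N where N: "\<And>n. N \<le> n \<Longrightarrow> cmod (l n - a) < 1"
      using LIMSEQ_D[OF lim, of 1] by auto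
    have bd: "cmod (q (b + Complex u e)) \<le> C * exp (\<sigma> * (\<bar>Re a\<bar> + 1)) * exp (- \<sigma> * \<bar>u\<bar>)"
      if "cmod (b - a) < 1" "\<bar>Im b\<bar> < \<beta> - \<gamma>" for b u
    proof -
      have "\<bar>Re b\<bar> \<le> \<bar>Re a\<bar> + 1"
        using abs_Re_le_cmod[of "b - a"] that by simp
      then have "\<bar>u\<bar> \<le> \<bar>Re b + u\<bar> + (\<bar>Re a\<bar> + 1)" by linarith
      then have "\<sigma> * \<bar>u\<bar> \<le> \<sigma> * (\<bar>Re b + u\<bar> + (\<bar>Re a\<bar> + 1))" using C by (intro mult_left_mono) auto
      then have "exp (- \<sigma> * \<bar>Re b + u\<bar>) \<le> exp (\<sigma> * (\<bar>Re a\<bar> + 1)) * exp (- \<sigma> * \<bar>u\<bar>)"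
        by (simp add: exp_add[symmetric] algebra_simps)
      from mult_left_mono[OF this C(1)] have "C * exp (- \<sigma> * \<bar>Re (b + Complex u e)\<bar>) \<le> C * exp (\<sigma> * (\<bar>Re a\<bar> + 1)) * exp (- \<sigma> * \<bar>u\<bar>)"
        by (simp add: mult.assoc)
      moreover have "b + Complex u e \<in> hstrip (- \<beta>) \<beta>"
        using that(2) e by auto
      ultimately show ?thesis using C(3) order_trans by blast
    qed
    have "(\<lambda>n. I (n + N) e) \<longlonglongrightarrow> (LINT u|(lborel::real measure). (0::real))"
      unfolding I_def
    proof (rule integral_dominated_convergence[where w = "\<lambda>u. 2 * (C * exp (\<sigma> * (\<bar>Re a\<bar> + 1))) * exp (- \<sigma> * \<bar>u\<bar>)"])
      show "(\<lambda>u. cmod (q (l (n + N) + Complex u e) - q (a + Complex u e))) \<in> borel_measurable lborel" for n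
        using int l a e by (intro borel_measurable_norm borel_measurable_diff borel_measurable_integrable) auto
      show "integrable lborel (\<lambda>u. 2 * (C * exp (\<sigma> * (\<bar>Re a\<bar> + 1))) * exp (- \<sigma> * \<bar>u\<bar>))"
        by (intro integrable_mult_right integrable_exp_abs C)
      show "AE u in lborel. norm (cmod (q (l (n + N) + Complex u e) - q (a + Complex u e))) \<le> 2 * (C * exp (\<sigma> * (\<bar>Re a\<bar> + 1))) * exp (- \<sigma> * \<bar>u\<bar>)" for n
      proof (rule AE_I2)
        fix u
        show "norm (cmod (q (l (n + N) + Complex u e) - q (a + Complex u e))) \<le> 2 * (C * exp (\<sigma> * (\<bar>Re a\<bar> + 1))) * exp (- \<sigma> * \<bar>u\<bar>)"
          using norm_triangle_ineq4[of "q (l (n + N) + Complex u e)" "q (a + Complex u e)"]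
            bd[of "l (n + N)" u] bd[of a u] N[of "n + N"] l a by simp
      qed
      show "AE u in lborel. (\<lambda>n. cmod (q (l (n + N) + Complex u e) - q (a + Complex u e))) \<longlonglongrightarrow> 0"
      proof (rule AE_I2)
        fix u
        have "a + Complex u e \<in> hstrip (- \<beta>) \<beta>" using a e by auto
        then have "isCont q (a + Complex u e)"
          using strip_fun_continuous[OF q] by (simp only: continuous_on_eq_continuous_at[OF open_hstrip])
        moreover have "(\<lambda>n. l (n + N) + Complex u e) \<longlonglongrightarrow> a + Complex u e"
          by (rule tendsto_add[OF LIMSEQ_ignore_initial_segment[OF lim, of N] tendsto_const])
        ultimately have "(\<lambda>n. q (l (n + N) + Complex u e)) \<longlonglongrightarrow> q (a + Complex u e)"
          by (rule isCont_tendsto_compose)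
        then show "(\<lambda>n. cmod (q (l (n + N) + Complex u e) - q (a + Complex u e))) \<longlonglongrightarrow> 0"
          using tendsto_norm_zero LIM_zero by blast
      qed
    qed simp_all
    then have "(\<lambda>n. I (n + N) e) \<longlonglongrightarrow> 0" by simp
    then show ?thesis by (rule LIMSEQ_offset)
  qed
  have "(\<lambda>n. contour_calc \<gamma> (dilate Q (l n)) x - contour_calc \<gamma> (dilate Q a) x) \<longlonglongrightarrow> 0"
  proof (rule Lim_null_comparison[OF always_eventually[OF allI[OF diff_le]]])
    have "(\<lambda>n. (I n \<gamma> + I n (- \<gamma>)) * (K * norm x)) \<longlonglongrightarrow> (0 + 0) * (K * norm x)"
      by (intro tendsto_intros I_lim) (use \<gamma>' in auto)
    then show "(\<lambda>n. (I n \<gamma> + I n (- \<gamma>)) * (K * norm x)) \<longlonglongrightarrow> 0" by simp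
  qed
  then show "(\<lambda>n. contour_calc \<gamma> (dilate Q (l n)) x) \<longlonglongrightarrow> contour_calc \<gamma> (dilate Q a) x"
    by (simp add: LIM_zero_iff)
qed

text \<open>
  Test \<open>v = P(A) x\<close> against itself on a contour inside those of \<open>P\<close> and \<open>Q\<close>, insert the constant \<open>c\<close> as an
  integral over \<open>s\<close>, exchange the integrals, and let \<open>product_formula\<close> move \<open>Q\<close> onto the vector \<open>x\<close>.  What is left of
  the contour integral is estimated by absolute values.
\<close>

lemma reproducing_estimate:
  assumes p: "strip_fun \<beta>1 (\<lambda>w. P (exp w))" and \<psi>: "strip_fun \<beta>2 \<psi>" and q: "strip_fun \<beta>2 (\<lambda>w. Q (exp w))"
    and \<beta>: "\<beta>1 \<le> pi" "\<beta>2 \<le> pi" and \<gamma>: "\<omega> < \<gamma>" "\<gamma> < \<gamma>1" "\<gamma> < \<gamma>2" "\<gamma>1 < \<beta>1" "\<gamma>2 < \<beta>2"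
    and c: "\<And>w. \<bar>Im w\<bar> < \<beta>2 \<Longrightarrow> (LINT s|lborel. \<psi> (complex_of_real s + w) * Q (exp (complex_of_real s + w))) = c"
    and h1: "\<And>w. w \<in> hstrip (- \<beta>1) \<beta>1 \<Longrightarrow> cmod (P (exp w)) \<le> h1 (Re w)"
    and h2: "\<And>w. w \<in> hstrip (- \<beta>2) \<beta>2 \<Longrightarrow> cmod (\<psi> w) \<le> h2 (Re w)"
    and [measurable]: "h1 \<in> borel_measurable borel" "h2 \<in> borel_measurable borel"
    and K: "\<And>w. \<bar>Im w\<bar> = \<gamma> \<Longrightarrow> norm (scaled_res w) \<le> K"
  shows "ennreal (2 * pi * cmod c * norm (contour_calc \<gamma>1 P x))
    \<le> ennreal (2 * K) * (\<integral>\<^sup>+s. (\<integral>\<^sup>+u. ennreal (h1 u) * ennreal (h2 (s + u)) \<partial>lborel)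
        * ennreal (norm (contour_calc \<gamma>2 (dilate Q (complex_of_real s)) x)) \<partial>lborel)"
proof -
  define v where "v = contour_calc \<gamma>1 P x"
  define p0 where "p0 w = P (exp w)" for w
  define q0 where "q0 w = Q (exp w)" for w
  define r where "r w = \<psi> w * q0 w" for w
  define \<phi> where "\<phi> s = norm (contour_calc \<gamma>2 (dilate Q (complex_of_real s)) x)" for s
  define I where "I s = (\<integral>\<^sup>+u. ennreal (h1 u) * ennreal (h2 (s + u)) \<partial>lborel)" for s
  define a where "a w = p0 w * res_form x v w" for w
  have \<gamma>0: "0 < \<gamma>" "\<gamma> < pi" "\<gamma> < \<beta>1" "\<gamma> < \<beta>2" using \<gamma> \<beta> \<omega>_pos by auto
  have K0: "0 \<le> K" by (rule order_trans[OF norm_ge_zero K[of "\<i> * \<gamma>"]]) (use \<gamma>0 in simp)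
  have p0: "strip_fun \<beta>1 p0" and q0: "strip_fun \<beta>2 q0" using p q unfolding p0_def q0_def by auto
  have r: "strip_fun \<beta>2 r" unfolding r_def by (rule strip_fun_mult[OF \<psi> q0])
  have rshift: "strip_fun \<beta>2 (\<lambda>w. f (complex_of_real s + w))" if "strip_fun \<beta>2 f" for f s
    using strip_fun_shift[OF that, of "complex_of_real s" 0] by simp
  have \<phi>_meas[measurable]: "\<phi> \<in> borel_measurable borel"
  proof -
    have "continuous_on UNIV (\<lambda>s. contour_calc \<gamma>2 (dilate Q (complex_of_real s)) x)"
      by (rule continuous_on_compose2[OF contour_calc_shift_continuous[OF q \<beta>(2)]]) (use \<gamma> in \<open>auto intro!: continuous_intros\<close>)
    then show ?thesis unfolding \<phi>_def by (intro borel_measurable_continuous_onI continuous_on_norm)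
  qed
  have I_meas[measurable]: "I \<in> borel_measurable borel"
    unfolding I_def by measurable
  have a_int: "integrable lborel (\<lambda>u. a (Complex u e))" and a_cont: "continuous_on UNIV (\<lambda>u. a (Complex u e))" if e: "\<bar>e\<bar> = \<gamma>" for e
    unfolding a_def
    by (rule strip_fun_mult_integrable[OF p0 _ res_form_line_continuous res_form_le[OF K]]
          continuous_on_mult[OF continuous_on_line[OF strip_fun_continuous[OF p0]] res_form_line_continuous];
        use e \<gamma> \<gamma>0 in simp; fail)+
  define h where "h e u s = a (Complex u e) * r (complex_of_real s + Complex u e)" for e u s
  have r_int: "integrable lborel (\<lambda>s. r (complex_of_real s + Complex u e))"
    and r_norm: "(LINT s|lborel. cmod (r (complex_of_real s + Complex u e))) = (LINT s|lborel. cmod (r (Complex s e)))"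
    and r_c: "(LINT s|lborel. r (complex_of_real s + Complex u e)) = c" if e: "\<bar>e\<bar> = \<gamma>" for u e
  proof -
    have eq: "complex_of_real s + Complex u e = Complex (u + 1 * s) e" for s by (simp add: complex_eq_iff)
    have i: "integrable lborel (\<lambda>s. r (Complex s e))"
      by (rule strip_fun_line_integrable[OF r]) (use e \<gamma>0 in auto)
    from lborel_integrable_real_affine[OF i, of 1 u] show "integrable lborel (\<lambda>s. r (complex_of_real s + Complex u e))"
      unfolding eq by simp
    show "(LINT s|lborel. cmod (r (complex_of_real s + Complex u e))) = (LINT s|lborel. cmod (r (Complex s e)))"
      unfolding eq using lborel_integral_real_affine[of 1 "\<lambda>s. cmod (r (Complex s e))" u] by simp
    show "(LINT s|lborel. r (complex_of_real s + Complex u e)) = c"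
      unfolding r_def q0_def by (rule c) (use e \<gamma>0 in auto)
  qed
  have h_cont: "continuous_on UNIV (\<lambda>z. h e (fst z) (snd z))" if e: "\<bar>e\<bar> = \<gamma>" for e
    unfolding h_def
  proof (intro continuous_on_mult)
    show "continuous_on UNIV (\<lambda>z. a (Complex (fst z) e))"
      by (rule continuous_on_compose2[OF a_cont[OF e] continuous_on_fst[OF continuous_on_id]]) auto
    show "continuous_on UNIV (\<lambda>z. r (complex_of_real (snd z) + Complex (fst z) e))"
      by (rule continuous_on_compose2[OF strip_fun_continuous[OF r]])
        (use e \<gamma>0 in \<open>auto intro!: continuous_intros simp: Complex_eq\<close>)
  qed
  have h_int: "integrable lborel (h e u)" if e: "\<bar>e\<bar> = \<gamma>" for e u
    unfolding h_def using r_int[OF e] by (intro integrable_mult_right)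
  have F: "(LINT u|lborel. LINT s|lborel. h e u s) = (LINT s|lborel. LINT u|lborel. h e u s)"
    "integrable lborel (\<lambda>s. LINT u|lborel. h e u s)" if e: "\<bar>e\<bar> = \<gamma>" for e
  proof -
    have 1: "integrable lborel (\<lambda>u. cmod (a (Complex u e)) * (LINT s|lborel. cmod (r (Complex s e))))"
      using a_int[OF e] by (intro integrable_mult_left integrable_norm)
    have 2: "(LINT s|lborel. cmod (h e u s)) \<le> cmod (a (Complex u e)) * (LINT s|lborel. cmod (r (Complex s e)))" for u
      unfolding h_def norm_mult using r_norm[OF e, of u] by simp
    note F = fubini_dominated[OF borel_measurable_pair_continuous[OF h_cont[OF e]] h_int[OF e] 1 2]
    show "(LINT u|lborel. LINT s|lborel. h e u s) = (LINT s|lborel. LINT u|lborel. h e u s)"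
      "integrable lborel (\<lambda>s. LINT u|lborel. h e u s)"
      by (rule F(2), rule F(4))
  qed
  define T where "T s = two_lines \<gamma> (\<lambda>w. a w * r (complex_of_real s + w))" for s
  have line_c: "c * line_int e a = (LINT s|lborel. line_int e (\<lambda>w. a w * r (complex_of_real s + w)))" if e: "\<bar>e\<bar> = \<gamma>" for e
  proof -
    have "c * line_int e a = (LINT u|lborel. LINT s|lborel. h e u s)"
      unfolding h_def line_int_def using r_c[OF e] by (simp add: mult.commute)
    also have "\<dots> = (LINT s|lborel. LINT u|lborel. h e u s)" by (rule F(1)[OF e])
    finally show ?thesis by (simp add: h_def line_int_def)
  qed
  have T_int: "integrable lborel (\<lambda>s. line_int e (\<lambda>w. a w * r (complex_of_real s + w)))" if e: "\<bar>e\<bar> = \<gamma>" for e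
    using F(2)[OF e] by (simp add: h_def line_int_def)
  have cT: "c * two_lines \<gamma> a = (LINT s|lborel. T s)"
    unfolding two_lines_def T_def right_diff_distrib using \<gamma>0
    by (subst Bochner_Integration.integral_diff) (auto intro!: T_int simp: line_c)
  have T_le: "ennreal (cmod (T s)) \<le> I s * ennreal (\<phi> s) * ennreal (2 * K * norm v)" for s
  proof -
    define b where "b = contour_calc \<gamma>2 (dilate Q (complex_of_real s)) x"
    have qs: "strip_fun \<beta>2 (\<lambda>w. (\<lambda>z. Q (exp (complex_of_real s) * z)) (exp w))"
      using rshift[OF q, of s] by (simp add: exp_add)
    have f: "strip_fun (min \<beta>1 \<beta>2) (\<lambda>w. p0 w * \<psi> (complex_of_real s + w))"
      by (intro strip_fun_mult strip_fun_mono[OF p0] strip_fun_mono[OF rshift[OF \<psi>]]) auto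
    have "T s = two_lines \<gamma> (\<lambda>w. p0 w * \<psi> (complex_of_real s + w) * Q (exp (complex_of_real s) * exp w) * res_form x v w)"
      unfolding T_def a_def r_def q0_def by (simp add: exp_add mult_ac)
    also have "\<dots> = two_lines \<gamma> (\<lambda>w. p0 w * \<psi> (complex_of_real s + w) * res_form b v w)"
      using product_formula[OF f qs \<beta>(2) \<gamma>(1,3) _ \<gamma>(5), of x v] \<gamma>0 unfolding b_def by simp
    finally have T: "T s = two_lines \<gamma> (\<lambda>w. p0 w * \<psi> (complex_of_real s + w) * res_form b v w)" .
    have line: "ennreal (cmod (line_int e (\<lambda>w. p0 w * \<psi> (complex_of_real s + w) * res_form b v w))) \<le> I s * ennreal (K * (\<phi> s * norm v))"
      if e: "\<bar>e\<bar> = \<gamma>" for e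
    proof -
      have mem: "- \<beta>1 < e" "e < \<beta>1" "- \<beta>2 < e" "e < \<beta>2" using e \<gamma>0 by auto
      have "ennreal (cmod (line_int e (\<lambda>w. p0 w * \<psi> (complex_of_real s + w) * res_form b v w)))
          \<le> (\<integral>\<^sup>+u. ennreal (cmod (p0 (Complex u e) * \<psi> (complex_of_real s + Complex u e) * res_form b v (Complex u e))) \<partial>lborel)"
        by (rule line_int_le_nn)
      also have "\<dots> \<le> (\<integral>\<^sup>+u. ennreal (h1 u) * ennreal (h2 (s + u)) * ennreal (K * (\<phi> s * norm v)) \<partial>lborel)"
      proof (rule nn_integral_mono)
        fix u
        have m1: "cmod (p0 (Complex u e)) \<le> h1 u" using h1[of "Complex u e"] mem unfolding p0_def by simp
        have m2: "cmod (\<psi> (complex_of_real s + Complex u e)) \<le> h2 (s + u)" using h2[of "complex_of_real s + Complex u e"] mem by simp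
        have m3: "cmod (res_form b v (Complex u e)) \<le> K * (\<phi> s * norm v)"
          using res_form_le[OF K, of "Complex u e" b v] e unfolding \<phi>_def b_def by simp
        have "cmod (p0 (Complex u e) * \<psi> (complex_of_real s + Complex u e) * res_form b v (Complex u e)) \<le> h1 u * h2 (s + u) * (K * (\<phi> s * norm v))"
          unfolding norm_mult using m1 m2 m3
          by (intro mult_mono) (auto intro: order_trans[OF norm_ge_zero] mult_nonneg_nonneg)
        then show "ennreal (cmod (p0 (Complex u e) * \<psi> (complex_of_real s + Complex u e) * res_form b v (Complex u e)))
            \<le> ennreal (h1 u) * ennreal (h2 (s + u)) * ennreal (K * (\<phi> s * norm v))"
          using order_trans[OF norm_ge_zero m1] order_trans[OF norm_ge_zero m2] order_trans[OF norm_ge_zero m3]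
          by (simp add: ennreal_mult[symmetric] ennreal_leI)
      qed
      also have "\<dots> = I s * ennreal (K * (\<phi> s * norm v))"
        unfolding I_def by (rule nn_integral_multc) measurable
      finally show ?thesis .
    qed
    have "ennreal (cmod (T s)) \<le> ennreal (cmod (line_int (- \<gamma>) (\<lambda>w. p0 w * \<psi> (complex_of_real s + w) * res_form b v w))
        + cmod (line_int \<gamma> (\<lambda>w. p0 w * \<psi> (complex_of_real s + w) * res_form b v w)))"
      unfolding T two_lines_def by (intro ennreal_leI norm_triangle_ineq4)
    also have "\<dots> \<le> I s * ennreal (K * (\<phi> s * norm v)) + I s * ennreal (K * (\<phi> s * norm v))"
      unfolding ennreal_plus[OF norm_ge_zero norm_ge_zero] using \<gamma>0 by (intro add_mono line) auto
    also have "\<dots> = I s * ennreal (\<phi> s) * ennreal (2 * K * norm v)"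
    proof -
      have \<phi>0: "0 \<le> \<phi> s" unfolding \<phi>_def by simp
      have "I s * ennreal (K * (\<phi> s * norm v)) + I s * ennreal (K * (\<phi> s * norm v)) = I s * ennreal (K * (\<phi> s * norm v) + K * (\<phi> s * norm v))"
        using K0 \<phi>0 by (simp add: distrib_left[symmetric] ennreal_plus[symmetric] del: ennreal_plus)
      also have "K * (\<phi> s * norm v) + K * (\<phi> s * norm v) = \<phi> s * (2 * K * norm v)" by simp
      finally show ?thesis using K0 \<phi>0 by (simp add: ennreal_mult mult.assoc)
    qed
    finally show ?thesis .
  qed
  have "cinner v v = 1 / (2 * complex_of_real pi * \<i>) * two_lines \<gamma>1 (\<lambda>w. p0 w * res_form x v w)"
    using contour_calc_inner[OF p _ \<gamma>(4) \<beta>(1), of x v] \<gamma> by (simp add: v_def[symmetric] p0_def)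
  also have "two_lines \<gamma>1 (\<lambda>w. p0 w * res_form x v w) = two_lines \<gamma> a"
    unfolding a_def by (rule contour_independent[OF p0 \<beta>(1)]) (use \<gamma> \<gamma>0 in auto)
  finally have vv: "2 * complex_of_real pi * \<i> * cinner v v = two_lines \<gamma> a"
    by (simp add: field_simps)
  have "norm v * norm v \<le> cmod (cinner v v)"
    by (metis Re_cinner complex_Re_le_cmod power2_eq_square power2_norm_eq_inner)
  then have "2 * pi * cmod c * norm v * norm v \<le> 2 * pi * cmod c * cmod (cinner v v)"
    using mult_left_mono[of "norm v * norm v" "cmod (cinner v v)" "2 * pi * cmod c"] by (simp add: mult.assoc)
  also have "\<dots> = cmod (c * two_lines \<gamma> a)"
    unfolding vv[symmetric] by (simp add: norm_mult)
  finally have "ennreal (2 * pi * cmod c * norm v * norm v) \<le> ennreal (cmod (LINT s|lborel. T s))"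
    unfolding cT by (rule ennreal_leI)
  also have "\<dots> \<le> (\<integral>\<^sup>+s. ennreal (cmod (T s)) \<partial>lborel)"
    by (rule integral_norm_bound_ennreal) (use \<gamma>0 in \<open>auto simp: T_def two_lines_def intro!: T_int Bochner_Integration.integrable_diff\<close>)
  also have "\<dots> \<le> (\<integral>\<^sup>+s. I s * ennreal (\<phi> s) * ennreal (2 * K * norm v) \<partial>lborel)"
    by (intro nn_integral_mono T_le)
  also have "\<dots> = (\<integral>\<^sup>+s. I s * ennreal (\<phi> s) \<partial>lborel) * ennreal (2 * K * norm v)"
    by (rule nn_integral_multc) measurable
  finally have main: "ennreal (2 * pi * cmod c * norm v) * ennreal (norm v) \<le> (ennreal (2 * K) * (\<integral>\<^sup>+s. I s * ennreal (\<phi> s) \<partial>lborel)) * ennreal (norm v)"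
    using K0 by (simp add: ennreal_mult[symmetric] ennreal_mult mult_ac)
  have "ennreal (2 * pi * cmod c * norm v) \<le> ennreal (2 * K) * (\<integral>\<^sup>+s. I s * ennreal (\<phi> s) \<partial>lborel)"
  proof (cases "v = 0")
    case False
    then have iff: "ennreal (norm v) * a \<le> ennreal (norm v) * b \<longleftrightarrow> a \<le> b" for a b
      by (intro ennreal_mult_le_mult_iff) auto
    show ?thesis using main unfolding mult.commute[of _ "ennreal (norm v)"] iff .
  qed simp
  then show ?thesis unfolding v_def I_def \<phi>_def .
qed

lemma nn_integral_exp_abs_shift:
  assumes "0 \<le> C" "0 < \<sigma>"
  shows "(\<integral>\<^sup>+u. ennreal (C * exp (- \<sigma> * \<bar>b + u\<bar>)) \<partial>lborel) = ennreal (C * (LINT u|lborel. exp (- \<sigma> * \<bar>u\<bar>)))"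
proof -
  have "(\<integral>\<^sup>+u. ennreal (C * exp (- \<sigma> * \<bar>b + u\<bar>)) \<partial>lborel) = (\<integral>\<^sup>+u. ennreal (C * exp (- \<sigma> * \<bar>u\<bar>)) \<partial>lborel)"
    by (rule nn_integral_translate[of "\<lambda>u. ennreal (C * exp (- \<sigma> * \<bar>u\<bar>))" b]) measurable
  also have "\<dots> = ennreal (LINT u|lborel. C * exp (- \<sigma> * \<bar>u\<bar>))"
    using assms by (intro nn_integral_eq_integral integrable_mult_right integrable_exp_abs) auto
  finally show ?thesis by simp
qed

text \<open>
  The imaginary parts of \<open>l1\<close> and \<open>l2\<close> rotate \<open>P\<close> and \<open>Q\<close>, which is why the contours have to lie in the sectors of
  angle \<open>\<theta> - a1\<close> and \<open>\<theta> - a2\<close>; the real parts only translate \<open>t\<close> and \<open>s\<close>.  The constant depends on the decay of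
  \<open>P\<close> and \<open>Q\<close>, on the bound for the resolvent and on the reproducing constant of the unrotated \<open>Q\<close>, hence not on
  \<open>l1\<close> and \<open>l2\<close>.
\<close>

lemma square_functions_comparable:
  assumes P: "strip_fun \<theta> (\<lambda>w. P (exp w))" and Q: "strip_fun \<theta> (\<lambda>w. Q (exp w))" and \<theta>: "\<theta> \<le> pi"
    and a: "0 \<le> a1" "0 \<le> a2" and \<gamma>: "\<omega> < \<gamma>1" "\<gamma>1 < \<theta> - a1" "\<omega> < \<gamma>2" "\<gamma>2 < \<theta> - a2"
    and nz: "w0 \<in> hstrip (- \<theta>) \<theta>" "Q (exp w0) \<noteq> 0"
  obtains M where "0 < M"
    "\<And>l1 l2 x. \<bar>Im l1\<bar> \<le> a1 \<Longrightarrow> \<bar>Im l2\<bar> \<le> a2 \<Longrightarrow>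
      sq_int \<gamma>1 P l1 x
      \<le> ennreal M * sq_int \<gamma>2 Q l2 x"
proof -
  define p where "p w = P (exp w)" for w
  define q where "q w = Q (exp w)" for w
  have p: "strip_fun \<theta> p" and q: "strip_fun \<theta> q" using P Q unfolding p_def q_def by auto
  define c where "c = (LINT u|lborel. (cmod (q (Complex u 0)))\<^sup>2)"
  have \<theta>0: "0 < \<theta>" using \<gamma> a \<omega>_pos by linarith
  have c: "0 < c" unfolding c_def by (rule integral_norm_square_pos[OF q \<theta>0 nz(1)]) (use nz in \<open>simp add: q_def\<close>)
  define \<gamma> where "\<gamma> = (\<omega> + min \<gamma>1 \<gamma>2) / 2"
  have g: "\<omega> < \<gamma>" "\<gamma> < \<gamma>1" "\<gamma> < \<gamma>2" using assms(6,8) unfolding \<gamma>_def by auto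
  then have g0: "0 < \<gamma>" "\<gamma> < pi" using \<gamma> a \<theta> \<omega>_pos by auto
  obtain K where K: "0 < K" "\<And>w. \<gamma> \<le> \<bar>Im w\<bar> \<Longrightarrow> \<bar>Im w\<bar> < pi \<Longrightarrow> norm (scaled_res w) \<le> K"
    using scaled_res_bounded[OF g(1) g0(2)] by metis
  obtain C1 \<sigma>1 where C1: "0 \<le> C1" "0 < \<sigma>1" "\<And>w. w \<in> hstrip (- \<theta>) \<theta> \<Longrightarrow> cmod (p w) \<le> C1 * exp (- \<sigma>1 * \<bar>Re w\<bar>)"
    using strip_funE[OF p] by metis
  obtain C2 \<sigma>2 where C2: "0 \<le> C2" "0 < \<sigma>2" "\<And>w. w \<in> hstrip (- \<theta>) \<theta> \<Longrightarrow> cmod (q w) \<le> C2 * exp (- \<sigma>2 * \<bar>Re w\<bar>)"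
    using strip_funE[OF q] by metis
  define H where "H = (C1 * (LINT u|lborel. exp (- \<sigma>1 * \<bar>u\<bar>))) * (C2 * (LINT u|lborel. exp (- \<sigma>2 * \<bar>u\<bar>)))"
  have H: "0 \<le> H" unfolding H_def using C1 C2 by (auto intro!: mult_nonneg_nonneg)
  define M where "M = (2 * K * H / (2 * pi * c))\<^sup>2"
  have "sq_int \<gamma>1 P l1 x
      \<le> ennreal M * sq_int \<gamma>2 Q l2 x"
    if l: "\<bar>Im l1\<bar> \<le> a1" "\<bar>Im l2\<bar> \<le> a2" for l1 l2 x
  proof -
    define \<Phi> where "\<Phi> t = norm (contour_calc \<gamma>1 (dilate P (complex_of_real t + l1)) x)" for t
    define \<phi> where "\<phi> s = norm (contour_calc \<gamma>2 (dilate Q (complex_of_real s + l2)) x)" for s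
    define h1 where "h1 u = C1 * exp (- \<sigma>1 * \<bar>Re l1 + u\<bar>)" for u
    define h2 where "h2 u = C2 * exp (- \<sigma>2 * \<bar>Re l2 + u\<bar>)" for u
    define \<psi> where "\<psi> w = cnj (q (cnj (l2 + w)))" for w
    have [measurable]: "h1 \<in> borel_measurable borel" "h2 \<in> borel_measurable borel"
      unfolding h1_def h2_def by measurable
    have ql: "strip_fun (\<theta> - a2) (\<lambda>w. q (l2 + w))" by (rule strip_fun_shift[OF q l(2)])
    have \<psi>: "strip_fun (\<theta> - a2) \<psi>" unfolding \<psi>_def by (rule strip_fun_shift[OF strip_fun_conj[OF q] l(2)])
    have est: "ennreal (2 * pi * c * \<Phi> t) \<le> ennreal (2 * K) * (\<integral>\<^sup>+s. (\<integral>\<^sup>+u. ennreal (h1 (t + u)) * ennreal (h2 (s + u)) \<partial>lborel) * ennreal (\<phi> s) \<partial>lborel)" for t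
    proof -
      let ?P = "\<lambda>z. P (exp (complex_of_real t + l1) * z)"
      let ?Q = "\<lambda>z. Q (exp l2 * z)"
      have P': "?P (exp w) = p (complex_of_real t + l1 + w)" for w by (simp add: p_def exp_add)
      have Q': "?Q (exp w) = q (l2 + w)" for w by (simp add: q_def exp_add)
      have 1: "strip_fun (\<theta> - a1) (\<lambda>w. ?P (exp w))"
        unfolding P' by (rule strip_fun_shift[OF p]) (use l in simp)
      have 2: "strip_fun (\<theta> - a2) (\<lambda>w. ?Q (exp w))" unfolding Q' by (rule ql)
      have "ennreal (2 * pi * cmod (complex_of_real c) * norm (contour_calc \<gamma>1 ?P x))
        \<le> ennreal (2 * K) * (\<integral>\<^sup>+s. (\<integral>\<^sup>+u. ennreal (h1 (t + u)) * ennreal (h2 (s + u)) \<partial>lborel)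
          * ennreal (norm (contour_calc \<gamma>2 (\<lambda>z. ?Q (exp (complex_of_real s) * z)) x)) \<partial>lborel)"
      proof (rule reproducing_estimate[OF 1 \<psi> 2 _ _ g \<gamma>(2,4)])
        show "(LINT s|lborel. \<psi> (complex_of_real s + w) * ?Q (exp (complex_of_real s + w))) = complex_of_real c"
          if "\<bar>Im w\<bar> < \<theta> - a2" for w
          unfolding Q' c_def \<psi>_def using reproducing_constant[OF q, of "l2 + w"] that l(2)
          by (simp add: algebra_simps)
        show "cmod (?P (exp w)) \<le> h1 (t + Re w)" if "w \<in> hstrip (- (\<theta> - a1)) (\<theta> - a1)" for w
        proof -
          have "complex_of_real t + l1 + w \<in> hstrip (- \<theta>) \<theta>" using that l(1) by auto
          from C1(3)[OF this] show ?thesis unfolding P' h1_def by (simp add: add_ac)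
        qed
        show "cmod (\<psi> w) \<le> h2 (Re w)" if "w \<in> hstrip (- (\<theta> - a2)) (\<theta> - a2)" for w
        proof -
          have "cnj (l2 + w) \<in> hstrip (- \<theta>) \<theta>" using that l(2) by auto
          from C2(3)[OF this] show ?thesis unfolding \<psi>_def h2_def by simp
        qed
        show "norm (scaled_res w) \<le> K" if "\<bar>Im w\<bar> = \<gamma>" for w using K(2)[of w] that g0 by simp
      qed (use \<theta> a in auto)
      moreover have "exp l2 * (exp (complex_of_real s) * z) = exp (complex_of_real s + l2) * z" for s z
        by (simp add: exp_add mult_ac)
      ultimately show ?thesis using c by (simp add: \<Phi>_def \<phi>_def)
    qed
    have \<phi>_meas[measurable]: "\<phi> \<in> borel_measurable borel"
    proof -
      have "continuous_on UNIV (\<lambda>s. contour_calc \<gamma>2 (dilate Q (complex_of_real s + l2)) x)"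
        by (rule continuous_on_compose2[OF contour_calc_shift_continuous[OF Q \<theta> assms(8)]]) (use assms(9) l a in \<open>auto intro!: continuous_intros\<close>)
      then show ?thesis unfolding \<phi>_def by (intro borel_measurable_continuous_onI continuous_on_norm)
    qed
    define J where "J t = (\<integral>\<^sup>+s. (\<integral>\<^sup>+u. ennreal (h1 (t + u)) * ennreal (h2 (s + u)) \<partial>lborel) * ennreal (\<phi> s) \<partial>lborel)" for t
    have J_meas[measurable]: "J \<in> borel_measurable borel" unfolding J_def by measurable
    have "ennreal ((\<Phi> t)\<^sup>2) \<le> ennreal ((2 * K / (2 * pi * c))\<^sup>2) * (J t)\<^sup>2" for t
    proof -
      have "ennreal (\<Phi> t) = ennreal (1 / (2 * pi * c)) * ennreal (2 * pi * c * \<Phi> t)"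
        using c by (simp add: ennreal_mult[symmetric] \<Phi>_def)
      also have "\<dots> \<le> ennreal (1 / (2 * pi * c)) * (ennreal (2 * K) * J t)"
        unfolding J_def by (intro mult_left_mono est) auto
      also have "\<dots> = ennreal (2 * K / (2 * pi * c)) * J t"
        using c K(1) by (simp add: ennreal_mult[symmetric] mult.assoc[symmetric])
      finally have "(ennreal (\<Phi> t))\<^sup>2 \<le> (ennreal (2 * K / (2 * pi * c)) * J t)\<^sup>2"
        by (intro power_mono) auto
      then show ?thesis
        using c K(1) by (simp add: power_mult_distrib ennreal_power \<Phi>_def)
    qed
    then have "(\<integral>\<^sup>+t. ennreal ((\<Phi> t)\<^sup>2) \<partial>lborel) \<le> (\<integral>\<^sup>+t. ennreal ((2 * K / (2 * pi * c))\<^sup>2) * (J t)\<^sup>2 \<partial>lborel)"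
      by (intro nn_integral_mono)
    also have "\<dots> = ennreal ((2 * K / (2 * pi * c))\<^sup>2) * (\<integral>\<^sup>+t. (J t)\<^sup>2 \<partial>lborel)"
      by (rule nn_integral_cmult) measurable
    also have "\<dots> \<le> ennreal ((2 * K / (2 * pi * c))\<^sup>2) * ((ennreal H)\<^sup>2 * (\<integral>\<^sup>+s. (ennreal (\<phi> s))\<^sup>2 \<partial>lborel))"
    proof (intro mult_left_mono)
      have "(\<integral>\<^sup>+u. ennreal (h1 u) \<partial>lborel) * (\<integral>\<^sup>+u. ennreal (h2 u) \<partial>lborel) = ennreal H"
        unfolding h1_def h2_def H_def nn_integral_exp_abs_shift[OF C1(1,2)] nn_integral_exp_abs_shift[OF C2(1,2)]
        by (rule ennreal_mult[symmetric]) (use C1 C2 in auto)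
      then show "(\<integral>\<^sup>+t. (J t)\<^sup>2 \<partial>lborel) \<le> (ennreal H)\<^sup>2 * (\<integral>\<^sup>+s. (ennreal (\<phi> s))\<^sup>2 \<partial>lborel)"
        using schur_test[of "\<lambda>u. ennreal (h1 u)" "\<lambda>u. ennreal (h2 u)" "\<lambda>s. ennreal (\<phi> s)"] unfolding J_def by simp
    qed simp
    also have "\<dots> = ennreal M * (\<integral>\<^sup>+s. ennreal ((\<phi> s)\<^sup>2) \<partial>lborel)"
    proof -
      have "(ennreal (\<phi> s))\<^sup>2 = ennreal ((\<phi> s)\<^sup>2)" for s by (simp add: ennreal_power \<phi>_def)
      moreover have "ennreal ((2 * K / (2 * pi * c))\<^sup>2) * (ennreal H)\<^sup>2 = ennreal M"
        using H by (simp add: ennreal_power ennreal_mult[symmetric] M_def power_mult_distrib power_divide)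
      ultimately show ?thesis by (simp add: mult.assoc[symmetric])
    qed
    finally show ?thesis unfolding \<Phi>_def \<phi>_def .
  qed
  moreover have "ennreal M * X \<le> ennreal (M + 1) * X" for X :: ennreal
    by (intro mult_right_mono ennreal_leI) auto
  moreover have "0 < M + 1" by (simp add: M_def add_nonneg_pos)
  \<comment> \<open>\<open>M\<close> itself may be zero when \<open>P = 0\<close>.\<close>
  ultimately show thesis using that[of "M + 1"] by (meson order_trans)
qed

end

section \<open>Sectors and rays\<close>

lemma exp_mem_sector: "\<bar>Im w\<bar> < \<theta> \<Longrightarrow> \<theta> \<le> pi \<Longrightarrow> exp w \<in> sector \<theta>"
  by (simp add: sector_def Arg_exp)

lemma Ln_mem_hstrip: "z \<in> sector \<theta> \<Longrightarrow> Ln z \<in> hstrip (- \<theta>) \<theta> \<and> exp (Ln z) = z"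
  by (auto simp: sector_def Arg_eq_Im_Ln)

lemma Hinf0_strip_fun:
  assumes F: "F \<in> Hinf0 \<theta>" and \<theta>: "\<theta> \<le> pi"
  shows "strip_fun \<theta> (\<lambda>w. F (exp w))"
proof -
  have sec: "exp w \<in> sector \<theta>" if "w \<in> hstrip (- \<theta>) \<theta>" for w
    using that \<theta> by (intro exp_mem_sector) auto
  then have sub: "exp ` hstrip (- \<theta>) \<theta> \<subseteq> sector \<theta>" by blast
  have "(F \<circ> exp) holomorphic_on hstrip (- \<theta>) \<theta>"
    by (rule holomorphic_on_compose_gen[OF holomorphic_on_exp _ sub]) (use F in \<open>auto simp: Hinf0_def\<close>)
  moreover obtain s c where s: "0 < s" "0 < c" "\<And>z. z \<in> sector \<theta> \<Longrightarrow> cmod (F z) \<le> c * (cmod z powr s / (1 + cmod z) powr (2 * s))"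
    using F unfolding Hinf0_def by blast
  have "cmod (F (exp w)) \<le> c * exp (- s * \<bar>Re w\<bar>)" if "w \<in> hstrip (- \<theta>) \<theta>" for w
  proof -
    define x where "x = Re w"
    have "1 + exp x \<noteq> 0" using exp_gt_zero[of x] by linarith
    then have "exp x powr s / (1 + exp x) powr (2 * s) \<le> exp x powr s / (max 1 (exp x)) powr (2 * s)"
      using s(1) by (intro divide_left_mono powr_mono2 mult_pos_pos) (auto simp: max_def)
    also have "\<dots> = exp (- s * \<bar>x\<bar>)"
      using s(1) by (auto simp: max_def powr_def exp_diff[symmetric] algebra_simps)
    finally have "c * (exp x powr s / (1 + exp x) powr (2 * s)) \<le> c * exp (- s * \<bar>x\<bar>)"
      using s(2) by (intro mult_left_mono) auto
    then show ?thesis using s(3)[OF sec[OF that]] unfolding x_def by simp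
  qed
  ultimately show ?thesis
    unfolding strip_fun_def o_def using s(1,2) by (intro conjI exI[of _ c] exI[of _ s]) auto
qed

lemma borel_measurable_ennreal_on:
  fixes f :: "'a::topological_space \<Rightarrow> real"
  assumes "continuous_on A f" "A \<in> sets borel"
  shows "(\<lambda>x. ennreal (f x) * indicator A x) \<in> borel_measurable borel"
proof -
  have "(\<lambda>x. indicator A x *\<^sub>R f x) \<in> borel_measurable borel"
    by (rule borel_measurable_continuous_on_indicator[OF assms(2,1)])
  then have "(\<lambda>x. ennreal (indicator A x *\<^sub>R f x)) \<in> borel_measurable borel" by measurable
  also have "(\<lambda>x. ennreal (indicator A x *\<^sub>R f x)) = (\<lambda>x. ennreal (f x) * indicator A x)"
    by (auto simp: indicator_def)
  finally show ?thesis .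
qed

lemma lborel_complex: "(lborel :: complex measure) = distr (lborel \<Otimes>\<^sub>M lborel) borel (\<lambda>z. Complex (fst z) (snd z))"
proof (rule lborel_eqI)
  have cont: "continuous_on UNIV (\<lambda>z::real \<times> real. Complex (fst z) (snd z))"
    unfolding Complex_eq by (intro continuous_intros)
  then have m: "(\<lambda>z. Complex (fst z) (snd z)) \<in> measurable (lborel \<Otimes>\<^sub>M lborel) borel"
    using borel_measurable_continuous_onI[OF cont] by (simp add: lborel_prod)
  fix l u :: complex
  assume lu: "\<And>b. b \<in> Basis \<Longrightarrow> l \<bullet> b \<le> u \<bullet> b"
  have le: "Re l \<le> Re u" "Im l \<le> Im u" using lu[of 1] lu[of \<i>] by (auto simp: Basis_complex_def)
  have "(\<lambda>z. Complex (fst z) (snd z)) -` box l u \<inter> space (lborel \<Otimes>\<^sub>M lborel) = {Re l<..<Re u} \<times> {Im l<..<Im u}"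
    by (auto simp: box_def Basis_complex_def space_pair_measure)
  then have "emeasure (distr (lborel \<Otimes>\<^sub>M lborel) borel (\<lambda>z. Complex (fst z) (snd z))) (box l u)
      = emeasure (lborel \<Otimes>\<^sub>M lborel) ({Re l<..<Re u} \<times> {Im l<..<Im u})"
    by (subst emeasure_distr[OF m]) auto
  also have "\<dots> = ennreal (Re u - Re l) * ennreal (Im u - Im l)"
    using le by (subst lborel.emeasure_pair_measure_Times) auto
  also have "\<dots> = (\<Prod>b\<in>Basis. (u - l) \<bullet> b)"
    using le by (simp add: Basis_complex_def ennreal_mult[symmetric] complex_eq_iff)
  finally show "emeasure (distr (lborel \<Otimes>\<^sub>M lborel) borel (\<lambda>z. Complex (fst z) (snd z))) (box l u) = (\<Prod>b\<in>Basis. (u - l) \<bullet> b)" .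
qed simp

lemma mem_sector_iff:
  assumes "0 < \<alpha>" "\<alpha> < pi / 2"
  shows "z \<in> sector \<alpha> \<longleftrightarrow> 0 < Re z \<and> \<bar>Im z / Re z\<bar> < tan \<alpha>"
proof -
  have "z \<in> sector \<alpha> \<Longrightarrow> 0 < Re z"
    using Re_Ln_pos_lt[of z] assms by (auto simp: sector_def Arg_eq_Im_Ln)
  moreover have "\<bar>Arg z\<bar> < \<alpha> \<longleftrightarrow> \<bar>Im z / Re z\<bar> < tan \<alpha>" if "0 < Re z"
  proof -
    have "\<bar>arctan y\<bar> < \<alpha> \<longleftrightarrow> \<bar>y\<bar> < tan \<alpha>" for y
    proof -
      have "arctan (tan \<alpha>) = \<alpha>" "arctan (- tan \<alpha>) = - \<alpha>" using assms by (auto simp: arctan_tan arctan_minus)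
      then show ?thesis
        using arctan_less_iff[of y "tan \<alpha>"] arctan_less_iff[of "- tan \<alpha>" y] by (auto simp: abs_less_iff)
    qed
    then show ?thesis using that by (simp add: arg_conv_arctan)
  qed
  ultimately show ?thesis by (auto simp: sector_def)
qed

text \<open>
  A linear substitution \<open>b = a \<tau>\<close> on each vertical line, followed by Fubini's theorem.  With the slope \<open>\<tau>\<close> in
  place of the angle, no polar coordinates are needed.
\<close>

lemma nn_integral_sector:
  fixes f :: "complex \<Rightarrow> ennreal"
  assumes meas: "(\<lambda>z. f z * indicator (sector \<alpha>) z) \<in> borel_measurable borel" and \<alpha>: "0 < \<alpha>" "\<alpha> < pi / 2"
  shows "(\<integral>\<^sup>+z\<in>sector \<alpha>. f z \<partial>lborel)
    = (\<integral>\<^sup>+\<tau>\<in>{- tan \<alpha><..<tan \<alpha>}. (\<integral>\<^sup>+a\<in>{0<..}. ennreal a * f (Complex a (a * \<tau>)) \<partial>lborel) \<partial>lborel)"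
    and "(\<lambda>\<tau>. (\<integral>\<^sup>+a\<in>{0<..}. ennreal a * f (Complex a (a * \<tau>)) \<partial>lborel) * indicator {- tan \<alpha><..<tan \<alpha>} \<tau>) \<in> borel_measurable borel"
proof -
  define g where "g z = f z * indicator (sector \<alpha>) z" for z
  have [measurable]: "g \<in> borel_measurable borel" unfolding g_def by (rule meas)
  have C1[measurable]: "(\<lambda>z. Complex (fst z) (snd z)) \<in> measurable (lborel \<Otimes>\<^sub>M lborel) borel"
  proof -
    have "continuous_on UNIV (\<lambda>z::real \<times> real. Complex (fst z) (snd z))"
      unfolding Complex_eq by (intro continuous_intros)
    from borel_measurable_continuous_onI[OF this] show ?thesis by (simp add: lborel_prod)
  qed
  have C2[measurable]: "(\<lambda>z. Complex (fst z) (fst z * snd z)) \<in> measurable (lborel \<Otimes>\<^sub>M lborel) borel"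
  proof -
    have "continuous_on UNIV (\<lambda>z::real \<times> real. Complex (fst z) (fst z * snd z))"
      unfolding Complex_eq by (intro continuous_intros)
    from borel_measurable_continuous_onI[OF this] show ?thesis by (simp add: lborel_prod)
  qed
  have C3[measurable]: "(\<lambda>b. Complex a b) \<in> borel_measurable borel" for a
    unfolding Complex_eq by (intro borel_measurable_continuous_onI continuous_intros)
  have g1: "(\<lambda>z. g (Complex (fst z) (snd z))) \<in> borel_measurable (lborel \<Otimes>\<^sub>M lborel)"
    by measurable
  have pm[measurable]: "(\<lambda>z. indicator {0<..} (fst z) * (ennreal (fst z) * g (Complex (fst z) (fst z * snd z)))) \<in> borel_measurable (lborel \<Otimes>\<^sub>M lborel)"
    by measurable
  have inner: "(\<integral>\<^sup>+b. g (Complex a b) \<partial>lborel) = (\<integral>\<^sup>+\<tau>. indicator {0<..} a * (ennreal a * g (Complex a (a * \<tau>))) \<partial>lborel)" for a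
  proof (cases "0 < a")
    case True
    have "(\<integral>\<^sup>+b. g (Complex a b) \<partial>lborel) = ennreal \<bar>a\<bar> * (\<integral>\<^sup>+\<tau>. g (Complex a (0 + a * \<tau>)) \<partial>lborel)"
      by (rule nn_integral_real_affine) (use True in auto)
    also have "\<dots> = (\<integral>\<^sup>+\<tau>. ennreal a * g (Complex a (a * \<tau>)) \<partial>lborel)"
      using True by (subst nn_integral_cmult) auto
    finally show ?thesis using True by simp
  next
    case False
    then have "g (Complex a b) = 0" for b
      unfolding g_def by (simp add: mem_sector_iff[OF \<alpha>])
    then show ?thesis using False by simp
  qed
  have ray: "(\<integral>\<^sup>+a. indicator {0<..} a * (ennreal a * g (Complex a (a * \<tau>))) \<partial>lborel)
      = (\<integral>\<^sup>+a\<in>{0<..}. ennreal a * f (Complex a (a * \<tau>)) \<partial>lborel) * indicator {- tan \<alpha><..<tan \<alpha>} \<tau>" for \<tau>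
  proof -
    have sec: "Complex a (a * \<tau>) \<in> sector \<alpha> \<longleftrightarrow> \<tau> \<in> {- tan \<alpha><..<tan \<alpha>}" if "0 < a" for a
      using that by (auto simp: mem_sector_iff[OF \<alpha>] abs_less_iff)
    show ?thesis
    proof (cases "\<tau> \<in> {- tan \<alpha><..<tan \<alpha>}")
      case True
      then show ?thesis
        by (simp del: greaterThanLessThan_iff) (intro nn_integral_cong, use sec in \<open>auto simp: g_def indicator_def simp del: greaterThanLessThan_iff\<close>)
    next
      case False
      then have z: "indicator {0<..} a * (ennreal a * g (Complex a (a * \<tau>))) = 0" for a
        using sec by (auto simp: g_def indicator_def simp del: greaterThanLessThan_iff)
      show ?thesis unfolding z using False by (simp del: greaterThanLessThan_iff)
    qed
  qed
  have "(\<integral>\<^sup>+z\<in>sector \<alpha>. f z \<partial>lborel) = (\<integral>\<^sup>+z. g (Complex (fst z) (snd z)) \<partial>(lborel \<Otimes>\<^sub>M lborel))"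
    unfolding g_def[symmetric] by (subst lborel_complex) (rule nn_integral_distr[OF C1], measurable)
  also have "\<dots> = (\<integral>\<^sup>+a. \<integral>\<^sup>+b. g (Complex a b) \<partial>lborel \<partial>lborel)"
    using lborel.nn_integral_fst[OF g1] by simp
  also have "\<dots> = (\<integral>\<^sup>+a. \<integral>\<^sup>+\<tau>. indicator {0<..} a * (ennreal a * g (Complex a (a * \<tau>))) \<partial>lborel \<partial>lborel)"
    unfolding inner ..
  also have "\<dots> = (\<integral>\<^sup>+\<tau>. \<integral>\<^sup>+a. indicator {0<..} a * (ennreal a * g (Complex a (a * \<tau>))) \<partial>lborel \<partial>lborel)"
    by (rule lborel_pair.Fubini'[symmetric]) (use pm in \<open>simp add: case_prod_beta'\<close>)
  finally show "(\<integral>\<^sup>+z\<in>sector \<alpha>. f z \<partial>lborel)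
    = (\<integral>\<^sup>+\<tau>\<in>{- tan \<alpha><..<tan \<alpha>}. (\<integral>\<^sup>+a\<in>{0<..}. ennreal a * f (Complex a (a * \<tau>)) \<partial>lborel) \<partial>lborel)"
    unfolding ray .
  have "(\<lambda>\<tau>. \<integral>\<^sup>+a. indicator {0<..} a * (ennreal a * g (Complex a (a * \<tau>))) \<partial>lborel) \<in> borel_measurable lborel"
  proof (rule lborel.borel_measurable_nn_integral)
    have "(\<lambda>z. (snd z, fst z)) \<in> measurable (lborel \<Otimes>\<^sub>M lborel) (lborel \<Otimes>\<^sub>M (lborel :: real measure))" by measurable
    from measurable_compose[OF this pm]
    show "(\<lambda>(\<tau>, a). indicator {0<..} a * (ennreal a * g (Complex a (a * \<tau>)))) \<in> borel_measurable (lborel \<Otimes>\<^sub>M lborel)"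
      by (simp add: case_prod_beta')
  qed
  then show "(\<lambda>\<tau>. (\<integral>\<^sup>+a\<in>{0<..}. ennreal a * f (Complex a (a * \<tau>)) \<partial>lborel) * indicator {- tan \<alpha><..<tan \<alpha>} \<tau>) \<in> borel_measurable borel"
    unfolding ray by simp
qed

section \<open>Equivalence of the area integral and the square function\<close>

lemma ennsqrt_le:
  assumes "a \<le> ennreal (C\<^sup>2) * b" "0 < C"
  shows "ennsqrt a \<le> ennreal C * ennsqrt b"
proof (cases "b = \<infinity>")
  case True
  then show ?thesis using assms(2) by (simp add: ennsqrt_def ennreal_mult_top)
next
  case False
  then obtain r where r: "b = ennreal r" "0 \<le> r" by (cases b) auto
  then have a: "a \<le> ennreal (C\<^sup>2 * r)" using assms(1) by (simp add: ennreal_mult)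
  then obtain q where q: "a = ennreal q" "0 \<le> q" by (cases a) (auto simp: top_unique)
  have "sqrt q \<le> sqrt (C\<^sup>2 * r)" using a q r by (intro real_sqrt_le_mono) simp
  also have "\<dots> = C * sqrt r" using assms(2) by (simp add: real_sqrt_mult)
  finally show ?thesis using q r assms(2) by (simp add: ennsqrt_def ennreal_mult[symmetric] ennreal_leI)
qed

lemma (in sectorial_operator) square_fn_eq:
  assumes G: "strip_fun \<theta> (\<lambda>w. G (exp w))" and \<theta>: "\<theta> \<le> pi" and \<gamma>: "\<gamma> = (SOME \<gamma>. \<omega> < \<gamma> \<and> \<gamma> < \<theta>)" "\<omega> < \<gamma>" "\<gamma> < \<theta>"
  shows "square_fn D A \<omega> \<theta> G x
    = ennsqrt (\<integral>\<^sup>+u. ennreal ((norm (contour_calc \<gamma> (dilate G (of_real u)) x))\<^sup>2) \<partial>lborel)"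
proof -
  define \<phi> where "\<phi> t = norm (contour_calc \<gamma> (\<lambda>z. G (complex_of_real t * z)) x)" for t
  have fc: "fun_calc D A \<omega> \<theta> f = contour_calc \<gamma> f" for f
    unfolding fun_calc_def contour_calc_def Let_def \<gamma>(1) ..
  have "continuous_on {0<..} (\<lambda>t. contour_calc \<gamma> (dilate G (complex_of_real (ln t))) x)"
    by (rule continuous_on_compose2[OF contour_calc_shift_continuous[OF G \<theta> \<gamma>(2)]]) (use \<gamma> in \<open>auto intro!: continuous_intros\<close>)
  then have "continuous_on {0<..} (\<lambda>t. (norm (contour_calc \<gamma> (dilate G (complex_of_real (ln t))) x))\<^sup>2 / t)"
    by (intro continuous_on_divide continuous_on_power continuous_on_norm continuous_on_id) auto
  then have "continuous_on {0<..} (\<lambda>t. (\<phi> t)\<^sup>2 / t)"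
    by (rule continuous_on_eq) (auto simp: \<phi>_def exp_of_real)
  from borel_measurable_ennreal_on[OF this]
  have "(\<integral>\<^sup>+t\<in>{0<..}. ennreal ((\<phi> t)\<^sup>2 / t) \<partial>lborel) = (\<integral>\<^sup>+u. ennreal (exp u) * ennreal ((\<phi> (exp u))\<^sup>2 / exp u) \<partial>lborel)"
    by (intro nn_integral_exp_subst) simp
  also have "\<dots> = (\<integral>\<^sup>+u. ennreal ((\<phi> (exp u))\<^sup>2) \<partial>lborel)"
    by (simp add: ennreal_mult[symmetric])
  finally show ?thesis
    unfolding square_fn_def fc \<phi>_def by (simp add: exp_of_real)
qed

text \<open>
  On the ray of slope \<open>\<tau>\<close> the density \<open>1 / \<bar>z\<bar>\<^sup>2\<close> and the Jacobian \<open>a\<close> combine to \<open>(1 / (1 + \<tau>\<^sup>2)) da / a\<close>.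
\<close>

lemma (in sectorial_operator) area_fn_eq:
  assumes F: "strip_fun \<theta> (\<lambda>w. F (exp w))" and \<theta>: "\<theta> \<le> pi" and \<alpha>: "0 < \<alpha>" "\<alpha> < pi / 2"
    and \<gamma>: "\<gamma> = (SOME \<gamma>. \<omega> < \<gamma> \<and> \<gamma> < \<theta> - \<alpha>)" "\<omega> < \<gamma>" "\<gamma> < \<theta> - \<alpha>"
  defines "I \<equiv> \<lambda>x l. sq_int \<gamma> F l x"
  shows "area_fn D A \<omega> \<theta> \<alpha> F x
    = ennsqrt (\<integral>\<^sup>+\<tau>\<in>{- tan \<alpha><..<tan \<alpha>}. ennreal (1 / (1 + \<tau>\<^sup>2)) * I x (Ln (Complex 1 \<tau>)) \<partial>lborel)"
    and "(\<lambda>\<tau>. ennreal (1 / (1 + \<tau>\<^sup>2)) * I x (Ln (Complex 1 \<tau>)) * indicator {- tan \<alpha><..<tan \<alpha>} \<tau>) \<in> borel_measurable borel"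
proof -
  define \<phi> where "\<phi> z = norm (contour_calc \<gamma> (\<lambda>w. F (z * w)) x)" for z
  define f where "f z = ennreal ((\<phi> z)\<^sup>2 / (cmod z)\<^sup>2)" for z
  have fc: "fun_calc D A \<omega> (\<theta> - \<alpha>) f = contour_calc \<gamma> f" for f
    unfolding fun_calc_def contour_calc_def Let_def \<gamma>(1) ..
  have open_sector: "open (sector \<alpha>)"
  proof -
    have "sector \<alpha> = {z. 0 < Re z} \<inter> {z. \<bar>Im z\<bar> < tan \<alpha> * Re z}"
      by (auto simp: mem_sector_iff[OF \<alpha>] abs_divide pos_divide_less_eq)
    also have "open \<dots>"
      by (intro open_Int open_Collect_less continuous_intros)
    finally show ?thesis .
  qed
  have cont: "continuous_on (sector \<alpha>) \<phi>"
  proof -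
    have "continuous_on (sector \<alpha>) (\<lambda>z. contour_calc \<gamma> (dilate F (Ln z)) x)"
    proof (rule continuous_on_compose2[OF contour_calc_shift_continuous[OF F \<theta> \<gamma>(2)]])
      show "continuous_on (sector \<alpha>) Ln"
        by (intro continuous_intros) (auto simp: mem_sector_iff[OF \<alpha>] complex_nonpos_Reals_iff)
      show "Ln ` sector \<alpha> \<subseteq> {l. \<bar>Im l\<bar> < \<theta> - \<gamma>}"
        using Ln_mem_hstrip[of _ \<alpha>] \<gamma> by fastforce
    qed
    then have "continuous_on (sector \<alpha>) (\<lambda>z. norm (contour_calc \<gamma> (dilate F (Ln z)) x))"
      by (rule continuous_on_norm)
    then show ?thesis
      by (rule continuous_on_eq) (auto simp: \<phi>_def sector_def)
  qed
  have meas: "(\<lambda>z. f z * indicator (sector \<alpha>) z) \<in> borel_measurable borel"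
    unfolding f_def
    by (rule borel_measurable_ennreal_on) (use open_sector cont in \<open>auto intro!: continuous_intros simp: sector_def\<close>)
  have ray: "(\<integral>\<^sup>+a\<in>{0<..}. ennreal a * f (Complex a (a * \<tau>)) \<partial>lborel) = ennreal (1 / (1 + \<tau>\<^sup>2)) * I x (Ln (Complex 1 \<tau>))"
    if \<tau>: "\<tau> \<in> {- tan \<alpha><..<tan \<alpha>}" for \<tau>
  proof -
    define l where "l = Ln (Complex 1 \<tau>)"
    have l: "exp l = Complex 1 \<tau>" unfolding l_def by (rule exp_Ln) (simp add: complex_eq_iff)
    have "Complex 1 \<tau> \<in> sector \<alpha>" using \<tau> by (auto simp: mem_sector_iff[OF \<alpha>])
    then have Im_l: "\<bar>Im l\<bar> < \<alpha>" using Ln_mem_hstrip unfolding l_def by fastforce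
    have f_eq: "ennreal a * f (Complex a (a * \<tau>)) = ennreal ((\<phi> (Complex a (a * \<tau>)))\<^sup>2 / a / (1 + \<tau>\<^sup>2))" if "0 < a" for a
    proof -
      have "(cmod (Complex a (a * \<tau>)))\<^sup>2 = a * (a * (1 + \<tau>\<^sup>2))"
        unfolding cmod_power2 by (simp add: power2_eq_square algebra_simps)
      then show ?thesis
        using that unfolding f_def by (simp add: ennreal_mult[symmetric])
    qed
    have on_ray: "Complex a (a * \<tau>) = complex_of_real a * exp l" for a
      unfolding l by (simp add: complex_eq_iff)
    have "continuous_on {0<..} (\<lambda>a. contour_calc \<gamma> (dilate F (complex_of_real (ln a) + l)) x)"
      by (rule continuous_on_compose2[OF contour_calc_shift_continuous[OF F \<theta> \<gamma>(2)]]) (use \<gamma> Im_l in \<open>auto intro!: continuous_intros\<close>)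
    then have "continuous_on {0<..} (\<lambda>a. (norm (contour_calc \<gamma> (dilate F (complex_of_real (ln a) + l)) x))\<^sup>2 / a / (1 + \<tau>\<^sup>2))"
      by (intro continuous_on_divide continuous_on_power continuous_on_norm continuous_on_id continuous_on_const)
        (auto simp: add_nonneg_eq_0_iff)
    then have "continuous_on {0<..} (\<lambda>a. (\<phi> (Complex a (a * \<tau>)))\<^sup>2 / a / (1 + \<tau>\<^sup>2))"
      by (rule continuous_on_eq) (auto simp: \<phi>_def on_ray exp_add exp_of_real)
    then have "(\<lambda>a. ennreal ((\<phi> (Complex a (a * \<tau>)))\<^sup>2 / a / (1 + \<tau>\<^sup>2)) * indicator {0<..} a) \<in> borel_measurable borel"
      by (rule borel_measurable_ennreal_on) simp
    also have "(\<lambda>a. ennreal ((\<phi> (Complex a (a * \<tau>)))\<^sup>2 / a / (1 + \<tau>\<^sup>2)) * indicator {0<..} a) = (\<lambda>a. ennreal a * f (Complex a (a * \<tau>)) * indicator {0<..} a)"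
      using f_eq by (auto simp: indicator_def)
    finally have "(\<integral>\<^sup>+a\<in>{0<..}. ennreal a * f (Complex a (a * \<tau>)) \<partial>lborel)
        = (\<integral>\<^sup>+u. ennreal (exp u) * (ennreal (exp u) * f (Complex (exp u) (exp u * \<tau>))) \<partial>lborel)"
      by (rule nn_integral_exp_subst)
    also have "\<dots> = (\<integral>\<^sup>+u. ennreal (1 / (1 + \<tau>\<^sup>2)) * ennreal ((norm (contour_calc \<gamma> (dilate F (complex_of_real u + l)) x))\<^sup>2) \<partial>lborel)"
    proof (rule nn_integral_cong)
      fix u
      have "\<phi> (Complex (exp u) (exp u * \<tau>)) = norm (contour_calc \<gamma> (dilate F (complex_of_real u + l)) x)"
        unfolding on_ray \<phi>_def by (simp add: exp_add exp_of_real)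
      then show "ennreal (exp u) * (ennreal (exp u) * f (Complex (exp u) (exp u * \<tau>)))
          = ennreal (1 / (1 + \<tau>\<^sup>2)) * ennreal ((norm (contour_calc \<gamma> (dilate F (complex_of_real u + l)) x))\<^sup>2)"
        by (subst f_eq) (auto simp: ennreal_mult[symmetric])
    qed
    also have "\<dots> = ennreal (1 / (1 + \<tau>\<^sup>2)) * I x l"
      unfolding I_def
    proof (rule nn_integral_cmult)
      have "continuous_on UNIV (\<lambda>u. contour_calc \<gamma> (dilate F (complex_of_real u + l)) x)"
        by (rule continuous_on_compose2[OF contour_calc_shift_continuous[OF F \<theta> \<gamma>(2)]]) (use \<gamma> Im_l in \<open>auto intro!: continuous_intros\<close>)
      then have "(\<lambda>u. norm (contour_calc \<gamma> (dilate F (complex_of_real u + l)) x)) \<in> borel_measurable borel"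
        by (intro borel_measurable_continuous_onI continuous_on_norm)
      then show "(\<lambda>u. ennreal ((norm (contour_calc \<gamma> (dilate F (complex_of_real u + l)) x))\<^sup>2)) \<in> borel_measurable lborel"
        by simp
    qed
    finally show ?thesis unfolding l_def .
  qed
  have "area_fn D A \<omega> \<theta> \<alpha> F x = ennsqrt (\<integral>\<^sup>+z\<in>sector \<alpha>. f z \<partial>lborel)"
    unfolding area_fn_def fc f_def \<phi>_def ..
  also have "(\<integral>\<^sup>+z\<in>sector \<alpha>. f z \<partial>lborel)
      = (\<integral>\<^sup>+\<tau>\<in>{- tan \<alpha><..<tan \<alpha>}. (\<integral>\<^sup>+a\<in>{0<..}. ennreal a * f (Complex a (a * \<tau>)) \<partial>lborel) \<partial>lborel)"
    by (rule nn_integral_sector(1)[OF meas \<alpha>])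
  also have eq: "(\<lambda>\<tau>. (\<integral>\<^sup>+a\<in>{0<..}. ennreal a * f (Complex a (a * \<tau>)) \<partial>lborel) * indicator {- tan \<alpha><..<tan \<alpha>} \<tau>)
      = (\<lambda>\<tau>. ennreal (1 / (1 + \<tau>\<^sup>2)) * I x (Ln (Complex 1 \<tau>)) * indicator {- tan \<alpha><..<tan \<alpha>} \<tau>)"
    using ray by (auto simp: indicator_def)
  finally show "area_fn D A \<omega> \<theta> \<alpha> F x
    = ennsqrt (\<integral>\<^sup>+\<tau>\<in>{- tan \<alpha><..<tan \<alpha>}. ennreal (1 / (1 + \<tau>\<^sup>2)) * I x (Ln (Complex 1 \<tau>)) \<partial>lborel)" .
  show "(\<lambda>\<tau>. ennreal (1 / (1 + \<tau>\<^sup>2)) * I x (Ln (Complex 1 \<tau>)) * indicator {- tan \<alpha><..<tan \<alpha>} \<tau>) \<in> borel_measurable borel"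
    using nn_integral_sector(2)[OF meas \<alpha>] unfolding eq .
qed

lemma slope_measure:
  assumes "0 < T"
  obtains W where "0 < W" "(\<integral>\<^sup>+\<tau>\<in>{- T<..<T}. ennreal (1 / (1 + \<tau>\<^sup>2)) \<partial>lborel) = ennreal W"
proof -
  let ?W = "\<integral>\<^sup>+\<tau>\<in>{- T<..<T}. ennreal (1 / (1 + \<tau>\<^sup>2)) \<partial>lborel"
  have "?W \<le> (\<integral>\<^sup>+\<tau>. indicator {- T<..<T} \<tau> \<partial>lborel)"
  proof (rule nn_integral_mono)
    fix \<tau> :: real
    have "0 < 1 + \<tau>\<^sup>2" by (simp add: add_pos_nonneg)
    then have "1 / (1 + \<tau>\<^sup>2) \<le> 1" by (simp add: divide_le_eq)
    then show "ennreal (1 / (1 + \<tau>\<^sup>2)) * indicator {- T<..<T} \<tau> \<le> indicator {- T<..<T} \<tau>"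
      by (auto simp: indicator_def)
  qed
  also have "\<dots> = ennreal (2 * T)" using assms by (simp add: nn_integral_indicator)
  finally have up: "?W \<le> ennreal (2 * T)" .
  have "(\<integral>\<^sup>+\<tau>. ennreal (1 / (1 + T\<^sup>2)) * indicator {- T<..<T} \<tau> \<partial>lborel) \<le> ?W"
  proof (intro nn_integral_mono)
    fix \<tau> :: real
    show "ennreal (1 / (1 + T\<^sup>2)) * indicator {- T<..<T} \<tau> \<le> ennreal (1 / (1 + \<tau>\<^sup>2)) * indicator {- T<..<T} \<tau>"
    proof (cases "\<tau> \<in> {- T<..<T}")
      case True
      then have "\<tau>\<^sup>2 \<le> T\<^sup>2" by (intro abs_le_square_iff[THEN iffD1]) auto
      then show ?thesis
        by (intro mult_right_mono ennreal_leI divide_left_mono add_left_mono mult_pos_pos) (auto intro: add_pos_nonneg)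
    qed simp
  qed
  also have "(\<integral>\<^sup>+\<tau>. ennreal (1 / (1 + T\<^sup>2)) * indicator {- T<..<T} \<tau> \<partial>lborel) = ennreal (1 / (1 + T\<^sup>2)) * ennreal (2 * T)"
    using assms by (subst nn_integral_cmult_indicator) auto
  also have "\<dots> = ennreal (2 * T / (1 + T\<^sup>2))"
    using assms by (simp add: ennreal_mult[symmetric])
  finally have low: "ennreal (2 * T / (1 + T\<^sup>2)) \<le> ?W" .
  have pos: "0 < 2 * T / (1 + T\<^sup>2)" using assms by (auto intro!: divide_pos_pos add_pos_nonneg)
  obtain W where W: "?W = ennreal W" "0 \<le> W"
    using up by (cases ?W) (auto simp: top_unique)
  have "2 * T / (1 + T\<^sup>2) \<le> W" using low W pos by simp
  then show thesis using that[of W] W pos by linarith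
qed

theorem mainTheorem3:
  fixes D :: "'a::complex_hilbert set" and A :: "'a \<Rightarrow> 'a"
    and \<omega> \<theta> \<alpha> :: real and F G :: "complex \<Rightarrow> complex"
  assumes "0 < \<omega>" and "\<omega> < pi"
    and "sectorial \<omega> D A"
    and "inj_on A D"
    and "\<omega> < \<theta>" and "\<theta> < pi"
    and "0 < \<alpha>" and "\<alpha> < (\<theta> - \<omega>) / 2"
    and "F \<in> Hinf0 \<theta>" and "\<exists>z\<in>sector \<theta>. F z \<noteq> 0"
    and "G \<in> Hinf0 \<theta>" and "\<exists>z\<in>sector \<theta>. G z \<noteq> 0"
  shows "\<exists>C::real. C > 0 \<and>
    (\<forall>x. ennreal (1 / C) * square_fn D A \<omega> \<theta> G x \<le> area_fn D A \<omega> \<theta> \<alpha> F x \<and>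
         area_fn D A \<omega> \<theta> \<alpha> F x \<le> ennreal C * square_fn D A \<omega> \<theta> G x)"
proof -
  interpret sectorial_operator D A \<omega>
    by unfold_locales (use assms in auto)
  have \<theta>: "\<theta> \<le> pi" and \<alpha>: "0 < \<alpha>" "\<alpha> < pi / 2" "\<omega> < \<theta> - \<alpha>" "0 < tan \<alpha>"
    using assms by (auto intro!: tan_gt_zero)
  have F: "strip_fun \<theta> (\<lambda>w. F (exp w))" and G: "strip_fun \<theta> (\<lambda>w. G (exp w))"
    using assms \<theta> by (auto intro: Hinf0_strip_fun)
  obtain wF where wF: "wF \<in> hstrip (- \<theta>) \<theta>" "F (exp wF) \<noteq> 0"
    using assms(10) Ln_mem_hstrip by metis
  obtain wG where wG: "wG \<in> hstrip (- \<theta>) \<theta>" "G (exp wG) \<noteq> 0"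
    using assms(12) Ln_mem_hstrip by metis
  define \<gamma>G where "\<gamma>G = (SOME \<gamma>. \<omega> < \<gamma> \<and> \<gamma> < \<theta>)"
  define \<gamma>F where "\<gamma>F = (SOME \<gamma>. \<omega> < \<gamma> \<and> \<gamma> < \<theta> - \<alpha>)"
  have \<gamma>G: "\<omega> < \<gamma>G" "\<gamma>G < \<theta>"
    unfolding \<gamma>G_def using someI_ex[OF dense[OF assms(5)]] by auto
  have \<gamma>F: "\<omega> < \<gamma>F" "\<gamma>F < \<theta> - \<alpha>"
    unfolding \<gamma>F_def using someI_ex[OF dense[OF \<alpha>(3)]] by auto
  define SG where "SG x = (\<integral>\<^sup>+u. ennreal ((norm (contour_calc \<gamma>G (dilate G (of_real u)) x))\<^sup>2) \<partial>lborel)" for x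
  define IF where "IF x l = sq_int \<gamma>F F l x" for x l
  define T where "T = {- tan \<alpha><..<tan \<alpha>}"
  define AF where "AF x = (\<integral>\<^sup>+\<tau>\<in>T. ennreal (1 / (1 + \<tau>\<^sup>2)) * IF x (Ln (Complex 1 \<tau>)) \<partial>lborel)" for x
  have square: "square_fn D A \<omega> \<theta> G x = ennsqrt (SG x)" for x
    unfolding SG_def by (rule square_fn_eq[OF G \<theta> \<gamma>G_def \<gamma>G])
  have area: "area_fn D A \<omega> \<theta> \<alpha> F x = ennsqrt (AF x)" for x
    unfolding AF_def IF_def T_def by (rule area_fn_eq(1)[OF F \<theta> \<alpha>(1,2) \<gamma>F_def \<gamma>F])
  have AF_meas: "(\<lambda>\<tau>. ennreal (1 / (1 + \<tau>\<^sup>2)) * IF x (Ln (Complex 1 \<tau>)) * indicator T \<tau>) \<in> borel_measurable borel" for x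
    unfolding IF_def T_def by (rule area_fn_eq(2)[OF F \<theta> \<alpha>(1,2) \<gamma>F_def \<gamma>F])
  obtain M1 where "0 < M1" and m1: "\<And>l1 l2 x. \<bar>Im l1\<bar> \<le> \<alpha> \<Longrightarrow> \<bar>Im l2\<bar> \<le> 0 \<Longrightarrow>
      sq_int \<gamma>F F l1 x
      \<le> ennreal M1 * sq_int \<gamma>G G l2 x"
    by (rule square_functions_comparable[OF F G \<theta> _ _ \<gamma>F \<gamma>G(1) _ wG, of 0]) (use \<alpha> \<gamma>G in auto)
  then have M1: "0 < M1" "\<bar>Im l\<bar> \<le> \<alpha> \<Longrightarrow> IF x l \<le> ennreal M1 * SG x" for l x
    using m1[of l 0 x] by (simp_all add: IF_def SG_def)
  obtain M2 where "0 < M2" and m2: "\<And>l1 l2 x. \<bar>Im l1\<bar> \<le> 0 \<Longrightarrow> \<bar>Im l2\<bar> \<le> \<alpha> \<Longrightarrow>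
      sq_int \<gamma>G G l1 x
      \<le> ennreal M2 * sq_int \<gamma>F F l2 x"
    by (rule square_functions_comparable[OF G F \<theta> _ _ \<gamma>G(1) _ \<gamma>F wF, of 0]) (use \<alpha> \<gamma>G in auto)
  then have M2: "0 < M2" "\<bar>Im l\<bar> \<le> \<alpha> \<Longrightarrow> SG x \<le> ennreal M2 * IF x l" for l x
    using m2[of 0 l x] by (simp_all add: IF_def SG_def)
  obtain W where W: "0 < W" "(\<integral>\<^sup>+\<tau>\<in>T. ennreal (1 / (1 + \<tau>\<^sup>2)) \<partial>lborel) = ennreal W"
    unfolding T_def using slope_measure[OF \<alpha>(4)] by blast
  have W_mult: "(\<integral>\<^sup>+\<tau>. k * (ennreal (1 / (1 + \<tau>\<^sup>2)) * indicator T \<tau>) \<partial>lborel) = k * ennreal W" for k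
    unfolding W(2)[symmetric] by (rule nn_integral_cmult) (auto simp: T_def)
  have Im_le: "\<bar>Im (Ln (Complex 1 \<tau>))\<bar> \<le> \<alpha>" if "\<tau> \<in> T" for \<tau>
  proof -
    have "Complex 1 \<tau> \<in> sector \<alpha>" using that \<alpha> by (auto simp: mem_sector_iff T_def)
    from Ln_mem_hstrip[OF this] show ?thesis by auto
  qed
  have upper: "AF x \<le> ennreal (M1 * W) * SG x" for x
  proof -
    have "AF x \<le> (\<integral>\<^sup>+\<tau>. (ennreal M1 * SG x) * (ennreal (1 / (1 + \<tau>\<^sup>2)) * indicator T \<tau>) \<partial>lborel)"
      unfolding AF_def
    proof (rule nn_integral_mono)
      fix \<tau>
      show "ennreal (1 / (1 + \<tau>\<^sup>2)) * IF x (Ln (Complex 1 \<tau>)) * indicator T \<tau> \<le> (ennreal M1 * SG x) * (ennreal (1 / (1 + \<tau>\<^sup>2)) * indicator T \<tau>)"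
      proof (cases "\<tau> \<in> T")
        case True
        then show ?thesis using M1(2)[OF Im_le[OF True], of x] by (simp add: mult.commute mult_right_mono)
      qed simp
    qed
    then show ?thesis
      unfolding W_mult using M1(1) W(1) by (simp add: ennreal_mult mult_ac)
  qed
  have lower: "SG x * ennreal W \<le> ennreal M2 * AF x" for x
  proof -
    have "SG x * ennreal W = (\<integral>\<^sup>+\<tau>. SG x * (ennreal (1 / (1 + \<tau>\<^sup>2)) * indicator T \<tau>) \<partial>lborel)"
      by (rule W_mult[symmetric])
    also have "\<dots> \<le> (\<integral>\<^sup>+\<tau>. ennreal M2 * (ennreal (1 / (1 + \<tau>\<^sup>2)) * IF x (Ln (Complex 1 \<tau>)) * indicator T \<tau>) \<partial>lborel)"
    proof (rule nn_integral_mono)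
      fix \<tau>
      show "SG x * (ennreal (1 / (1 + \<tau>\<^sup>2)) * indicator T \<tau>) \<le> ennreal M2 * (ennreal (1 / (1 + \<tau>\<^sup>2)) * IF x (Ln (Complex 1 \<tau>)) * indicator T \<tau>)"
      proof (cases "\<tau> \<in> T")
        case True
        have "ennreal (1 / (1 + \<tau>\<^sup>2)) * SG x \<le> ennreal (1 / (1 + \<tau>\<^sup>2)) * (ennreal M2 * IF x (Ln (Complex 1 \<tau>)))"
          by (intro mult_left_mono M2(2) Im_le True) simp
        then show ?thesis using True by (simp add: mult_ac)
      qed simp
    qed
    also have "\<dots> = ennreal M2 * AF x"
      unfolding AF_def by (rule nn_integral_cmult) (use AF_meas in simp)
    finally show ?thesis .
  qed
  define C where "C = sqrt (M1 * W + M2 / W)"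
  have C: "0 < C" "C\<^sup>2 = M1 * W + M2 / W"
    unfolding C_def using M1(1) M2(1) W(1) by (auto intro!: add_pos_pos)
  have "ennsqrt (AF x) \<le> ennreal C * ennsqrt (SG x)" for x
  proof (rule ennsqrt_le[OF order_trans[OF upper] C(1)])
    show "ennreal (M1 * W) * SG x \<le> ennreal (C\<^sup>2) * SG x"
      unfolding C using M2(1) W(1) by (intro mult_right_mono ennreal_leI) auto
  qed
  moreover have "ennreal (1 / C) * ennsqrt (SG x) \<le> ennsqrt (AF x)" for x
  proof -
    have "SG x = ennreal (1 / W) * (SG x * ennreal W)"
      using W(1) by (simp add: mult.left_commute[of _ "SG x"] ennreal_mult[symmetric])
    also have "\<dots> \<le> ennreal (1 / W) * (ennreal M2 * AF x)"
      by (intro mult_left_mono lower) simp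
    also have "\<dots> = ennreal (M2 / W) * AF x"
      using W(1) M2(1) by (simp add: mult.assoc[symmetric] ennreal_mult[symmetric])
    also have "\<dots> \<le> ennreal (C\<^sup>2) * AF x"
      unfolding C using M1(1) W(1) by (intro mult_right_mono ennreal_leI) auto
    finally have "ennsqrt (SG x) \<le> ennreal C * ennsqrt (AF x)"
      using C(1) by (rule ennsqrt_le)
    then have "ennreal (1 / C) * ennsqrt (SG x) \<le> ennreal (1 / C) * (ennreal C * ennsqrt (AF x))"
      by (intro mult_left_mono) auto
    also have "\<dots> = ennsqrt (AF x)"
      using C(1) by (simp add: mult.assoc[symmetric] ennreal_mult[symmetric])
    finally show ?thesis .
  qed
  ultimately show ?thesis
    unfolding square area using C(1) by blast
qed

end
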